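(* Let $n\ge1$. For every simplified grove $G$ of size $n$ there is a finite sequence of simplified groves $G=G_0,G_1,\dots,G_k$ of size $n$ such that each $G_{t+1}$ is obtained from $G_t$ by a clockwise spin and $G_k$ is the target grove of size $n$.
   Context: Let $V_n=\{(i,j)\in\mathbb{Z}^2 : |i|+|j|\le n,\ j\le 0,\ i+j\equiv n \pmod 2\}$. Two points of $V_n$ are joined by a lattice edge if they differ by $(\pm 2,0)$ or by $(\pm1,\pm1)$. A simplified grove of size $n$ is a graph $G$ with vertex set $V_n$ whose edges are lattice edges, such that (acyclicity) $G$ has no cycle, and (connectivity) each connected component of $G$ contains exactly one of the following sets of boundary vertices and each of these sets is contained in some component: the singletons $\{(-n,0)\},\{(n,0)\},\{(0,-n)\}$; the west pairs $\{(-i,0),(\frac{-n-i}{2},\frac{-n+i}{2})\}$ for $0<i<n$, $i\equiv n \pmod 2$; the east pairs $\{(i,0),(\frac{n+i}{2},\frac{-n+i}{2})\}$ for $0<i<n$, $i\equiv n\pmod 2$; the south pairs $\{(-n+i,-i),(n-i,-i)\}$ for $\frac n2<i<n$; and, if $n$ is even, the middle triplet $\{(0,0),(-\frac n2,-\frac n2),(\frac n2,-\frac n2)\}$. The target grove of size $n$ is the simplified grove of size $n$ whose edges are exactly: (i) for each $0\le i<n$ with $i\equiv n\pmod 2$, with $d=(n-i)/2$, the edges $\{(-i+t,-t),(-i+t+1,-t-1)\}$ for $0\le t<d$ and $\{(-i+d-2s,-d),(-i+d-2s-2,-d)\}$ for $0\le s<d$; (ii) for each $0<i<n$ with $i\equiv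 n\pmod 2$, with $d=(n-i)/2$, the edges $\{(i+t,-t),(i+t+1,-t-1)\}$ for $0\le t<d$; (iii) for each $\frac n2<i<n$, the edges $\{(-n+i+2s,-i),(-n+i+2s+2,-i)\}$ for $0\le s<n-i$. Clockwise spins: for a vertex $p=(x,y)$, list its six potential neighbours in the clockwise cyclic order $UL=(x-1,y+1)$, $UR=(x+1,y+1)$, $R=(x+2,y)$, $DR=(x+1,y-1)$, $DL=(x-1,y-1)$, $L=(x-2,y)$, followed again by $UL$. A simplified grove $G'$ is obtained from a simplified grove $G$ by a clockwise spin with pivot $p$ if there are $u,v\in V_n$ with $v$ immediately following $u$ in this cyclic order, $\{p,u\}$ an edge of $G$ and $\{p,v\}$ not an edge of $G$, such that $G'$ is obtained from $G$ by deleting the edge $\{p,u\}$ and adding the edge $\{p,v\}$. *)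

theory Defs
  imports Main
begin

text \<open>A finite simple graph is given by a vertex set together with a set of
  two-element sets of vertices, its edges.\<close>

type_synonym point = "int \<times> int"

definition adjacency :: "'a set set \<Rightarrow> ('a \<times> 'a) set" where
  "adjacency E = {(u, v). {u, v} \<in> E}"

definition components :: "'a set \<Rightarrow> 'a set set \<Rightarrow> 'a set set" where
  "components V E = {C. \<exists>v\<in>V. C = {w \<in> V. (v, w) \<in> (adjacency E)\<^sup>*}}"

definition is_cycle :: "'a set set \<Rightarrow> 'a list \<Rightarrow> bool" where
  "is_cycle E vs \<longleftrightarrow> 3 \<le> length vs \<and> distinct vs \<and>
     (\<forall>i<length vs. {vs ! i, vs ! (Suc i mod length vs)} \<in> E)"

definition grove_vertices :: "nat \<Rightarrow> point set" where
  "grove_vertices n =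
     {(i, j). \<bar>i\<bar> + \<bar>j\<bar> \<le> int n \<and> j \<le> 0 \<and> (i + j) mod 2 = int n mod 2}"

definition lattice_adjacent :: "point \<Rightarrow> point \<Rightarrow> bool" where
  "lattice_adjacent p q \<longleftrightarrow>
     (fst q - fst p, snd q - snd p) \<in> {(2, 0), (-2, 0), (1, 1), (1, -1), (-1, 1), (-1, -1)}"

definition lattice_edges :: "nat \<Rightarrow> point set set" where
  "lattice_edges n =
     {{p, q} |p q. p \<in> grove_vertices n \<and> q \<in> grove_vertices n \<and> lattice_adjacent p q}"

text \<open>Every \<open>div 2\<close> below is applied to an even number.\<close>

definition corner_singletons :: "nat \<Rightarrow> point set set" where
  "corner_singletons n = {{(- int n, 0)}, {(int n, 0)}, {(0, - int n)}}"

definition west_pairs :: "nat \<Rightarrow> point set set" where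
  "west_pairs n =
     {{(- i, 0), ((- int n - i) div 2, (- int n + i) div 2)} |i.
        0 < i \<and> i < int n \<and> i mod 2 = int n mod 2}"

definition east_pairs :: "nat \<Rightarrow> point set set" where
  "east_pairs n =
     {{(i, 0), ((int n + i) div 2, (- int n + i) div 2)} |i.
        0 < i \<and> i < int n \<and> i mod 2 = int n mod 2}"

definition south_pairs :: "nat \<Rightarrow> point set set" where
  "south_pairs n =
     {{(- int n + i, - i), (int n - i, - i)} |i. int n < 2 * i \<and> i < int n}"

definition middle_triplets :: "nat \<Rightarrow> point set set" where
  "middle_triplets n =
     (if even n
      then {{(0, 0), (- (int n div 2), - (int n div 2)), (int n div 2, - (int n div 2))}}
      else {})"

definition boundary_sets :: "nat \<Rightarrow> point set set" where
  "boundary_sets n = corner_singletons n \<union> west_pairs n \<union> east_pairs n \<union>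
     south_pairs n \<union> middle_triplets n"

definition simplified_grove :: "nat \<Rightarrow> point set set \<Rightarrow> bool" where
  "simplified_grove n G \<longleftrightarrow>
     G \<subseteq> lattice_edges n \<and>
     (\<nexists>vs. is_cycle G vs) \<and>
     (\<forall>C \<in> components (grove_vertices n) G. \<exists>!S. S \<in> boundary_sets n \<and> S \<subseteq> C) \<and>
     (\<forall>S \<in> boundary_sets n. \<exists>C \<in> components (grove_vertices n) G. S \<subseteq> C)"

definition target_grove :: "nat \<Rightarrow> point set set" where
  "target_grove n =
     {{(- i + t, - t), (- i + t + 1, - t - 1)} |i t.
        0 \<le> i \<and> i < int n \<and> i mod 2 = int n mod 2 \<and> 0 \<le> t \<and> t < (int n - i) div 2} \<union>
     {{(- i + d - 2 * s, - d), (- i + d - 2 * s - 2, - d)} |i d s.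
        0 \<le> i \<and> i < int n \<and> i mod 2 = int n mod 2 \<and> d = (int n - i) div 2 \<and> 0 \<le> s \<and> s < d} \<union>
     {{(i + t, - t), (i + t + 1, - t - 1)} |i t.
        0 < i \<and> i < int n \<and> i mod 2 = int n mod 2 \<and> 0 \<le> t \<and> t < (int n - i) div 2} \<union>
     {{(- int n + i + 2 * s, - i), (- int n + i + 2 * s + 2, - i)} |i s.
        int n < 2 * i \<and> i < int n \<and> 0 \<le> s \<and> s < int n - i}"

definition clockwise_neighbours :: "point \<Rightarrow> point list" where
  "clockwise_neighbours p = (case p of (x, y) \<Rightarrow>
     [(x - 1, y + 1), (x + 1, y + 1), (x + 2, y), (x + 1, y - 1), (x - 1, y - 1), (x - 2, y)])"

definition clockwise_next :: "point \<Rightarrow> point \<Rightarrow> point \<Rightarrow> bool" where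
  "clockwise_next p u v \<longleftrightarrow>
     (\<exists>k<6. u = clockwise_neighbours p ! k \<and> v = clockwise_neighbours p ! (Suc k mod 6))"

definition clockwise_spin_at ::
  "nat \<Rightarrow> point \<Rightarrow> point set set \<Rightarrow> point set set \<Rightarrow> bool" where
  "clockwise_spin_at n p G G' \<longleftrightarrow>
     simplified_grove n G \<and> simplified_grove n G' \<and> p \<in> grove_vertices n \<and>
     (\<exists>u \<in> grove_vertices n. \<exists>v \<in> grove_vertices n.
        clockwise_next p u v \<and> {p, u} \<in> G \<and> {p, v} \<notin> G \<and>
        G' = (G - {{p, u}}) \<union> {{p, v}})"

definition clockwise_spin :: "nat \<Rightarrow> point set set \<Rightarrow> point set set \<Rightarrow> bool" where
  "clockwise_spin n G G' \<longleftrightarrow> (\<exists>p. clockwise_spin_at n p G G')"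

end

theory Submission
  imports Defs
begin

text \<open>Orient each branch that contains no boundary vertex towards the rest of its component. The
  edge leaving such a branch can be turned clockwise to any neighbour, because an obstruction can only
  come from a smaller branch of the same kind. So everything off the paths joining boundary vertices
  can be rearranged at will, and a path can be pushed across any triangle whose third vertex is free.

  In the coordinates \<open>(c, t)\<close> used below, the target grove consists of the shells \<open>max c t = d\<close>. The
  shells are filled in the order of decreasing \<open>d\<close>: among all reachable groves that keep the outer
  shells, take one in which the path to be moved has least weight, where edges of small \<open>c + t\<close> are
  heavy. If this path left its shell, then an edge of it with least \<open>c + t\<close> could be pushed outwards,
  since by a parity version of the Jordan curve theorem the third vertex of the triangle belongs to the
  path or is free. Once all shells are filled, no vertex is left over and the grove is the target.\<close>

section \<open>Connectivity and acyclicity\<close>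

text \<open>A spin must return a grove. Two situations guarantee this, isolated in
  \<open>grove_swap\<close>: the exchanged ends stay connected, or the moved piece has no boundary
  vertex. All rearrangements are reduced to these. What is free is measured against a set
  \<open>C\<close> whose connections run inside \<open>C\<close> (\<open>solid\<close>): a component
  of the complement of \<open>C\<close> without boundary vertices (\<open>pocket\<close>) can be
  rearranged, and every path between vertices of \<open>C\<close> or of the boundary survives. The
  order of the shells matters because the label of a boundary vertex records its shell: once all
  shells beyond \<open>d\<close> are finished, the component of shell \<open>d\<close> cannot enter
  them, so they act as a wall and can be added to \<open>C\<close>. The moved path is open, so its
  crossing parity is meaningful only where the ray does not separate its two ends; this explains the
  conditions on ends in the section on crossing parity and the last assumption of
  \<open>stage\<close>.\<close>

abbreviation con :: "'a set set \<Rightarrow> 'a \<Rightarrow> 'a \<Rightarrow> bool" where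
  "con G x y \<equiv> (x, y) \<in> (adjacency G)\<^sup>*"

lemma con_trans: "con G x y \<Longrightarrow> con G y z \<Longrightarrow> con G x z"
  by (rule rtrancl_trans)

lemma con_edge: "{x, y} \<in> G \<Longrightarrow> con G x y"
  by (auto simp: adjacency_def)

lemma con_sym: "con G x y \<Longrightarrow> con G y x"
proof -
  have "sym (adjacency G)" by (auto simp: sym_def adjacency_def insert_commute)
  then show "con G x y \<Longrightarrow> con G y x" by (meson sym_rtrancl symD)
qed

lemma con_mono: "con G x y \<Longrightarrow> G \<subseteq> H \<Longrightarrow> con H x y"
proof -
  assume "con G x y" "G \<subseteq> H"
  moreover from this have "adjacency G \<subseteq> adjacency H" by (auto simp: adjacency_def)
  ultimately show "con H x y" using rtrancl_mono by blast
qed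

lemma con_insertD:
  assumes "con (insert {p, u} H) z b"
  shows "con H z b \<or> (con H z p \<and> con H u b) \<or> (con H z u \<and> con H p b)"
  using assms
proof (induction rule: rtrancl_induct)
  case base
  then show ?case by simp
next
  case (step y w)
  then consider "{y, w} = {p, u}" | "{y, w} \<in> H" by (auto simp: adjacency_def)
  then show ?case
  proof cases
    case 1
    then show ?thesis using step.IH by (metis doubleton_eq_iff rtrancl.rtrancl_refl)
  next
    case 2
    then show ?thesis using step.IH by (meson con_edge con_trans)
  qed
qed

lemma con_leave:
  assumes "con G z b" "z \<in> K" "b \<notin> K"
  obtains k u where "k \<in> K" "u \<notin> K" "{k, u} \<in> G" "con G z k" "con G z u"
proof -
  have "b \<in> K \<or> (\<exists>k u. k \<in> K \<and> u \<notin> K \<and> {k, u} \<in> G \<and> con G z k \<and> con G z u)"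
    using assms(1)
  proof (induction rule: rtrancl_induct)
    case base
    then show ?case using assms by simp
  next
    case (step y w)
    then show ?case
      by (metis (mono_tags, lifting) adjacency_def case_prodD mem_Collect_eq rtrancl.rtrancl_into_rtrancl)
  qed
  then show thesis using assms that by blast
qed

text \<open>Follow the connection from its last visit to \<open>z\<close>: the edge leaving
  \<open>z\<close> there is the wanted one, and what follows never returns to
  \<open>z\<close>.\<close>

lemma con_first_edge:
  assumes "con H z k" "k \<noteq> z"
  obtains w where "{z, w} \<in> H" "con {e \<in> H. z \<notin> e} w k"
proof -
  have "k \<noteq> z \<longrightarrow> (\<exists>w. {z, w} \<in> H \<and> con {e \<in> H. z \<notin> e} w k)"
    using assms(1)
  proof (induction rule: rtrancl_induct)
    case base
    then show ?case by simp
  next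
    case (step y k')
    have e: "{y, k'} \<in> H" using step by (simp add: adjacency_def)
    show ?case
    proof (cases "y = z")
      case True
      then show ?thesis using e by blast
    next
      case False
      show ?thesis
      proof
        assume "k' \<noteq> z"
        then have "{y, k'} \<in> {e \<in> H. z \<notin> e}" using False e by auto
        then show "\<exists>w. {z, w} \<in> H \<and> con {e \<in> H. z \<notin> e} w k'"
          using step.IH False by (meson con_edge con_trans)
      qed
    qed
  qed
  then show thesis using assms that by blast
qed

text \<open>Forests are encoded by the condition that every edge is a bridge, the form in which
  deleting and adding single edges can be analysed; \<open>no_cycle_iff_acyc\<close> compares it
  with cycles as vertex lists.\<close>

definition acyc :: "'a set set \<Rightarrow> bool" where
  "acyc G \<longleftrightarrow> (\<forall>x y. {x, y} \<in> G \<longrightarrow> x \<noteq> y \<and> \<not> con (G - {{x, y}}) x y)"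

lemma acycD: "acyc G \<Longrightarrow> {x, y} \<in> G \<Longrightarrow> \<not> con (G - {{x, y}}) x y"
  by (simp add: acyc_def)

lemma acyc_mono: "acyc G \<Longrightarrow> H \<subseteq> G \<Longrightarrow> acyc H"
  unfolding acyc_def
  by (metis (no_types, lifting) Diff_mono con_mono order_refl subsetD)

lemma acyc_insert:
  assumes "acyc H" "\<not> con H p v"
  shows "acyc (insert {p, v} H)"
  unfolding acyc_def
proof (intro allI impI)
  fix x y assume xy: "{x, y} \<in> insert {p, v} H"
  show "x \<noteq> y \<and> \<not> con (insert {p, v} H - {{x, y}}) x y"
  proof (cases "{x, y} = {p, v}")
    case True
    then have "\<not> con H x y" using assms(2) by (metis con_sym doubleton_eq_iff)
    moreover have "insert {p, v} H - {{x, y}} \<subseteq> H" using True by auto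
    ultimately have "\<not> con (insert {p, v} H - {{x, y}}) x y"
      using con_mono[where H = H] by blast
    then show ?thesis by auto
  next
    case False
    then have e: "{x, y} \<in> H" using xy by auto
    have eq: "insert {p, v} H - {{x, y}} = insert {p, v} (H - {{x, y}})" using False by auto
    have "\<not> con (insert {p, v} (H - {{x, y}})) x y"
    proof
      assume c: "con (insert {p, v} (H - {{x, y}})) x y"
      have "(con (H - {{x, y}}) x p \<and> con (H - {{x, y}}) v y) \<or>
          (con (H - {{x, y}}) x v \<and> con (H - {{x, y}}) p y)"
        using con_insertD[OF c] acycD[OF assms(1) e] by blast
      then have "(con H x p \<and> con H v y) \<or> (con H x v \<and> con H p y)"
        using con_mono[of _ _ "H - {{x, y}}" H] by blast
      then have "con H p v"
        using con_edge[OF e] by (meson con_sym con_trans)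
      then show False using assms by simp
    qed
    then show ?thesis using assms(1) e eq by (simp add: acyc_def)
  qed
qed

subsection \<open>Walks\<close>

abbreviation walk :: "'a set set \<Rightarrow> 'a list \<Rightarrow> bool" where
  "walk G ps \<equiv> successively (\<lambda>p q. {p, q} \<in> G) ps"

lemma walk_con: "walk G ps \<Longrightarrow> p \<in> set ps \<Longrightarrow> con G (hd ps) p"
proof (induction ps)
  case (Cons a ps)
  then show ?case
    by (cases ps) (auto intro: con_trans con_edge)
qed simp

lemma walk_mono: "walk G ps \<Longrightarrow> (\<And>p q. p \<in> set ps \<Longrightarrow> q \<in> set ps \<Longrightarrow> {p, q} \<in> G \<Longrightarrow> {p, q} \<in> H) \<Longrightarrow> walk H ps"
  by (auto intro: successively_mono)

lemma walk_rev: "walk G (rev ps) = walk G ps"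
  by (simp add: insert_commute)

lemma con_imp_walk:
  assumes "con G x y"
  obtains ps where "walk G ps" "distinct ps" "ps \<noteq> []" "hd ps = x" "last ps = y"
proof -
  have "\<exists>ps. walk G ps \<and> distinct ps \<and> ps \<noteq> [] \<and> hd ps = x \<and> last ps = y"
    using assms
  proof (induction rule: rtrancl_induct)
    case base
    then show ?case by (intro exI[of _ "[x]"]) auto
  next
    case (step y z)
    then obtain ps where ps: "walk G ps" "distinct ps" "ps \<noteq> []" "hd ps = x" "last ps = y" by blast
    show ?case
    proof (cases "z \<in> set ps")
      case True
      then obtain as bs where ab: "ps = as @ z # bs" by (meson split_list)
      then have "walk G (as @ [z])" using ps(1) by (auto simp: successively_append_iff)
      then show ?thesis using ps ab
        by (intro exI[of _ "as @ [z]"]) (auto simp: hd_append split: if_splits)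
    next
      case False
      have "{y, z} \<in> G" using step by (simp add: adjacency_def)
      then show ?thesis using ps False
        by (intro exI[of _ "ps @ [z]"]) (auto simp: successively_append_iff)
    qed
  qed
  then show thesis using that by blast
qed

lemma no_cycle_iff_acyc:
  assumes "\<And>x y. {x, y} \<in> G \<Longrightarrow> x \<noteq> y"
  shows "(\<nexists>vs. is_cycle G vs) \<longleftrightarrow> acyc G"
proof
  assume nc: "\<nexists>vs. is_cycle G vs"
  show "acyc G" unfolding acyc_def
  proof (intro allI impI conjI)
    fix x y assume e: "{x, y} \<in> G"
    then show xy: "x \<noteq> y" using assms by blast
    show "\<not> con (G - {{x, y}}) x y"
    proof
      assume "con (G - {{x, y}}) x y"
      then obtain ps where ps: "walk (G - {{x, y}}) ps" "distinct ps" "ps \<noteq> []" "hd ps = x" "last ps = y"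
        by (rule con_imp_walk)
      \<comment> \<open>A path of two vertices would be the deleted edge itself, so the path is long
        enough to count as a cycle.\<close>
      have len: "3 \<le> length ps"
      proof (rule ccontr)
        assume "\<not> 3 \<le> length ps"
        moreover have "length ps \<noteq> 0" using ps(3) by simp
        ultimately consider "length ps = 1" | "length ps = 2" by linarith
        then show False
        proof cases
          case 1
          then obtain a where "ps = [a]" by (auto simp: length_Suc_conv)
          then show False using ps xy by auto
        next
          case 2
          then obtain a b where "ps = [a, b]" by (auto simp: length_Suc_conv numeral_2_eq_2)
          then show False using ps by auto
        qed
      qed
      have "{ps ! i, ps ! (Suc i mod length ps)} \<in> G" if "i < length ps" for i
      proof (cases "Suc i = length ps")
        case True
        then have "ps ! i = y" using ps by (metis diff_Suc_1 last_conv_nth)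
        moreover have "ps ! 0 = x" using ps by (simp add: hd_conv_nth)
        ultimately show ?thesis using True e by (simp add: insert_commute)
      next
        case False
        then have "Suc i < length ps" using that by simp
        then show ?thesis using ps(1) by (auto simp: successively_conv_nth)
      qed
      then have "is_cycle G ps" using len ps by (simp add: is_cycle_def)
      then show False using nc by blast
    qed
  qed
next
  assume ac: "acyc G"
  show "\<nexists>vs. is_cycle G vs"
  proof
    assume "\<exists>vs. is_cycle G vs"
    then obtain vs where vs: "3 \<le> length vs" "distinct vs"
      "\<And>i. i < length vs \<Longrightarrow> {vs ! i, vs ! (Suc i mod length vs)} \<in> G"
      by (auto simp: is_cycle_def)
    define L where "L = length vs - 1"
    have L: "2 \<le> L" "length vs = Suc L" using vs(1) by (auto simp: L_def)
    let ?e = "{vs ! 0, vs ! L}"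
    have e: "?e \<in> G" using vs(3)[of L] L by (simp add: insert_commute)
    have "con (G - {?e}) (vs ! 0) (vs ! i)" if "i \<le> L" for i
      using that
    proof (induction i)
      case (Suc i)
      have "{vs ! i, vs ! Suc i} \<in> G" using vs(3)[of i] Suc L by simp
      moreover have "{vs ! i, vs ! Suc i} \<noteq> ?e"
        using vs(2) Suc L by (auto simp: doubleton_eq_iff nth_eq_iff_index_eq)
      ultimately have "con (G - {?e}) (vs ! i) (vs ! Suc i)" by (intro con_edge) auto
      then show ?case using Suc con_trans by fastforce
    qed simp
    then show False using acycD[OF ac e] by blast
  qed
qed

section \<open>Groves in triangular coordinates\<close>

text \<open>Barycentric coordinates: \<open>(c, t)\<close> is the point \<open>(2 c - n + t, - t)\<close> of the
  original picture, so \<open>c\<close> counts steps to the right and \<open>t\<close> steps along the south-east direction.\<close>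

definition tri :: "nat \<Rightarrow> point set" where
  "tri n = {(c, t). 0 \<le> c \<and> 0 \<le> t \<and> c + t \<le> int n}"

definition side :: "nat \<Rightarrow> point set" where
  "side n = {(c, t) \<in> tri n. c = 0 \<or> t = 0 \<or> c + t = int n}"

definition ladj :: "point \<Rightarrow> point \<Rightarrow> bool" where
  "ladj p q \<longleftrightarrow> (fst q - fst p, snd q - snd p) \<in> {(1, 0), (-1, 0), (0, 1), (0, -1), (1, -1), (-1, 1)}"

text \<open>A clockwise turn by 60 degrees sends the difference vector \<open>(a, b)\<close> to \<open>(- b, a + b)\<close>.\<close>

fun cw_next :: "point \<Rightarrow> point \<Rightarrow> point" where
  "cw_next (c, t) (c', t') = (c + t - t', c' - c + t')"

text \<open>The boundary sets, and the components of the target grove, are the fibres of this label: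
  in the target, two vertices are connected iff they have the same \<open>max c t\<close> and, when this maximum
  exceeds \<open>n / 2\<close>, lie on the same side of the diagonal.\<close>

definition lab :: "nat \<Rightarrow> point \<Rightarrow> int \<times> nat" where
  "lab n p = (case p of (c, t) \<Rightarrow>
     (max c t, if 2 * max c t \<le> int n then 0 else if t < c then 1 else 2))"

text \<open>Components and boundary sets are replaced by labels: every vertex reaches the boundary,
  and the label decides which boundary vertices are connected. \<open>simplified_grove_phi\<close>
  proves the equivalence with the original conditions.\<close>

definition grove :: "nat \<Rightarrow> point set set \<Rightarrow> bool" where
  "grove n G \<longleftrightarrow>
     (\<forall>e\<in>G. \<exists>p\<in>tri n. \<exists>q\<in>tri n. e = {p, q} \<and> ladj p q) \<and>
     acyc G \<and>
     (\<forall>p\<in>tri n. \<exists>b\<in>side n. con G p b) \<and>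
     (\<forall>b\<in>side n. \<forall>b'\<in>side n. con G b b' \<longleftrightarrow> lab n b = lab n b')"

definition spin :: "nat \<Rightarrow> point set set \<Rightarrow> point set set \<Rightarrow> bool" where
  "spin n G G' \<longleftrightarrow> grove n G \<and> grove n G' \<and>
     (\<exists>p u. {p, u} \<in> G \<and> cw_next p u \<in> tri n \<and> {p, cw_next p u} \<notin> G \<and>
        G' = insert {p, cw_next p u} (G - {{p, u}}))"

abbreviation reach :: "nat \<Rightarrow> point set set \<Rightarrow> point set set \<Rightarrow> bool" where
  "reach n \<equiv> (spin n)\<^sup>*\<^sup>*"

lemma ladj_iff: "ladj (c, t) q \<longleftrightarrow>
    q \<in> {(c + 1, t), (c - 1, t), (c, t + 1), (c, t - 1), (c + 1, t - 1), (c - 1, t + 1)}"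
proof -
  have *: "ladj (c, t) (a, b) \<longleftrightarrow>
    (a, b) \<in> {(c + 1, t), (c - 1, t), (c, t + 1), (c, t - 1), (c + 1, t - 1), (c - 1, t + 1)}" for a b
    unfolding ladj_def insert_iff prod.inject fst_conv snd_conv empty_iff by presburger
  show ?thesis using *[of "fst q" "snd q"] unfolding prod.collapse .
qed

lemma ladjE:
  assumes "ladj (c, t) q"
  obtains "q = (c + 1, t)" | "q = (c - 1, t)" | "q = (c, t + 1)" | "q = (c, t - 1)"
    | "q = (c + 1, t - 1)" | "q = (c - 1, t + 1)"
  using assms that unfolding ladj_iff by blast

lemma ladj_sym: "ladj p q \<longleftrightarrow> ladj q p"
proof -
  have "ladj q p" if "ladj p q" for p q
    using that by (cases p; hypsubst; elim ladjE) (simp_all add: ladj_iff)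
  then show ?thesis by blast
qed
lemma ladj_cw_next: "ladj p u \<Longrightarrow> ladj p (cw_next p u) \<and> ladj u (cw_next p u) \<and> cw_next p u \<noteq> u \<and> cw_next p u \<noteq> p"
  by (cases p; hypsubst; elim ladjE) (simp_all add: ladj_iff)

lemma tri_ladj: "p \<in> tri n \<Longrightarrow> p \<notin> side n \<Longrightarrow> ladj p q \<Longrightarrow> q \<in> tri n"
  by (cases p; hypsubst; elim ladjE) (auto simp: tri_def side_def)
lemma side_tri: "side n \<subseteq> tri n"
  by (auto simp: side_def)

lemma finite_tri: "finite (tri n)"
proof -
  have "tri n \<subseteq> {0..int n} \<times> {0..int n}" by (auto simp: tri_def)
  then show ?thesis by (rule finite_subset) auto
qed

lemma cw_next_orbit:
  assumes "ladj q u" "ladj q v"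
  obtains k where "v = (cw_next q ^^ k) u"
proof -
  have "v = u \<or> v = cw_next q u \<or> v = cw_next q (cw_next q u) \<or> v = cw_next q (cw_next q (cw_next q u)) \<or>
      v = cw_next q (cw_next q (cw_next q (cw_next q u))) \<or> v = cw_next q (cw_next q (cw_next q (cw_next q (cw_next q u))))"
  proof -
    obtain c t where q: "q = (c, t)" by (cases q)
    show ?thesis
      using assms unfolding q by (elim ladjE) simp_all
  qed
  then show thesis
    using that[of 0] that[of 1] that[of 2] that[of 3] that[of 4] that[of 5]
    by (auto simp: eval_nat_numeral)
qed

lemma grove_edge:
  assumes "grove n G" "{p, q} \<in> G"
  shows "p \<in> tri n" "q \<in> tri n" "ladj p q" "p \<noteq> q"
proof -
  have "\<exists>p'\<in>tri n. \<exists>q'\<in>tri n. {p, q} = {p', q'} \<and> ladj p' q'"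
    using assms by (auto simp: grove_def)
  then show "p \<in> tri n" "q \<in> tri n" "ladj p q"
    using ladj_sym by (auto simp: doubleton_eq_iff)
  then show "p \<noteq> q" by (auto simp: ladj_def)
qed

lemma grove_acyc: "grove n G \<Longrightarrow> acyc G"
  by (simp add: grove_def)

lemma grove_side: "grove n G \<Longrightarrow> p \<in> tri n \<Longrightarrow> \<exists>b\<in>side n. con G p b"
  by (simp add: grove_def)

lemma grove_lab: "grove n G \<Longrightarrow> b \<in> side n \<Longrightarrow> b' \<in> side n \<Longrightarrow> con G b b' \<longleftrightarrow> lab n b = lab n b'"
  by (simp add: grove_def)

lemma grove_con_tri: "grove n G \<Longrightarrow> H \<subseteq> G \<Longrightarrow> con H p q \<Longrightarrow> p \<in> tri n \<Longrightarrow> q \<in> tri n"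
proof -
  assume g: "grove n G" "H \<subseteq> G" "p \<in> tri n" and c: "con H p q"
  from c g show "q \<in> tri n"
    by (induction rule: rtrancl_induct) (auto simp: adjacency_def dest: grove_edge)
qed

text \<open>Two reasons why the exchange keeps the connections between boundary vertices: either
  \<open>u\<close> and \<open>v\<close> are connected without the edge \<open>p u\<close>, so that
  no component changes, or the piece cut off with \<open>p\<close> has no boundary vertex and is
  merely hung up elsewhere.\<close>

lemma grove_swap:
  assumes g: "grove n G" and pu: "{p, u} \<in> G" and v: "v \<in> tri n" "ladj p v"
    and nc: "\<not> con (G - {{p, u}}) p v"
    and alt: "con (G - {{p, u}}) u v \<or> (\<forall>b\<in>side n. \<not> con (G - {{p, u}}) p b)"
  shows "grove n (insert {p, v} (G - {{p, u}}))"
proof -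
  define H where "H = G - {{p, u}}"
  have GH: "G = insert {p, u} H" using pu by (auto simp: H_def)
  have pV: "p \<in> tri n" "u \<in> tri n" using grove_edge[OF g pu] by auto
  have HG: "H \<subseteq> G" and HG': "H \<subseteq> insert {p, v} H" by (auto simp: H_def)
  have 1: "\<forall>e\<in>insert {p, v} H. \<exists>p\<in>tri n. \<exists>q\<in>tri n. e = {p, q} \<and> ladj p q"
    using g v pV by (auto simp: grove_def H_def)
  have 2: "acyc (insert {p, v} H)"
    using acyc_insert[OF acyc_mono[OF grove_acyc[OF g] HG]] nc by (simp add: H_def)
  have "(\<forall>p'\<in>tri n. \<exists>b\<in>side n. con (insert {p, v} H) p' b) \<and>
     (\<forall>b\<in>side n. \<forall>b'\<in>side n. con (insert {p, v} H) b b' \<longleftrightarrow> con G b b')"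
    using alt
  proof
    assume uv: "con (G - {{p, u}}) u v"
    have "con (insert {p, v} H) a b \<longleftrightarrow> con G a b" for a b
    proof
      assume "con (insert {p, v} H) a b"
      from con_insertD[OF this] have "con G a b \<or> (con G a p \<and> con G v b) \<or> (con G a v \<and> con G p b)"
        using con_mono[OF _ HG] by blast
      moreover have "con G v p"
        using con_mono[OF uv, of G] con_edge[OF pu] by (meson Diff_subset con_sym con_trans)
      ultimately show "con G a b" by (meson con_sym con_trans)
    next
      assume "con G a b"
      then have "con (insert {p, u} H) a b" using GH by simp
      from con_insertD[OF this] have "con (insert {p, v} H) a b \<or>
          (con (insert {p, v} H) a p \<and> con (insert {p, v} H) u b) \<or>
          (con (insert {p, v} H) a u \<and> con (insert {p, v} H) p b)"
        using con_mono[OF _ HG'] by blast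
      moreover have "con (insert {p, v} H) u v" using con_mono[OF _ HG'] uv by (simp add: H_def)
      then have "con (insert {p, v} H) u p"
        using con_edge[of p v "insert {p, v} H"] by (meson con_sym con_trans insertI1)
      ultimately show "con (insert {p, v} H) a b" by (meson con_sym con_trans)
    qed
    then show ?thesis using g by (auto simp: grove_def)
  next
    assume "\<forall>b\<in>side n. \<not> con (G - {{p, u}}) p b"
    then have nb: "\<And>b. b \<in> side n \<Longrightarrow> \<not> con H p b" by (simp add: H_def)
    have down: "con H a b" if "con G a b" "\<not> con H p a" "\<not> con H p b" for a b
    proof -
      have "con (insert {p, u} H) a b" using that GH by simp
      from con_insertD[OF this] show ?thesis using that con_sym[of a p H] by blast
    qed
    have down': "con H a b" if "con (insert {p, v} H) a b" "\<not> con H p a" "\<not> con H p b" for a b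
      using con_insertD[OF that(1)] that con_sym[of a p H] by blast
    show ?thesis
    proof (intro conjI ballI)
      fix q assume q: "q \<in> tri n"
      have *: "\<exists>b\<in>side n. con (insert {p, v} H) q b" if q: "q \<in> tri n" "\<not> con H p q" for q
      proof -
        obtain b where b: "b \<in> side n" "con G q b" using grove_side[OF g q(1)] by blast
        then show ?thesis using down[OF b(2) q(2) nb] con_mono[OF _ HG'] by blast
      qed
      show "\<exists>b\<in>side n. con (insert {p, v} H) q b"
      proof (cases "con H p q")
        case True
        then have "con (insert {p, v} H) q v"
          using con_mono[OF _ HG', of p q] con_edge[of p v "insert {p, v} H"]
          by (meson con_sym con_trans insertI1)
        moreover have "\<not> con H p v" using nc by (simp add: H_def)
        ultimately show ?thesis using *[OF v(1)] con_trans by metis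
      qed (use * q in blast)
    next
      fix b b' assume "b \<in> side n" "b' \<in> side n"
      then show "con (insert {p, v} H) b b' = con G b b'"
        using down[of b b'] down'[of b b'] nb[of b] nb[of b'] con_mono[OF _ HG, of b b'] con_mono[OF _ HG', of b b']
        by argo
    qed
  qed
  then show ?thesis using 1 2 g unfolding grove_def H_def[symmetric] by simp
qed

lemma spin_step:
  assumes g: "grove n G" and pu: "{p, u} \<in> G" and v: "cw_next p u = v" "v \<in> tri n"
    and nc: "\<not> con (G - {{p, u}}) p v"
    and alt: "con (G - {{p, u}}) u v \<or> (\<forall>b\<in>side n. \<not> con (G - {{p, u}}) p b)"
  shows "reach n G (insert {p, v} (G - {{p, u}})) \<and> grove n (insert {p, v} (G - {{p, u}}))"
proof -
  have l: "ladj p v" "v \<noteq> u" "v \<noteq> p" using ladj_cw_next[of p u] grove_edge[OF g pu] v by auto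
  have "{p, v} \<notin> G"
  proof
    assume "{p, v} \<in> G"
    then have "{p, v} \<in> G - {{p, u}}" using l by (auto simp: doubleton_eq_iff)
    then show False using nc con_edge by metis
  qed
  moreover have g': "grove n (insert {p, v} (G - {{p, u}}))"
    using grove_swap[OF g pu v(2) l(1) nc alt] .
  ultimately have "spin n G (insert {p, v} (G - {{p, u}}))"
    unfolding spin_def using g pu v by blast
  then show ?thesis using g' by blast
qed

lemma reach_grove: "reach n G G' \<Longrightarrow> grove n G \<Longrightarrow> grove n G'"
  by (induction rule: rtranclp_induct) (simp_all add: spin_def)

subsection \<open>Branches without boundary vertices\<close>

text \<open>Removing the edge from \<open>q\<close> to \<open>u\<close> splits its tree in two; this
  is the part that stays with \<open>q\<close>.\<close>

definition branch :: "point set set \<Rightarrow> point \<Rightarrow> point \<Rightarrow> point set" where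
  "branch G q u = {w. con (G - {{q, u}}) q w}"

lemma branch_other: "grove n G \<Longrightarrow> {q, u} \<in> G \<Longrightarrow> u \<notin> branch G q u"
  using acycD[OF grove_acyc, of n G q u] by (simp add: branch_def)

lemma branch_tri: "grove n G \<Longrightarrow> {q, u} \<in> G \<Longrightarrow> branch G q u \<subseteq> tri n"
  using grove_con_tri[OF _ Diff_subset] grove_edge(1)[of n G q u] unfolding branch_def by blast

text \<open>The edge \<open>q u\<close> is the only link between the branch and the rest, so a
  connection between two outside vertices does not enter the branch.\<close>

lemma con_off_branch:
  assumes g: "grove n G" and qu: "{q, u} \<in> G" and z: "con G z b"
    and nb: "z \<notin> branch G q u" "b \<notin> branch G q u"
  shows "con {e \<in> G. e \<inter> branch G q u = {}} z b"
proof -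
  have "con (insert {q, u} (G - {{q, u}})) z b" using z qu by (simp add: insert_absorb)
  from con_insertD[OF this] have c: "con (G - {{q, u}}) z b"
    using nb con_sym[of z q] unfolding branch_def by blast
  then show ?thesis
  proof (induction rule: rtrancl_induct)
    case (step y w)
    have zy: "con (G - {{q, u}}) z y" "{y, w} \<in> G - {{q, u}}" using step by (auto simp: adjacency_def)
    then have "con (G - {{q, u}}) z w" using con_edge con_trans by metis
    then have "y \<notin> branch G q u" "w \<notin> branch G q u"
      using zy(1) nb(1) con_trans[OF _ con_sym, of q _ "G - {{q, u}}" z]
      unfolding branch_def mem_Collect_eq by blast+
    then have "con {e \<in> G. e \<inter> branch G q u = {}} y w"
      using zy(2) by (intro con_edge) auto
    with step.IH show ?case by (rule con_trans)
  qed simp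
qed

text \<open>A vertex outside the old branch still reaches a boundary vertex along old edges, so a
  branch that grew would contain a boundary vertex \<open>b\<close>. In the new grove
  \<open>b\<close> is connected, through \<open>q u\<close>, to a boundary vertex \<open>s\<close>
  on the side of \<open>u\<close>; then both have the same label and were connected in the old
  grove, off the branch. That connection has survived and closes a cycle with
  \<open>q u\<close>.\<close>

lemma branch_preserved:
  assumes g: "grove n G" and qu: "{q, u} \<in> G" and fr: "branch G q u \<inter> side n = {}"
    and g': "grove n G'" and pres: "\<And>e. e \<in> G \<Longrightarrow> e \<inter> branch G q u = {} \<Longrightarrow> e \<in> G'"
    and qu': "{q, u} \<in> G'"
  shows "branch G' q u \<subseteq> branch G q u"
proof -
  let ?F = "{e \<in> G. e \<inter> branch G q u = {}}"
  have q: "q \<in> branch G q u" by (simp add: branch_def)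
  have F: "?F \<subseteq> G' - {{q, u}}" using pres q by auto
  have u: "u \<in> tri n" "u \<notin> branch G q u" using grove_edge[OF g qu] branch_other[OF g qu] by auto
  obtain s where s: "s \<in> side n" "con G u s" using grove_side[OF g u(1)] by blast
  have us: "con (G' - {{q, u}}) u s"
    using con_off_branch[OF g qu s(2) u(2)] s(1) fr con_mono[OF _ F] by blast
  have nos: "b \<notin> branch G' q u" if b: "b \<in> side n" for b
  proof
    assume "b \<in> branch G' q u"
    then have qb: "con (G' - {{q, u}}) q b" by (simp add: branch_def)
    then have "con G' b s"
      using us con_edge[OF qu'] con_mono[of _ _ "G' - {{q, u}}" G'] by (meson Diff_subset con_sym con_trans)
    then have "lab n b = lab n s" using grove_lab[OF g' b s(1)] by simp
    then have "con G b s" using grove_lab[OF g b s(1)] by simp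
    then have "con (G' - {{q, u}}) b s"
      using con_off_branch[OF g qu] s(1) b fr con_mono[OF _ F] by blast
    then have "con (G' - {{q, u}}) q u" using qb us by (meson con_sym con_trans)
    then show False using acycD[OF grove_acyc[OF g'] qu'] by blast
  qed
  show ?thesis
  proof
    fix z assume z: "z \<in> branch G' q u"
    show "z \<in> branch G q u"
    proof (rule ccontr)
      assume nz: "z \<notin> branch G q u"
      have "z \<in> tri n" using z branch_tri[OF g' qu'] by blast
      then obtain b where b: "b \<in> side n" "con G z b" using grove_side[OF g] by blast
      then have "con (G' - {{q, u}}) z b"
        using con_off_branch[OF g qu b(2) nz] fr con_mono[OF _ F] by blast
      then have "b \<in> branch G' q u" using z unfolding branch_def by (auto intro: con_trans)
      then show False using nos b by blast
    qed
  qed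
qed

text \<open>If the next neighbour \<open>v\<close> lies in the branch of \<open>q\<close> itself, the branch of \<open>v\<close> is strictly
  smaller, so \<open>v\<close> can first be turned to the current neighbour \<open>u\<close> of \<open>q\<close>; after that the turn of \<open>q\<close>
  from \<open>u\<close> to \<open>v\<close> happens inside the triangle \<open>q u v\<close>.\<close>

lemma rotate_to:
  assumes "grove n G" "{q, u} \<in> G" "branch G q u \<inter> side n = {}" "ladj q v"
  shows "\<exists>G'. reach n G G' \<and> {q, v} \<in> G' \<and> (\<forall>e\<in>G. e \<inter> branch G q u = {} \<longrightarrow> e \<in> G')"
  using assms
proof (induction "card (branch G q u)" arbitrary: G q u v rule: less_induct)
  case less
  \<comment> \<open>A single clockwise turn. The last clause keeps the branch from growing, so that
    turns can be iterated up to the wanted neighbour.\<close>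
  have one: "\<exists>G'. reach n H G' \<and> {q, cw_next q w} \<in> G' \<and>
      (\<forall>e\<in>H. e \<inter> branch H q w = {} \<longrightarrow> e \<in> G') \<and> branch G' q (cw_next q w) \<subseteq> branch H q w"
    if H: "grove n H" "{q, w} \<in> H" "branch H q w \<inter> side n = {}" "branch H q w \<subseteq> branch G q u" for H w
  proof -
    let ?v = "cw_next q w"
    have q: "q \<in> branch H q w" by (simp add: branch_def)
    have qV: "q \<in> tri n" "q \<notin> side n" using grove_edge[OF H(1,2)] H(3) q by auto
    have lw: "ladj q w" using grove_edge[OF H(1,2)] by auto
    have lv: "ladj q ?v" "ladj w ?v" "?v \<noteq> w" "?v \<noteq> q" using ladj_cw_next[OF lw] by auto
    have vV: "?v \<in> tri n" using tri_ladj[OF qV lv(1)] .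
    have wn: "w \<notin> branch H q w" using branch_other[OF H(1,2)] .
    have fin: "finite (branch G q u)" using branch_tri[OF less.prems(1,2)] finite_tri finite_subset by blast
    have turn: ?thesis if H1: "reach n H H1" "{q, w} \<in> H1" "?v \<notin> branch H1 q w"
        "\<forall>e\<in>H. e \<inter> branch H q w = {} \<longrightarrow> e \<in> H1" for H1
    proof -
      have g1: "grove n H1" using reach_grove[OF H1(1) H(1)] .
      have sub: "branch H1 q w \<subseteq> branch H q w"
        using branch_preserved[OF H(1-3) g1 _ H1(2)] H1(4) by blast
      let ?G' = "insert {q, ?v} (H1 - {{q, w}})"
      have nc: "\<not> con (H1 - {{q, w}}) q ?v" using H1(3) by (simp add: branch_def)
      have "\<forall>b\<in>side n. \<not> con (H1 - {{q, w}}) q b"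
        using sub H(3) unfolding branch_def by blast
      then have r: "reach n H1 ?G'" using spin_step[OF g1 H1(2) refl vV nc disjI2] by simp
      have ne: "{q, ?v} \<notin> H1 - {{q, w}}" using nc con_edge[of q ?v "H1 - {{q, w}}"] by argo
      then have "?G' - {{q, ?v}} = H1 - {{q, w}}" by auto
      then have "branch ?G' q ?v = branch H1 q w" by (simp add: branch_def)
      moreover have "\<forall>e\<in>H. e \<inter> branch H q w = {} \<longrightarrow> e \<in> ?G'" using H1(4) q by auto
      moreover have "reach n H ?G'" using H1(1) r by simp
      ultimately show ?thesis using sub by blast
    qed
    show ?thesis
    proof (cases "?v \<in> branch H q w")
      case False
      then show ?thesis using turn[of H] H(2) by auto
    next
      case True
      then have "con (H - {{q, w}}) ?v q" by (simp add: branch_def con_sym)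
      \<comment> \<open>\<open>z\<close> is the neighbour of \<open>?v\<close> on the way to
        \<open>q\<close>, so the branch of \<open>?v\<close> at \<open>z\<close> consists of what
        hangs off \<open>?v\<close> on the far side from \<open>q\<close>.\<close>
      then obtain z where z: "{?v, z} \<in> H - {{q, w}}" "con {e \<in> H - {{q, w}}. ?v \<notin> e} z q"
        by (rule con_first_edge) (use lv in auto)
      have zq: "con (H - {{?v, z}} - {{q, w}}) z q" by (rule con_mono[OF z(2)]) auto
      have zH: "{?v, z} \<in> H" using z by auto
      let ?D = "branch H ?v z"
      have zq': "con (H - {{?v, z}}) z q" by (rule con_mono[OF zq]) auto
      have qD: "q \<notin> ?D"
      proof
        assume "q \<in> ?D"
        then have "con (H - {{?v, z}}) ?v q" by (simp add: branch_def)
        then have "con (H - {{?v, z}}) ?v z" using con_sym[OF zq'] by (rule con_trans)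
        then show False using acycD[OF grove_acyc[OF H(1)] zH] by blast
      qed
      have D: "?D \<subseteq> branch H q w"
      proof
        fix y assume "y \<in> ?D"
        then have "con (insert {q, w} (H - {{?v, z}} - {{q, w}})) ?v y"
          unfolding branch_def mem_Collect_eq by (rule con_mono) auto
        from con_insertD[OF this]
        consider "con (H - {{?v, z}} - {{q, w}}) ?v y" | "con (H - {{?v, z}} - {{q, w}}) ?v q"
          | "con (H - {{?v, z}} - {{q, w}}) ?v w" by blast
        then show "y \<in> branch H q w"
        proof cases
          case 1
          then have "con (H - {{q, w}}) ?v y" by (rule con_mono) auto
          then show ?thesis using True unfolding branch_def by (auto intro: con_trans)
        next
          case 2
          then have "con (H - {{?v, z}}) ?v q" by (rule con_mono) auto
          then show ?thesis using qD by (simp add: branch_def)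
        next
          case 3
          then have "con (H - {{q, w}}) ?v w" by (rule con_mono) auto
          then have "w \<in> branch H q w" using True unfolding branch_def by (auto intro: con_trans)
          then show ?thesis using wn by blast
        qed
      qed
      have "?D \<subset> branch G q u" using D qD q H(4) by blast
      then have "card ?D < card (branch G q u)" using fin psubset_card_mono by blast
      moreover have "?D \<inter> side n = {}" using D H(3) by blast
      ultimately obtain H1 where H1: "reach n H H1" "{?v, w} \<in> H1" "\<forall>e\<in>H. e \<inter> ?D = {} \<longrightarrow> e \<in> H1"
        using less.hyps[OF _ H(1) zH, of w] lv(2) ladj_sym by blast
      have g1: "grove n H1" using reach_grove[OF H1(1) H(1)] .
      have "{q, w} \<inter> ?D = {}" using qD wn D by auto
      then have qw: "{q, w} \<in> H1" using H1(3) H(2) by simp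
      have "?v \<notin> branch H1 q w"
      proof
        assume "?v \<in> branch H1 q w"
        then have "con (H1 - {{q, w}}) q ?v" by (simp add: branch_def)
        moreover have "{?v, w} \<in> H1 - {{q, w}}" using H1(2) lv by (auto simp: doubleton_eq_iff)
        then have "con (H1 - {{q, w}}) ?v w" by (rule con_edge)
        ultimately have "con (H1 - {{q, w}}) q w" by (rule con_trans)
        then show False using acycD[OF grove_acyc[OF g1] qw] by blast
      qed
      moreover have "\<forall>e\<in>H. e \<inter> branch H q w = {} \<longrightarrow> e \<in> H1" using H1(3) D by blast
      ultimately show ?thesis by (rule turn[OF H1(1) qw])
    qed
  qed
  have all: "\<exists>G'. reach n G G' \<and> {q, (cw_next q ^^ k) u} \<in> G' \<and>
      (\<forall>e\<in>G. e \<inter> branch G q u = {} \<longrightarrow> e \<in> G') \<and> branch G' q ((cw_next q ^^ k) u) \<subseteq> branch G q u" for k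
  proof (induction k)
    case 0
    then show ?case using less.prems by auto
  next
    case (Suc k)
    then obtain H where H: "reach n G H" "{q, (cw_next q ^^ k) u} \<in> H"
      "\<forall>e\<in>G. e \<inter> branch G q u = {} \<longrightarrow> e \<in> H" "branch H q ((cw_next q ^^ k) u) \<subseteq> branch G q u" by blast
    have gH: "grove n H" using reach_grove[OF H(1) less.prems(1)] .
    have fr: "branch H q ((cw_next q ^^ k) u) \<inter> side n = {}" using H(4) less.prems(3) by blast
    obtain G' where G': "reach n H G'" "{q, cw_next q ((cw_next q ^^ k) u)} \<in> G'"
      "\<forall>e\<in>H. e \<inter> branch H q ((cw_next q ^^ k) u) = {} \<longrightarrow> e \<in> G'"
      "branch G' q (cw_next q ((cw_next q ^^ k) u)) \<subseteq> branch H q ((cw_next q ^^ k) u)"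
      using one[OF gH H(2) fr H(4)] by blast
    have "\<forall>e\<in>G. e \<inter> branch G q u = {} \<longrightarrow> e \<in> G'"
    proof (intro ballI impI)
      fix e assume e: "e \<in> G" "e \<inter> branch G q u = {}"
      then have "e \<inter> branch H q ((cw_next q ^^ k) u) = {}" using H(4) by blast
      then show "e \<in> G'" using G'(3) H(3) e by simp
    qed
    moreover have "reach n G G'" using H(1) G'(1) by simp
    ultimately show ?case using G'(2) subset_trans[OF G'(4) H(4)] by (intro exI[of _ G']) simp
  qed
  obtain k where k: "v = (cw_next q ^^ k) u"
    using cw_next_orbit[OF grove_edge(3)[OF less.prems(1,2)] less.prems(4)] .
  show ?case unfolding k using all[of k] by (elim exE conjE) (intro exI conjI)
qed

subsection \<open>Pockets\<close>

text \<open>A convexity condition: in a forest it says that the path between two connected vertices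
  of \<open>C\<close> stays in \<open>C\<close>. It turns two separate connections from outside to
  one component of \<open>C\<close> into a cycle.\<close>

definition solid :: "'a set set \<Rightarrow> 'a set \<Rightarrow> bool" where
  "solid G C \<longleftrightarrow> (\<forall>p\<in>C. \<forall>q\<in>C. con G p q \<longrightarrow> con {e \<in> G. e \<subseteq> C} p q)"

text \<open>For \<open>z\<close> outside \<open>C\<close> this is the component of \<open>z\<close>
  after the vertices of \<open>C\<close> have been removed.\<close>

definition pocket :: "'a set set \<Rightarrow> 'a set \<Rightarrow> 'a \<Rightarrow> 'a set" where
  "pocket G C z = {w. con {e \<in> G. e \<inter> C = {}} z w}"

lemma pocket_disjoint:
  assumes "z \<notin> C" shows "pocket G C z \<inter> C = {}"
proof -
  have "w \<notin> C" if "con {e \<in> G. e \<inter> C = {}} z w" for w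
    using that by (induction rule: rtrancl_induct) (auto simp: adjacency_def assms)
  then show ?thesis by (auto simp: pocket_def)
qed

lemma pocket_exit:
  assumes z: "z \<notin> C" and H: "H \<subseteq> G" "con H h q" and h: "h \<in> pocket G C z" and q: "q \<notin> pocket G C z"
  obtains k p where "k \<in> pocket G C z" "p \<in> C" "{k, p} \<in> H" "con H h k" "con H h p"
proof -
  obtain k p where kp: "k \<in> pocket G C z" "p \<notin> pocket G C z" "{k, p} \<in> H" "con H h k" "con H h p"
    using con_leave[OF H(2) h q] by metis
  have "p \<in> C"
  proof (rule ccontr)
    assume "p \<notin> C"
    moreover have "k \<notin> C" using pocket_disjoint[OF z] kp(1) by blast
    ultimately have "{k, p} \<in> {e \<in> G. e \<inter> C = {}}" using kp(3) H(1) by auto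
    then have kp': "con {e \<in> G. e \<inter> C = {}} k p" by (rule con_edge)
    have "con {e \<in> G. e \<inter> C = {}} z k" using kp(1) by (simp add: pocket_def)
    then have "con {e \<in> G. e \<inter> C = {}} z p" using kp' by (rule con_trans)
    then show False using kp(2) by (simp add: pocket_def)
  qed
  then show thesis using that kp by blast
qed

text \<open>The vertices \<open>p\<close> and \<open>p'\<close> are connected through the edge
  \<open>h h'\<close>, hence also inside \<open>C\<close>, and there the edge is avoided because
  \<open>h\<close> is outside \<open>C\<close>. In an acyclic graph the conclusion is absurd, which
  is how the lemma is used.\<close>

lemma solid_join:
  assumes "solid G C" "h \<notin> C" "p \<in> C" "p' \<in> C" "con (G - {{h, h'}}) h p" "con (G - {{h, h'}}) h' p'"
    "{h, h'} \<in> G"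
  shows "con (G - {{h, h'}}) h h'"
proof -
  have hp: "con G h p" "con G h' p'" using assms(5,6) con_mono by (metis Diff_subset)+
  have "con G p h" using hp(1) by (rule con_sym)
  also have "con G h h'" using assms(7) by (rule con_edge)
  also have "con G h' p'" by fact
  finally have "con G p p'" .
  then have "con {e \<in> G. e \<subseteq> C} p p'" using assms(1,3,4) by (auto simp: solid_def)
  then have "con (G - {{h, h'}}) p p'" by (rule con_mono) (use assms(2) in auto)
  with assms(5) have "con (G - {{h, h'}}) h p'" by (rule con_trans)
  then show ?thesis using con_sym[OF assms(6)] by (rule con_trans)
qed

text \<open>The pocket can be left only into \<open>C\<close>. If an edge touched it and both ends
  got out without using the edge, \<open>solid_join\<close> would give a cycle. Hence paths between
  vertices of \<open>C\<close> or of the boundary survive every rearrangement of a pocket without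
  boundary vertices.\<close>

lemma edge_off_pocket:
  assumes g: "grove n G" and z: "z \<notin> C" and sol: "solid G C" and fr: "pocket G C z \<inter> side n = {}"
    and e: "{h, h'} \<in> G" and q: "q \<in> C \<union> side n" "q' \<in> C \<union> side n"
    and c: "con (G - {{h, h'}}) h q" "con (G - {{h, h'}}) h' q'"
  shows "{h, h'} \<inter> pocket G C z = {}"
proof -
  have *: "h \<notin> pocket G C z"
    if e: "{h, h'} \<in> G" and q: "q \<in> C \<union> side n" "q' \<in> C \<union> side n"
    and c: "con (G - {{h, h'}}) h q" "con (G - {{h, h'}}) h' q'" for h h' q q'
  proof
    assume h: "h \<in> pocket G C z"
    then have hC: "h \<notin> C" using pocket_disjoint[OF z] by blast
    have notin: "q \<notin> pocket G C z" if "q \<in> C \<union> side n" for q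
      using that pocket_disjoint[OF z] fr by blast
    obtain p where p: "p \<in> C" "con (G - {{h, h'}}) h p"
      using pocket_exit[OF z Diff_subset c(1) h notin[OF q(1)]] by metis
    have "\<exists>p'\<in>C. con (G - {{h, h'}}) h' p'"
    proof (cases "h' \<in> C")
      case True
      then show ?thesis by blast
    next
      case False
      then have "{h, h'} \<in> {e \<in> G. e \<inter> C = {}}" using e hC by auto
      then have hh: "con {e \<in> G. e \<inter> C = {}} h h'" by (rule con_edge)
      have "con {e \<in> G. e \<inter> C = {}} z h" using h by (simp add: pocket_def)
      then have "con {e \<in> G. e \<inter> C = {}} z h'" using hh by (rule con_trans)
      then have "h' \<in> pocket G C z" by (simp add: pocket_def)
      then show ?thesis using pocket_exit[OF z Diff_subset c(2) _ notin[OF q(2)]] by metis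
    qed
    then obtain p' where p': "p' \<in> C" "con (G - {{h, h'}}) h' p'" by blast
    show False
      using solid_join[OF sol hC p(1) p'(1) p(2) p'(2) e] acycD[OF grove_acyc[OF g] e] by simp
  qed
  have "h \<notin> pocket G C z" by (rule *[OF e q c])
  moreover have "h' \<notin> pocket G C z"
    by (rule *[of h' h q' q]) (use e q c in \<open>simp_all add: insert_commute\<close>)
  ultimately show ?thesis by simp
qed

text \<open>As every vertex reaches the boundary, a pocket without boundary vertices is joined to
  \<open>C\<close>. Let \<open>u\<close> be the first vertex after \<open>z\<close> on the way to
  \<open>C\<close>. By \<open>solid_join\<close> the branch of \<open>z\<close> at \<open>u\<close>
  has no second exit, so it stays in the pocket and \<open>rotate_to\<close> applies.\<close>

lemma attach:
  assumes g: "grove n G" and z: "z \<in> tri n" "z \<notin> C" and sol: "solid G C"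
    and fr: "pocket G C z \<inter> side n = {}" and r: "ladj z r"
  obtains G' where "reach n G G'" "grove n G'" "{z, r} \<in> G'"
    "\<And>e. e \<in> G \<Longrightarrow> e \<inter> pocket G C z = {} \<Longrightarrow> e \<in> G'"
proof -
  have zp: "z \<in> pocket G C z" by (simp add: pocket_def)
  obtain b where b: "b \<in> side n" "con G z b" using grove_side[OF g z(1)] by blast
  then have "b \<notin> pocket G C z" using fr by blast
  then obtain k p where kp: "k \<in> pocket G C z" "p \<in> C" "{k, p} \<in> G"
    using pocket_exit[OF z(2) order_refl b(2) zp] by metis
  obtain u where u: "{z, u} \<in> G" "con (G - {{z, u}}) u p"
  proof (cases "k = z")
    case True
    then show thesis using kp that by blast
  next
    case False
    have "con {e \<in> G. e \<inter> C = {}} z k" using kp(1) by (simp add: pocket_def)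
    then obtain w where w: "{z, w} \<in> {e \<in> G. e \<inter> C = {}}" "con {e \<in> {e \<in> G. e \<inter> C = {}}. z \<notin> e} w k"
      using False by (rule con_first_edge)
    have "con (G - {{z, w}}) w k" using w(2) by (rule con_mono) auto
    moreover have "{k, p} \<noteq> {z, w}" using w(1) kp(2) by auto
    then have "con (G - {{z, w}}) k p" using kp(3) by (intro con_edge) auto
    ultimately have "con (G - {{z, w}}) w p" by (rule con_trans)
    then show thesis using that w(1) by blast
  qed
  have "branch G z u \<subseteq> pocket G C z"
  proof
    fix y assume "y \<in> branch G z u"
    then have y: "con (G - {{z, u}}) z y" by (simp add: branch_def)
    show "y \<in> pocket G C z"
    proof (rule ccontr)
      assume "y \<notin> pocket G C z"
      then obtain p' where "p' \<in> C" "con (G - {{z, u}}) z p'"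
        using pocket_exit[OF z(2) Diff_subset y zp] by metis
      then show False
        using solid_join[OF sol z(2) _ kp(2) _ u(2) u(1)] acycD[OF grove_acyc[OF g] u(1)] by simp
    qed
  qed
  then have sub: "branch G z u \<inter> side n = {}" "\<And>e. e \<inter> pocket G C z = {} \<Longrightarrow> e \<inter> branch G z u = {}"
    using fr by blast+
  obtain G' where G': "reach n G G'" "{z, r} \<in> G'" "\<forall>e\<in>G. e \<inter> branch G z u = {} \<longrightarrow> e \<in> G'"
    using rotate_to[OF g u(1) sub(1) r] by (elim exE conjE)
  show thesis
    by (rule that[OF G'(1) reach_grove[OF G'(1) g] G'(2)]) (use G'(3) sub(2) in simp)
qed

section \<open>Crossing parity\<close>

text \<open>Inequality of truth values is addition modulo 2, so this counts the consecutive pairs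
  satisfying \<open>f\<close> modulo 2.\<close>

fun cross_parity :: "('a \<Rightarrow> 'a \<Rightarrow> bool) \<Rightarrow> 'a list \<Rightarrow> bool" where
  "cross_parity f (p # q # r) = (f p q \<noteq> cross_parity f (q # r))"
| "cross_parity f _ = False"

lemma cross_parity_cong_xor:
  assumes "successively P ps" "\<And>p q. p \<in> set ps \<Longrightarrow> q \<in> set ps \<Longrightarrow> P p q \<Longrightarrow> f p q = (g p q \<noteq> h p q)"
  shows "cross_parity f ps = (cross_parity g ps \<noteq> cross_parity h ps)"
  using assms by (induction f ps rule: cross_parity.induct) auto

lemma cross_parity_tele:
  "ps \<noteq> [] \<Longrightarrow> cross_parity (\<lambda>p q. (p \<in> H) \<noteq> (q \<in> H)) ps = ((hd ps \<in> H) \<noteq> (last ps \<in> H))"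
  by (induction "\<lambda>p q. (p \<in> H) \<noteq> (q \<in> H)" ps rule: cross_parity.induct) auto

lemma cross_parity_none:
  assumes "successively P ps" "\<And>p q. p \<in> set ps \<Longrightarrow> q \<in> set ps \<Longrightarrow> P p q \<Longrightarrow> \<not> f p q"
  shows "\<not> cross_parity f ps"
  using assms by (induction f ps rule: cross_parity.induct) auto

lemma cross_parity_append: "cross_parity f (as @ x # y # bs) = (cross_parity f (as @ [x]) \<noteq> (f x y \<noteq> cross_parity f (y # bs)))"
proof (induction as)
  case (Cons a as)
  then show ?case by (cases as) auto
qed simp

text \<open>Discrete Jordan curve theorem modulo 2: \<open>inside w (c, t)\<close> below is the parity of the number of
  steps of \<open>w\<close> that join a vertex \<open>(c', t)\<close> with \<open>c' \<le> c\<close> to the row above, that is, that cross a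
  ray going to the left.\<close>

definition up_cross :: "int \<Rightarrow> int \<Rightarrow> point \<Rightarrow> point \<Rightarrow> bool" where
  "up_cross c t p q \<longleftrightarrow> (snd p = t \<and> fst p \<le> c \<and> snd q = t - 1) \<or> (snd q = t \<and> fst q \<le> c \<and> snd p = t - 1)"

text \<open>Geometrically, \<open>up_cross c t\<close> and \<open>down_cross c t\<close> test the
  crossing of a leftward ray that starts in the triangle above, respectively below, the horizontal
  edge from \<open>(c, t)\<close> to \<open>(c + 1, t)\<close>.\<close>

definition down_cross :: "int \<Rightarrow> int \<Rightarrow> point \<Rightarrow> point \<Rightarrow> bool" where
  "down_cross c t p q \<longleftrightarrow> (snd p = t \<and> fst p \<le> c \<and> snd q = t + 1) \<or> (snd q = t \<and> fst q \<le> c \<and> snd p = t + 1)"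

definition edge_step :: "point \<Rightarrow> point \<Rightarrow> point \<Rightarrow> point \<Rightarrow> bool" where
  "edge_step a b p q \<longleftrightarrow> {p, q} = {a, b}"

definition lrow :: "point \<Rightarrow> point set" where
  "lrow p = {q. snd q = snd p \<and> fst q \<le> fst p}"

abbreviation lat :: "point list \<Rightarrow> bool" where "lat \<equiv> successively ladj"

text \<open>The two rays start in triangles that share the edge tested by \<open>edge_step\<close>,
  and differ by this edge alone; likewise in \<open>cross_sl\<close>. The names give the slope of
  the edge in the original picture: backslash, slash, horizontal.\<close>

lemma cross_bs: "ladj p q \<Longrightarrow> down_cross c t p q = (up_cross (c - 1) (t + 1) p q \<noteq> edge_step (c, t) (c, t + 1) p q)"
  by (cases p; hypsubst; elim ladjE; hypsubst) (simp_all add: down_cross_def up_cross_def edge_step_def doubleton_eq_iff, presburger+)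

lemma cross_sl: "ladj p q \<Longrightarrow> up_cross (c - 1) (t + 1) p q = (down_cross (c - 1) t p q \<noteq> edge_step (c, t) (c - 1, t + 1) p q)"
  by (cases p; hypsubst; elim ladjE; hypsubst) (simp_all add: down_cross_def up_cross_def edge_step_def doubleton_eq_iff, presburger+)

text \<open>Here the rays run on different sides of row \<open>t\<close>. A step enters or leaves
  the left part of the row from above, from below, or along the horizontal edge at its end.\<close>

lemma cross_h: "ladj p q \<Longrightarrow> ((p \<in> lrow (c, t)) \<noteq> (q \<in> lrow (c, t))) =
    (up_cross c t p q \<noteq> (down_cross c t p q \<noteq> edge_step (c, t) (c + 1, t) p q))"
  by (cases p; hypsubst; elim ladjE; hypsubst) (simp_all add: lrow_def down_cross_def up_cross_def edge_step_def doubleton_eq_iff, presburger+)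

lemma cross_parity_bs: "lat w \<Longrightarrow> cross_parity (down_cross c t) w = (cross_parity (up_cross (c - 1) (t + 1)) w \<noteq> cross_parity (edge_step (c, t) (c, t + 1)) w)"
  by (rule cross_parity_cong_xor[where P = ladj, OF _ cross_bs])

lemma cross_parity_sl: "lat w \<Longrightarrow> cross_parity (up_cross (c - 1) (t + 1)) w = (cross_parity (down_cross (c - 1) t) w \<noteq> cross_parity (edge_step (c, t) (c - 1, t + 1)) w)"
  by (rule cross_parity_cong_xor[where P = ladj, OF _ cross_sl])

text \<open>Membership in the left part of the row telescopes along the walk, so an open walk
  contributes an error term exactly when one of its two ends lies there and the other does
  not.\<close>

lemma cross_parity_h:
  assumes "lat w" "(hd w \<in> lrow (c, t)) = (last w \<in> lrow (c, t))"
  shows "cross_parity (up_cross c t) w = (cross_parity (down_cross c t) w \<noteq> cross_parity (edge_step (c, t) (c + 1, t)) w)"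
proof (cases "w = []")
  case False
  let ?d = "\<lambda>p q. down_cross c t p q \<noteq> edge_step (c, t) (c + 1, t) p q"
  have "cross_parity (\<lambda>p q. (p \<in> lrow (c, t)) \<noteq> (q \<in> lrow (c, t))) w = (cross_parity (up_cross c t) w \<noteq> cross_parity ?d w)"
    by (rule cross_parity_cong_xor[OF assms(1)]) (rule cross_h)
  moreover have "cross_parity ?d w = (cross_parity (down_cross c t) w \<noteq> cross_parity (edge_step (c, t) (c + 1, t)) w)"
    by (rule cross_parity_cong_xor[OF assms(1)]) simp
  ultimately show ?thesis using cross_parity_tele[OF False, of "lrow (c, t)"] assms(2) by argo
qed simp

lemma cross_parity_ec_off: "lat w \<Longrightarrow> a \<notin> set w \<or> b \<notin> set w \<Longrightarrow> \<not> cross_parity (edge_step a b) w"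
  by (rule cross_parity_none[of ladj]) (auto simp: edge_step_def doubleton_eq_iff)

definition inside :: "point list \<Rightarrow> point \<Rightarrow> bool" where
  "inside w p = cross_parity (up_cross (fst p) (snd p)) w"

text \<open>The passage between the two triangles goes above \<open>(c + 1, t)\<close> and crosses
  only two edges at that vertex, neither of which the walk can use. The ray never changes to the
  other side of a row, hence no condition on the ends.\<close>

lemma inside_right:
  assumes "lat w" "(c + 1, t) \<notin> set w"
  shows "inside w (c, t) = inside w (c + 1, t)"
  using cross_parity_bs[OF assms(1), of "c + 1" "t - 1"] cross_parity_sl[OF assms(1), of "c + 1 + 1" "t - 1"]
    cross_parity_ec_off[OF assms(1), of "(c + 1, t - 1)" "(c + 1, t)"] cross_parity_ec_off[OF assms(1), of "(c + 1 + 1, t - 1)" "(c + 1, t)"]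
    assms(2) by (simp add: inside_def add.commute)

lemma inside_dn:
  assumes "lat w" "(c, t) \<notin> set w" "(hd w \<in> lrow (c, t)) = (last w \<in> lrow (c, t))"
  shows "inside w (c, t) = cross_parity (down_cross c t) w"
  using cross_parity_h[OF assms(1,3)] cross_parity_ec_off[OF assms(1), of "(c, t)" "(c + 1, t)"] assms(2)
  by (simp add: inside_def)

lemma inside_bs:
  assumes "lat w" "(c, t) \<notin> set w" "(c, t + 1) \<notin> set w" "(hd w \<in> lrow (c, t)) = (last w \<in> lrow (c, t))"
  shows "inside w (c, t) = inside w (c, t + 1)"
  using inside_dn[OF assms(1,2,4)] cross_parity_sl[OF assms(1), of "c + 1" t]
    cross_parity_ec_off[OF assms(1), of "(c + 1, t)" "(c, t + 1)"] assms(3)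
  by (simp add: inside_def)

lemma inside_sl:
  assumes "lat w" "(c, t) \<notin> set w" "(c - 1, t + 1) \<notin> set w" "(hd w \<in> lrow (c, t)) = (last w \<in> lrow (c, t))"
  shows "inside w (c, t) = inside w (c - 1, t + 1)"
  using inside_dn[OF assms(1,2,4)] cross_parity_bs[OF assms(1), of c t]
    cross_parity_ec_off[OF assms(1), of "(c, t)" "(c, t + 1)"] assms(2)
  by (simp add: inside_def)

lemma inside_ladj:
  assumes w: "lat w" and pq: "ladj p q" "p \<notin> set w" "q \<notin> set w"
    and e: "snd p < snd q \<Longrightarrow> (hd w \<in> lrow p) = (last w \<in> lrow p)"
      "snd q < snd p \<Longrightarrow> (hd w \<in> lrow q) = (last w \<in> lrow q)"
  shows "inside w p = inside w q"
proof -
  obtain c t where p: "p = (c, t)" by (cases p)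
  from pq(1)[unfolded p] show ?thesis
  proof (cases rule: ladjE)
    case 1
    then show ?thesis using inside_right[OF w, of c t] pq p by simp
  next
    case 2
    then show ?thesis using inside_right[OF w, of "c - 1" t] pq p by simp
  next
    case 3
    then show ?thesis using inside_bs[OF w, of c t] pq e p by simp
  next
    case 4
    then show ?thesis using inside_bs[OF w, of c "t - 1"] pq e p by simp
  next
    case 5
    then show ?thesis using inside_sl[OF w, of "c + 1" "t - 1"] pq e p by simp
  next
    case 6
    then show ?thesis using inside_sl[OF w, of c t] pq e p by simp
  qed
qed

lemma inside_con:
  assumes w: "lat w" and c: "con F a b"
    and F: "\<And>p q. {p, q} \<in> F \<Longrightarrow> ladj p q \<and> p \<notin> set w \<and> q \<notin> set w \<and>
      (snd p < snd q \<longrightarrow> (hd w \<in> lrow p) = (last w \<in> lrow p))"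
  shows "inside w a = inside w b"
  using c
proof (induction rule: rtrancl_induct)
  case (step y z)
  then have "{y, z} \<in> F" "{z, y} \<in> F" by (auto simp: adjacency_def insert_commute)
  then have "inside w y = inside w z" using inside_ladj[OF w] F by simp
  then show ?case using step.IH by simp
qed simp

text \<open>On the left side the ray meets no vertex of the walk, and on the top side there is no
  row above. On the right side the ray covers the whole row, so the parity only tells whether the
  row separates the two ends of the walk, which the last hypothesis excludes.\<close>

lemma not_inside:
  assumes w: "lat w" "w \<noteq> []" "set w \<subseteq> tri n" and b: "b \<notin> tri n \<or> b \<in> side n" "b \<notin> set w"
    and e: "int n \<le> fst b + snd b \<Longrightarrow> (snd b \<le> snd (hd w)) = (snd b \<le> snd (last w))"
  shows "\<not> inside w b"
proof -
  obtain c t where bt: "b = (c, t)" by (cases b)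
  have tri: "0 \<le> fst p \<and> 0 \<le> snd p \<and> fst p + snd p \<le> int n" if "p \<in> set w" for p
    using that w(3) by (auto simp: tri_def)
  consider "c \<le> 0" | "t \<le> 0" | "int n \<le> c + t" using b bt by (fastforce simp: side_def tri_def)
  then show ?thesis
  proof cases
    case 1
    have "\<not> cross_parity (up_cross c t) w"
    proof (rule cross_parity_none[OF w(1)])
      fix p q assume pq: "p \<in> set w" "q \<in> set w"
      have "\<not> (snd r = t \<and> fst r \<le> c)" if "r \<in> set w" for r
      proof
        assume "snd r = t \<and> fst r \<le> c"
        then have "r = b" using tri[OF that] 1 bt by (simp add: prod_eq_iff)
        then show False using that b(2) by simp
      qed
      then show "\<not> up_cross c t p q" using pq unfolding up_cross_def by blast
    qed
    then show ?thesis by (simp add: inside_def bt)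
  next
    case 2
    have "\<not> cross_parity (up_cross c t) w"
    proof (rule cross_parity_none[OF w(1)])
      fix p q assume "p \<in> set w" "q \<in> set w" "ladj p q"
      then show "\<not> up_cross c t p q" using tri[of p] tri[of q] 2 by (auto simp: up_cross_def)
    qed
    then show ?thesis by (simp add: inside_def bt)
  next
    case 3
    have "cross_parity (up_cross c t) w = (cross_parity (\<lambda>p q. (p \<in> {p. t \<le> snd p}) \<noteq> (q \<in> {p. t \<le> snd p})) w \<noteq> cross_parity (\<lambda>_ _. False) w)"
    proof (rule cross_parity_cong_xor[OF w(1)])
      fix p q assume pq: "p \<in> set w" "q \<in> set w" "ladj p q"
      then have "snd q = snd p - 1 \<or> snd q = snd p \<or> snd q = snd p + 1" by (auto simp: ladj_def)
      then show "up_cross c t p q = (((p \<in> {p. t \<le> snd p}) \<noteq> (q \<in> {p. t \<le> snd p})) \<noteq> False)"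
        using tri[OF pq(1)] tri[OF pq(2)] 3 unfolding up_cross_def mem_Collect_eq by smt
    qed
    moreover have "\<not> cross_parity (\<lambda>_ _. False) w" by (rule cross_parity_none[OF w(1)]) simp
    ultimately show ?thesis
      using cross_parity_tele[OF w(2), of "{p. t \<le> snd p}"] e 3 bt by (simp add: inside_def)
  qed
qed

section \<open>One stage\<close>

lemma walk_split_con:
  assumes "walk G (as @ h # h' # bs)" "distinct (as @ h # h' # bs)"
  shows "con (G - {{h, h'}}) (hd (as @ [h])) h" "con (G - {{h, h'}}) h' (last (h' # bs))"
proof -
  have 1: "walk G (as @ [h])" "walk G (h' # bs)"
    using assms(1) by (auto simp: successively_append_iff)
  have "walk (G - {{h, h'}}) (as @ [h])"
    by (rule walk_mono[OF 1(1)]) (use assms(2) in \<open>auto simp: doubleton_eq_iff\<close>)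
  then show "con (G - {{h, h'}}) (hd (as @ [h])) h" by (rule walk_con) simp
  have "walk (G - {{h, h'}}) (h' # bs)"
    by (rule walk_mono[OF 1(2)]) (use assms(2) in \<open>auto simp: doubleton_eq_iff\<close>)
  then have "con (G - {{h, h'}}) (hd (h' # bs)) (last (h' # bs))" by (rule walk_con) simp
  then show "con (G - {{h, h'}}) h' (last (h' # bs))" by simp
qed

lemma successively_steps:
  "(\<And>as h h' bs. ps = as @ h # h' # bs \<Longrightarrow> P h h') \<Longrightarrow> successively P ps"
proof (induction ps)
  case (Cons a ps)
  show ?case
  proof (cases ps)
    case ps: (Cons b qs)
    have "successively P ps"
    proof (rule Cons.IH)
      fix as h h' bs assume "ps = as @ h # h' # bs"
      then show "P h h'" using Cons.prems[of "a # as" h h' bs] by simp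
    qed
    moreover have "P a b" using Cons.prems[of "[]" a b qs] ps by simp
    ultimately show ?thesis using ps by simp
  qed simp
qed simp

section \<open>The shells of the target and the wall formed by the finished ones\<close>

definition target_col :: "nat \<Rightarrow> int \<Rightarrow> point set set" where
  "target_col n d = {{(d, t), (d, t + 1)} |t. 0 \<le> t \<and> t + 1 \<le> d \<and> d + t + 1 \<le> int n}"

definition target_row :: "nat \<Rightarrow> int \<Rightarrow> point set set" where
  "target_row n d = {{(c, d), (c + 1, d)} |c. 0 \<le> c \<and> c + 1 \<le> d \<and> c + 1 + d \<le> int n}"

definition target_beyond :: "nat \<Rightarrow> int \<Rightarrow> point set set" where
  "target_beyond n d = (\<Union>d'\<in>{d<..}. target_col n d' \<union> target_row n d')"

definition shell :: "point \<Rightarrow> int" where "shell p = max (fst p) (snd p)"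

definition level :: "point \<Rightarrow> int" where "level p = fst p + snd p"

definition outer :: "nat \<Rightarrow> int \<Rightarrow> point set" where
  "outer n d = {p \<in> tri n. d < shell p}"

lemma con_chain:
  assumes "s \<le> (t::int)" "\<And>i. s \<le> i \<Longrightarrow> i < t \<Longrightarrow> {f i, f (i + 1)} \<in> F"
  shows "con F (f s) (f t)"
  using assms
proof (induction t rule: int_ge_induct)
  case (step i)
  have "con F (f s) (f i)" using step by simp
  moreover have "con F (f i) (f (i + 1))" using step by (intro con_edge) simp
  ultimately show ?case by (rule con_trans)
qed simp

lemma col_con: "0 \<le> t \<Longrightarrow> t \<le> d \<Longrightarrow> d + t \<le> int n \<Longrightarrow> con (target_col n d) (d, 0) (d, t)"
  by (rule con_chain) (auto simp: target_col_def)

lemma row_con: "0 \<le> c \<Longrightarrow> c \<le> d \<Longrightarrow> c + d \<le> int n \<Longrightarrow> con (target_row n d) (0, d) (c, d)"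
  by (rule con_chain[where f = "\<lambda>c. (c, d)"]) (auto simp: target_row_def)

lemma target_beyond_sub: "d < d' \<Longrightarrow> target_col n d' \<subseteq> target_beyond n d \<and> target_row n d' \<subseteq> target_beyond n d"
  unfolding target_beyond_def by blast

lemma target_beyond_outer: "- 1 \<le> d \<Longrightarrow> e \<in> target_beyond n d \<Longrightarrow> e \<subseteq> outer n d"
  by (auto simp: target_beyond_def target_col_def target_row_def outer_def tri_def shell_def)

text \<open>Follow the column or the row of the shell back to its end on the top or left side; the
  label of that end contains the shell.\<close>

lemma outer_anchor:
  assumes p: "p \<in> outer n d" and d: "- 1 \<le> d"
  obtains a where "a \<in> side n" "a \<in> outer n d" "fst (lab n a) = shell p" "con (target_beyond n d) p a"
    "a = (shell p, 0) \<or> a = (0, shell p)"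
proof -
  obtain c t where ct: "p = (c, t)" by (cases p)
  have r: "0 \<le> c" "0 \<le> t" "c + t \<le> int n" "d < shell p" using p ct by (auto simp: outer_def tri_def)
  show thesis
  proof (cases "t \<le> c")
    case True
    then have m: "shell p = c" using ct by (simp add: shell_def)
    have "con (target_col n c) (c, 0) p" using col_con[of t c n] r True ct by simp
    then have "con (target_beyond n d) (c, 0) p" by (rule con_mono) (use target_beyond_sub m r in blast)
    then have "con (target_beyond n d) p (c, 0)" by (rule con_sym)
    then show thesis using that[of "(c, 0)"] m r d by (auto simp: side_def tri_def outer_def shell_def lab_def)
  next
    case False
    then have m: "shell p = t" using ct by (simp add: shell_def)
    have "con (target_row n t) (0, t) p" using row_con[of c t n] r False ct by simp
    then have "con (target_beyond n d) (0, t) p" by (rule con_mono) (use target_beyond_sub m r in blast)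
    then have "con (target_beyond n d) p (0, t)" by (rule con_sym)
    then show thesis using that[of "(0, t)"] m r d by (auto simp: side_def tri_def outer_def shell_def lab_def)
  qed
qed

text \<open>Anchors with equal labels lie in the same shell \<open>D\<close>. If they are its two
  different ends, equality of labels forces \<open>2 * D \<le> int n\<close>, and then column and
  row meet in \<open>(D, D)\<close>.\<close>

lemma outer_con:
  assumes g: "grove n G" and H: "target_beyond n d \<subseteq> G" and d: "- 1 \<le> d"
    and p: "p \<in> outer n d" and q: "q \<in> outer n d" and c: "con G p q"
  shows "con (target_beyond n d) p q"
proof -
  obtain a where a: "a \<in> side n" "a \<in> outer n d" "fst (lab n a) = shell p" "con (target_beyond n d) p a"
    "a = (shell p, 0) \<or> a = (0, shell p)" using outer_anchor[OF p d] .
  obtain b where b: "b \<in> side n" "b \<in> outer n d" "fst (lab n b) = shell q" "con (target_beyond n d) q b"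
    "b = (shell q, 0) \<or> b = (0, shell q)" using outer_anchor[OF q d] .
  have "con G a p" using con_mono[OF a(4) H] by (rule con_sym)
  also note c
  also have "con G q b" using con_mono[OF b(4) H] .
  finally have lab: "lab n a = lab n b" using grove_lab[OF g a(1) b(1)] by simp
  then have m: "shell p = shell q" using a(3) b(3) by simp
  define D where "D = shell p"
  have D: "d < D" "D \<le> int n" using a(2) p by (auto simp: outer_def D_def tri_def shell_def)
  have "con (target_beyond n d) a b"
  proof (cases "a = b")
    case False
    then have ab: "{a, b} = {(D, 0), (0, D)}" using a(5) b(5) m D_def by auto
    have "2 * D \<le> int n"
      using lab a(5) b(5) m False D d unfolding lab_def D_def by (auto split: if_splits)
    then have "con (target_col n D) (D, 0) (D, D)" "con (target_row n D) (0, D) (D, D)"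
      using col_con[of D D n] row_con[of D D n] D d by auto
    then have "con (target_beyond n d) (D, 0) (D, D)" "con (target_beyond n d) (0, D) (D, D)"
      using target_beyond_sub[OF D(1), of n] con_mono by metis+
    then have "con (target_beyond n d) (D, 0) (0, D)" using con_sym con_trans by metis
    then show ?thesis using ab con_sym[of "(D, 0)" "(0, D)"] by (auto simp: doubleton_eq_iff)
  qed simp
  with a(4) have "con (target_beyond n d) p b" by (rule con_trans)
  then show ?thesis using con_sym[OF b(4)] by (rule con_trans)
qed

lemma outer_not_con:
  assumes g: "grove n G" and H: "target_beyond n d \<subseteq> G" and d: "- 1 \<le> d"
    and a: "a \<in> side n" "shell a = d" and q: "q \<in> outer n d"
  shows "\<not> con G a q"
proof
  assume c: "con G a q"
  obtain b where b: "b \<in> side n" "fst (lab n b) = shell q" "con (target_beyond n d) q b"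
    using outer_anchor[OF q d] .
  note c also have "con G q b" using con_mono[OF b(3) H] .
  finally have "lab n a = lab n b" using grove_lab[OF g a(1) b(1)] by simp
  moreover have "fst (lab n a) = d" using a(2) by (simp add: lab_def shell_def split_beta)
  ultimately show False using b(2) q by (simp add: outer_def)
qed

text \<open>The set \<open>C\<close> is connected within itself and belongs to the component of
  \<open>a\<close>; the outer part is solid by \<open>outer_con\<close>, and by
  \<open>outer_not_con\<close> no component meets both.\<close>

lemma solid_ext:
  assumes g: "grove n G" and H: "target_beyond n d \<subseteq> G" and d: "- 1 \<le> d"
    and a: "a \<in> side n" "shell a = d" and r: "con G a r"
    and C: "\<And>p. p \<in> C \<Longrightarrow> con {e \<in> G. e \<subseteq> C} r p"
  shows "solid G (C \<union> outer n d)"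
proof -
  let ?R = "{e \<in> G. e \<subseteq> C \<union> outer n d}"
  have CG: "con G r p" if "p \<in> C" for p using C[OF that] by (rule con_mono) auto
  have CR: "con ?R r p" if "p \<in> C" for p using C[OF that] by (rule con_mono) auto
  have mix: "\<not> con G p q" if "p \<in> C" "q \<in> outer n d" for p q
  proof
    assume "con G p q"
    with CG[OF that(1)] have "con G r q" by (rule con_trans)
    with r have "con G a q" by (rule con_trans)
    then show False using outer_not_con[OF g H d a that(2)] by simp
  qed
  have "con ?R p q" if pq: "p \<in> C \<union> outer n d" "q \<in> C \<union> outer n d" "con G p q" for p q
  proof -
    consider "p \<in> C" "q \<in> C" | "p \<in> outer n d" "q \<in> outer n d"
      using pq mix[of p q] mix[of q p] con_sym[OF pq(3)] by blast
    then show ?thesis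
    proof cases
      case 1
      show ?thesis using con_sym[OF CR[OF 1(1)]] CR[OF 1(2)] by (rule con_trans)
    next
      case 2
      have "target_beyond n d \<subseteq> ?R" using H target_beyond_outer[OF d] by blast
      then show ?thesis using outer_con[OF g H d 2 pq(3)] con_mono by metis
    qed
  qed
  then show ?thesis by (simp add: solid_def)
qed

text \<open>For \<open>int n \<le> 2 * d\<close> both ends of the column are boundary vertices, so
  each of its edges lies on a path from boundary to boundary.\<close>

lemma target_col_pocket:
  assumes g: "grove n G" and H: "target_col n d \<subseteq> G" and n: "int n \<le> 2 * d" "d \<le> int n" and e: "e \<in> target_col n d"
    and z: "z \<notin> C" and sol: "solid G C" and fr: "pocket G C z \<inter> side n = {}"
  shows "e \<inter> pocket G C z = {}"
proof -
  obtain t where t: "e = {(d, t), (d, t + 1)}" "0 \<le> t" "t + 1 \<le> d" "d + t + 1 \<le> int n"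
    using e by (auto simp: target_col_def)
  have ed: "{(d, i), (d, i + 1)} \<in> G - {e}" if "0 \<le> i" "d + i + 1 \<le> int n" "i \<noteq> t" for i
  proof -
    have "{(d, i), (d, i + 1)} \<in> target_col n d" using that n by (auto simp: target_col_def)
    then show ?thesis using H that t(1) by (auto simp: doubleton_eq_iff)
  qed
  have "con (G - {e}) (d, 0) (d, t)" by (rule con_chain) (use t ed in auto)
  then have 1: "con (G - {e}) (d, t) (d, 0)" by (rule con_sym)
  have 2: "con (G - {e}) (d, t + 1) (d, int n - d)" by (rule con_chain) (use t ed in auto)
  have "(d, 0) \<in> side n" "(d, int n - d) \<in> side n" using t n by (auto simp: side_def tri_def)
  then show ?thesis
    using edge_off_pocket[OF g z sol fr, of "(d, t)" "(d, t + 1)" "(d, 0)" "(d, int n - d)"] 1 2 H e t(1) by blast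
qed

text \<open>Here \<open>y\<close> and \<open>(c, t - 1)\<close> are the left and upper left neighbours of \<open>v\<close>, and the walk enters \<open>v\<close>
  from \<open>last bs\<close>: the neighbours of \<open>v\<close> strictly between \<open>last bs\<close> and \<open>y\<close> in clockwise order are
  enclosed by the loop.\<close>

lemma loop_inside:
  assumes w: "lat (y # bs @ [v, y])" and dist: "distinct (y # bs @ [v])" and bs: "bs \<noteq> []"
    and v: "v = (c, t)" and y: "y = (c - 1, t)"
    and x: "(c, t - 1) \<notin> set (y # bs @ [v])" "\<not> inside (y # bs @ [v, y]) (c, t - 1)"
  shows "last bs \<noteq> (c - 1, t + 1) \<Longrightarrow> inside (y # bs @ [v, y]) (c - 1, t + 1)"
    and "last bs \<noteq> (c - 1, t + 1) \<Longrightarrow> last bs \<noteq> (c, t + 1) \<Longrightarrow> (c, t + 1) \<notin> set (y # bs @ [v]) \<Longrightarrow>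
      inside (y # bs @ [v, y]) (c, t + 1)"
    and "last bs \<noteq> (c - 1, t + 1) \<Longrightarrow> last bs \<noteq> (c, t + 1) \<Longrightarrow> last bs \<noteq> (c + 1, t) \<Longrightarrow>
      (c + 1, t) \<notin> set (y # bs @ [v]) \<Longrightarrow> inside (y # bs @ [v, y]) (c + 1, t)"
proof -
  let ?w = "y # bs @ [v, y]"
  obtain bs' z where bz: "bs = bs' @ [z]" using bs by (metis append_butlast_last_id)
  have z: "last bs = z" using bz by simp
  have lat1: "lat (y # bs)" using w bs by (auto simp: successively_append_iff successively_Cons hd_append)
  \<comment> \<open>The loop passes \<open>v\<close> once, coming from \<open>z\<close> and leaving
    to \<open>y\<close>, so these are the only two edges at \<open>v\<close> that it uses.\<close>
  have spoke: "cross_parity (edge_step v u) ?w = ((u = z) \<noteq> (u = y))" for u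
  proof -
    have vn: "v \<notin> set (y # bs)" using dist by auto
    have "cross_parity (edge_step v u) ?w = (cross_parity (edge_step v u) (y # bs) \<noteq> (edge_step v u z v \<noteq> edge_step v u v y))"
      using cross_parity_append[of "edge_step v u" "y # bs'" z v "[y]"] bz by simp
    moreover have "\<not> cross_parity (edge_step v u) (y # bs)" by (rule cross_parity_ec_off[OF lat1]) (use vn in simp)
    moreover have "edge_step v u z v \<longleftrightarrow> u = z" "edge_step v u v y \<longleftrightarrow> u = y"
      unfolding edge_step_def doubleton_eq_iff by blast+
    ultimately show ?thesis by simp
  qed
  have sw: "set ?w = set (y # bs @ [v])" by auto
  \<comment> \<open>The triangles at \<open>v\<close> are visited anticlockwise, starting beside
    \<open>(c, t - 1)\<close>, which is outside. The parity flips at the edge to \<open>y\<close>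
    and then stays odd until the edge to \<open>last bs\<close> is met. The digits in
    \<open>f45\<close> and \<open>f23\<close> number the neighbours of \<open>v\<close> clockwise
    from \<open>(c, t - 1)\<close> as 0.\<close>
  have up0: "cross_parity (down_cross c (t - 1)) ?w = False"
    using inside_dn[OF w, of c "t - 1"] x sw by simp
  have "cross_parity (up_cross (c - 1) t) ?w = False"
    using cross_parity_bs[OF w, of c "t - 1"] cross_parity_ec_off[OF w, of "(c, t - 1)" "(c, t)"] x(1) sw up0 by simp
  moreover have "edge_step (c - 1, t) (c, t) = edge_step v y" unfolding v y by (intro ext) (simp add: edge_step_def insert_commute)
  moreover have "z \<noteq> y" using dist bz by auto
  ultimately have f45: "cross_parity (down_cross (c - 1) t) ?w"
    using cross_parity_h[OF w, of "c - 1" t] spoke[of y] by simp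
  show 4: "inside ?w (c - 1, t + 1)" if "last bs \<noteq> (c - 1, t + 1)"
    using cross_parity_sl[OF w, of c t] f45 spoke[of "(c - 1, t + 1)"] that z v y by (simp add: inside_def)
  have f23: "cross_parity (down_cross c t) ?w" if "last bs \<noteq> (c - 1, t + 1)" "last bs \<noteq> (c, t + 1)"
    using cross_parity_bs[OF w, of c t] 4[OF that(1)] spoke[of "(c, t + 1)"] that z v y by (simp add: inside_def)
  show "inside ?w (c, t + 1)" if "last bs \<noteq> (c - 1, t + 1)" "last bs \<noteq> (c, t + 1)" "(c, t + 1) \<notin> set (y # bs @ [v])"
    using cross_parity_sl[OF w, of "c + 1" t] f23[OF that(1,2)] cross_parity_ec_off[OF w, of "(c + 1, t)" "(c, t + 1)"] that(3) sw
    by (simp add: inside_def)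
  show "inside ?w (c + 1, t)" if "last bs \<noteq> (c - 1, t + 1)" "last bs \<noteq> (c, t + 1)" "last bs \<noteq> (c + 1, t)"
    "(c + 1, t) \<notin> set (y # bs @ [v])"
  proof -
    have "inside ?w (c, t)"
      using cross_parity_h[OF w, of c t] f23[OF that(1,2)] spoke[of "(c + 1, t)"] that(3) z v y by (simp add: inside_def)
    then show ?thesis using inside_right[OF w, of c t] that(4) sw by simp
  qed
qed

text \<open>Pushing an edge of level sum \<open>s\<close> across a triangle replaces it by two edges of level sum \<open>s + 1\<close>,
  whence the base 3.\<close>

fun weight :: "nat \<Rightarrow> point list \<Rightarrow> nat" where
  "weight n (p # q # r) = 3 ^ nat (2 * int n + 2 - level p - level q) + weight n (q # r)"
| "weight n _ = 0"

lemma weight_append: "weight n (as @ x # bs) = weight n (as @ [x]) + weight n (x # bs)"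
proof (induction as)
  case (Cons a as)
  then show ?case by (cases as) auto
qed simp

lemma weight_rev: "weight n (rev ps) = weight n ps"
proof (induction ps)
  case (Cons a ps)
  show ?case
  proof (cases ps)
    case ps: (Cons b qs)
    have "weight n (rev (a # ps)) = weight n (rev qs @ [b]) + weight n [b, a]"
      using weight_append[of n "rev qs" b "[a]"] ps by simp
    then show ?thesis using Cons ps by (simp add: algebra_simps)
  qed simp
qed simp

lemma crossing_step:
  assumes "ps \<noteq> []" "hd ps \<in> S" "last ps \<notin> S"
  shows "\<exists>as h h' bs. ps = as @ h # h' # bs \<and> h \<in> S \<and> h' \<notin> S"
  using assms
proof (induction ps)
  case (Cons p ps)
  have ne: "ps \<noteq> []" using Cons.prems by auto
  show ?case
  proof (cases "hd ps \<in> S")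
    case True
    then obtain as h h' bs where "ps = as @ h # h' # bs" "h \<in> S" "h' \<notin> S" using Cons ne by auto
    then show ?thesis by (intro exI[of _ "p # as"] exI[of _ h] exI[of _ h'] exI[of _ bs]) simp
  next
    case False
    then show ?thesis using Cons.prems ne
      by (intro exI[of _ "[]"] exI[of _ p] exI[of _ "hd ps"] exI[of _ "tl ps"]) simp
  qed
qed simp

text \<open>All shells beyond \<open>d\<close> already carry the target edges; \<open>a\<close> and \<open>b\<close> are the ends of the path of
  shell \<open>d\<close> that is to be moved onto the shell, keeping the edges in \<open>H\<close>.\<close>

locale stage =
  fixes n :: nat and d :: int and H :: "point set set" and a b :: point
  assumes d0: "- 1 \<le> d" "d \<le> int n"
    and H: "H = target_beyond n d \<or> (H = target_beyond n d \<union> target_col n d \<and> int n \<le> 2 * d)"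
    and a: "a \<in> side n" "shell a = d" and b: "b \<in> side n" "shell b = d"
    and lab: "lab n a = lab n b"
    and hyp: "\<And>p. p \<in> side n \<Longrightarrow> p \<noteq> a \<Longrightarrow> p \<noteq> b \<Longrightarrow> shell p \<le> d \<Longrightarrow> fst p + snd p = int n \<Longrightarrow>
      (snd p \<le> snd a) = (snd p \<le> snd b)"
begin

definition good :: "point set set \<Rightarrow> point list \<Rightarrow> bool" where
  "good G ps \<longleftrightarrow> grove n G \<and> H \<subseteq> G \<and> walk G ps \<and> distinct ps \<and> ps \<noteq> [] \<and> hd ps = a \<and> last ps = b"

lemma TH: "target_beyond n d \<subseteq> H" using H by blast

lemma H_pocket:
  assumes g: "grove n G" and HG: "H \<subseteq> G" and e: "e \<in> H"
    and C: "outer n d \<subseteq> C" and z: "z \<notin> C" and sol: "solid G C" and fr: "pocket G C z \<inter> side n = {}"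
  shows "e \<inter> pocket G C z = {}"
proof -
  consider "e \<in> target_beyond n d" | "e \<in> target_col n d" "target_col n d \<subseteq> G" "int n \<le> 2 * d" using H e HG by blast
  then show ?thesis
  proof cases
    case 1
    then have "e \<subseteq> C" using target_beyond_outer[OF d0(1)] C by blast
    then show ?thesis using pocket_disjoint[OF z] by blast
  next
    case 2
    then show ?thesis using target_col_pocket[OF g 2(2,3) d0(2) 2(1) z sol fr] by simp
  qed
qed

lemma H_form:
  assumes "e \<in> H"
  obtains "e \<subseteq> outer n d" | t where "e = {(d, t), (d, t + 1)}" "0 \<le> t" "t + 1 \<le> d" "d + t + 1 \<le> int n" "target_col n d \<subseteq> H"
proof -
  consider "e \<in> target_beyond n d" | "e \<in> target_col n d" "target_col n d \<subseteq> H" using H assms by blast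
  then show thesis
  proof cases
    case 1
    then show thesis using target_beyond_outer[OF d0(1)] that(1) by blast
  next
    case 2
    then show thesis using that(2) by (auto simp: target_col_def)
  qed
qed

text \<open>This shows that path edges with an end off column \<open>d\<close> are not protected and
  may be removed.\<close>

lemma H_edge_shell: "{p, q} \<in> H \<Longrightarrow> shell p \<le> d \<Longrightarrow> fst p = d \<and> fst q = d"
  by (erule H_form) (auto simp: outer_def doubleton_eq_iff)

lemma con_in_stage:
  assumes g: "grove n G" and HG: "H \<subseteq> G" and c: "con G a p"
  shows "p \<in> tri n" "p \<notin> outer n d" "shell p \<le> d"
proof -
  show p: "p \<in> tri n" using grove_con_tri[OF g order_refl c] a(1) side_tri by blast
  show "p \<notin> outer n d" using outer_not_con[OF g _ d0(1) a] c TH HG by blast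
  then show "shell p \<le> d" using p by (simp add: outer_def)
qed

lemma good_con: "good G ps \<Longrightarrow> p \<in> set ps \<Longrightarrow> con G a p"
  unfolding good_def using walk_con[of G ps p] by blast

lemma good_in:
  assumes "good G ps" "p \<in> set ps"
  shows "p \<in> tri n" "p \<notin> outer n d" "shell p \<le> d"
  using con_in_stage[of G p] good_con[OF assms] assms(1) unfolding good_def by blast+

lemma good_lat: "good G ps \<Longrightarrow> lat ps"
  unfolding good_def by (auto intro: successively_mono grove_edge(3))

text \<open>Deleting an edge of a simple path leaves each end of the edge joined to an end of the
  path, so \<open>edge_off_pocket\<close> applies to every edge.\<close>

lemma walk_edges_pocket:
  assumes g: "grove n G" and z: "z \<notin> C" and sol: "solid G C" and fr: "pocket G C z \<inter> side n = {}"
    and ps: "walk G ps" "distinct ps" "ps \<noteq> []" and e: "hd ps \<in> C \<union> side n" "last ps \<in> C \<union> side n"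
    and G': "\<And>e. e \<in> G \<Longrightarrow> e \<inter> pocket G C z = {} \<Longrightarrow> e \<in> G'"
  shows "walk G' ps"
proof (rule successively_steps)
  fix as h h' bs assume eq: "ps = as @ h # h' # bs"
  then have e': "{h, h'} \<in> G" using ps(1) by (auto simp: successively_append_iff)
  have "con (G - {{h, h'}}) (hd (as @ [h])) h" "con (G - {{h, h'}}) h' (last (h' # bs))"
    using walk_split_con[of G as h h' bs] ps eq by simp_all
  moreover have "hd (as @ [h]) = hd ps" "last (h' # bs) = last ps" using eq by (auto simp: hd_append)
  ultimately have "con (G - {{h, h'}}) h (hd ps)" "con (G - {{h, h'}}) h' (last ps)"
    using con_sym[of "hd ps" h "G - {{h, h'}}"] by simp_all
  then have "{h, h'} \<inter> pocket G C z = {}" using edge_off_pocket[OF g z sol fr e' e] by simp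
  then show "{h, h'} \<in> G'" using G' e' by simp
qed

text \<open>The chord \<open>y v\<close> cannot be inserted by a single spin. Instead the edge by which the path enters \<open>v\<close>
  is turned clockwise about \<open>v\<close> until it reaches \<open>y\<close>; the neighbours passed on the way are enclosed by the
  loop, hence on the loop or free to be attached to the previous neighbour.\<close>

lemma close_loop:
  assumes good: "good G (al @ x # y # be @ v # ga)" and be: "be \<noteq> []"
    and x: "x = (c, t)" and y: "y = (c - 1, t + 1)" and v: "v = (c, t + 1)"
  shows "\<exists>G'. reach n G G' \<and> good G' (al @ x # y # v # ga)"
proof -
  let ?ps = "al @ x # y # be @ v # ga"
  have g: "grove n G" and HG: "H \<subseteq> G" and wk: "walk G ?ps" and dist: "distinct ?ps"
    and hd: "hd ?ps = a" and la: "last ?ps = b" using good by (auto simp: good_def)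
  define z where "z = last be"
  \<comment> \<open>The neighbours of \<open>v\<close> in clockwise order, from
    \<open>x = nb 0\<close> to \<open>y = nb 5\<close>.\<close>
  define nb where "nb j = (cw_next v ^^ j) x" for j
  have nbS: "cw_next v (nb j) = nb (Suc j)" for j by (simp add: nb_def)
  have nbs: "nb 0 = (c, t)" "nb 1 = (c + 1, t)" "nb 2 = (c + 1, t + 1)" "nb 3 = (c, t + 2)"
    "nb 4 = (c - 1, t + 2)" "nb 5 = (c - 1, t + 1)"
    by (simp_all add: nb_def v x eval_nat_numeral)
  have nbl: "ladj v (nb j)" for j
  proof (induction j)
    case 0
    then show ?case by (simp add: nb_def v x ladj_iff)
  next
    case (Suc j)
    then show ?case using ladj_cw_next[OF Suc] nbS[of j] by simp
  qed
  have nbl': "ladj (nb j) (nb (Suc j))" for j using ladj_cw_next[OF nbl[of j]] nbS[of j] by simp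
  have nbv: "nb j \<noteq> v" for j using nbl[of j] by (auto simp: ladj_def)
  have wks: "walk G (al @ [x, y])" "walk G (y # be)" "{z, v} \<in> G" "{x, y} \<in> G" "walk G (v # ga)"
    using wk be unfolding z_def by (auto simp: successively_append_iff successively_Cons hd_append)
  have vn: "v \<notin> set (al @ [x, y] @ be)" "v \<notin> set ga" using dist by auto
  define L where "L = set (y # be)"
  have zL: "z \<in> L" using be by (simp add: z_def L_def)
  obtain m where m: "1 \<le> m" "m \<le> 4" "z = nb m"
  proof -
    have "ladj v z" using grove_edge[OF g wks(3)] ladj_sym by blast
    moreover have "z \<noteq> x" "z \<noteq> y" using dist be unfolding z_def by auto
    ultimately have "z = nb 1 \<or> z = nb 2 \<or> z = nb 3 \<or> z = nb 4"
      unfolding v nbs x y by (elim ladjE) simp_all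
    then show thesis using that[of 1] that[of 2] that[of 3] that[of 4] by auto
  qed
  let ?w = "y # be @ [v, y]"
  have wtri: "set ?w \<subseteq> tri n" and wout: "set ?w \<inter> outer n d = {}" and winn: "\<And>p. p \<in> set ?w \<Longrightarrow> shell p \<le> d"
    using good_in[OF good] by auto
  have vy: "ladj v y" using nbl[of 5] nbs y by simp
  have lat: "lat ?w"
  proof -
    have "lat ?ps" using good_lat[OF good] .
    then show ?thesis using vy be by (auto simp: successively_append_iff successively_Cons hd_append)
  qed
  have distw: "distinct (y # be @ [v])" using dist by auto
  have notside: "\<not> inside ?w p" if "p \<notin> tri n \<or> p \<in> side n" "p \<notin> set ?w" for p
    by (rule not_inside[OF lat _ wtri that]) auto
  have xw: "x \<notin> set ?w" using dist by auto
  \<comment> \<open>The part of the path from \<open>a\<close> to \<open>x\<close> avoids the loop,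
    and \<open>a\<close> is a boundary vertex.\<close>
  have xout: "\<not> inside ?w x"
  proof -
    let ?F = "{e \<in> G. e \<subseteq> set (al @ [x])}"
    have "walk G (al @ [x])" using wks(1) by (auto simp: successively_append_iff)
    then have "walk ?F (al @ [x])" by (rule walk_mono) auto
    then have "con ?F (hd (al @ [x])) x" by (rule walk_con) simp
    moreover have "hd (al @ [x]) = a" using hd by (simp add: hd_append split: if_splits)
    ultimately have c: "con ?F a x" by simp
    have ad: "p \<notin> set ?w" if "p \<in> set (al @ [x])" for p using that dist by auto
    have "inside ?w a = inside ?w x"
    proof (rule inside_con[OF lat c])
      fix p q assume "{p, q} \<in> ?F"
      then show "ladj p q \<and> p \<notin> set ?w \<and> q \<notin> set ?w \<and>
          (snd p < snd q \<longrightarrow> (hd ?w \<in> lrow p) = (last ?w \<in> lrow p))"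
        using grove_edge(3)[OF g] ad by simp
    qed
    moreover have "a \<in> set (al @ [x])" using hd by (cases al) auto
    then have "\<not> inside ?w a" using notside[of a] a(1) ad by blast
    ultimately show ?thesis by simp
  qed
  have sector: "inside ?w (nb j)" if "m < j" "j \<le> 4" "nb j \<notin> set ?w" for j
  proof -
    have x': "(c, (t + 1) - 1) \<notin> set (y # be @ [v])" "\<not> inside ?w (c, (t + 1) - 1)"
      using xw xout x by auto
    note LI = loop_inside[OF lat distw be v y x']
    have dnb: "nb 1 \<noteq> nb 2" "nb 1 \<noteq> nb 3" "nb 1 \<noteq> nb 4" "nb 2 \<noteq> nb 3" "nb 2 \<noteq> nb 4" "nb 3 \<noteq> nb 4"
      unfolding nbs by simp_all
    have nbs': "nb 4 = (c - 1, t + 1 + 1)" "nb 3 = (c, t + 1 + 1)" "nb 2 = (c + 1, t + 1)" using nbs by auto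
    have j: "j = 2 \<or> j = 3 \<or> j = 4" using that m(1) by auto
    have lz: "last be = nb m" using m(3) z_def by simp
    have mm: "m = 1 \<or> m = 2 \<or> m = 3 \<or> m = 4" using m by auto
    from j show ?thesis
    proof (elim disjE)
      assume j: "j = 4"
      then show ?thesis using LI(1)[folded nbs'] lz mm dnb that(1) by auto
    next
      assume j: "j = 3"
      then show ?thesis using LI(2)[folded nbs'] lz mm dnb that by auto
    next
      assume j: "j = 2"
      then show ?thesis using LI(3)[folded nbs'] lz mm dnb that by auto
    qed
  qed
  \<comment> \<open>An edge of \<open>H\<close> at \<open>v\<close> would put \<open>v\<close> into
    column \<open>d\<close>. That column would then contain the edge \<open>x v\<close>, which
    closes a cycle with the loop. So turning the edge of \<open>v\<close> deletes nothing from
    \<open>H\<close>.\<close>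
  have vH: "{v, p} \<notin> H" for p
  proof
    assume vp: "{v, p} \<in> H"
    have "shell v \<le> d" using winn by simp
    with vp obtain s where s: "{v, p} = {(d, s), (d, s + 1)}" "target_col n d \<subseteq> H"
      by (elim H_form) (auto simp: outer_def)
    then have cd: "c = d" using v by (auto simp: doubleton_eq_iff)
    have "x \<in> tri n" "v \<in> tri n" "shell v \<le> d" using good_in[OF good] by auto
    then have "{(d, t), (d, t + 1)} \<in> target_col n d" using x v cd by (auto simp: target_col_def tri_def shell_def)
    then have xv: "{x, v} \<in> G" using s(2) HG x v cd by auto
    have "{x, v} \<noteq> {x, y}" using dist by (auto simp: doubleton_eq_iff)
    then have "con (G - {{x, y}}) x v" using xv by (intro con_edge) auto
    moreover have "con (G - {{x, y}}) y v"
    proof -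
      have "walk G (y # be @ [v])" using wk be by (auto simp: successively_append_iff successively_Cons hd_append)
      then have "walk (G - {{x, y}}) (y # be @ [v])"
        by (rule walk_mono) (use dist in \<open>auto simp: doubleton_eq_iff\<close>)
      then have "con (G - {{x, y}}) (hd (y # be @ [v])) v" by (rule walk_con) simp
      then show ?thesis by simp
    qed
    ultimately have "con (G - {{x, y}}) x y" using con_sym con_trans by metis
    then show False using acycD[OF grove_acyc[OF g] wks(4)] by simp
  qed
  \<comment> \<open>The loop and the neighbours of \<open>v\<close> swept so far. The invariant is
    that this set is connected within itself, hence without \<open>v\<close>, so that turning the
    edge of \<open>v\<close> from one of its members to the next changes no component.\<close>
  define D where "D j = L \<union> nb ` {m..j}" for j
  have vD: "v \<notin> D j" for j using vn(1) nbv by (auto simp: D_def L_def)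
  have turned: "\<exists>G'. reach n G G' \<and> grove n G' \<and> H \<subseteq> G' \<and> walk G' (al @ [x, y]) \<and> walk G' (v # ga) \<and>
      {v, nb j} \<in> G' \<and> (\<forall>p\<in>D j. con {e \<in> G'. e \<subseteq> D j} y p) \<and> D j \<inter> set ga = {}" if "m \<le> j" "j \<le> 5" for j
    using that
  proof (induction j rule: dec_induct)
    case base
    have D: "D m = L" using zL m(3) by (auto simp: D_def)
    have "walk {e \<in> G. e \<subseteq> L} (y # be)" by (rule walk_mono[OF wks(2)]) (auto simp: L_def)
    then have "\<forall>p\<in>L. con {e \<in> G. e \<subseteq> L} y p" using walk_con[of _ "y # be"] by (auto simp: L_def)
    moreover have "L \<inter> set ga = {}" using dist by (auto simp: L_def)
    ultimately show ?case using g HG wks m(3) D by (intro exI[of _ G]) (simp add: insert_commute)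
  next
    case (step j)
    then obtain G1 where G1: "reach n G G1" "grove n G1" "H \<subseteq> G1" "walk G1 (al @ [x, y])" "walk G1 (v # ga)"
      "{v, nb j} \<in> G1" "\<And>p. p \<in> D j \<Longrightarrow> con {e \<in> G1. e \<subseteq> D j} y p" "D j \<inter> set ga = {}" by auto
    define z' where "z' = nb (Suc j)"
    have jD: "nb j \<in> D j" using step by (auto simp: D_def)
    have DS: "D (Suc j) = insert z' (D j)" using step by (auto simp: D_def z'_def atLeastAtMostSuc_conv)
    have c1: "con G1 a y"
    proof -
      have "con G1 (hd (al @ [x, y])) y" by (rule walk_con[OF G1(4)]) simp
      then show ?thesis using hd by (simp add: hd_append split: if_splits)
    qed
    have Dtri: "D j \<subseteq> tri n"
    proof
      fix p assume "p \<in> D j"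
      then have "con G1 y p" using G1(7) by (metis (no_types, lifting) con_mono mem_Collect_eq subsetI)
      with c1 have "con G1 a p" by (rule con_trans)
      then show "p \<in> tri n" using con_in_stage(1)[OF G1(2,3)] by simp
    qed
    obtain G2 where G2: "reach n G1 G2" "grove n G2" "H \<subseteq> G2" "walk G2 (al @ [x, y])" "walk G2 (v # ga)"
      "{v, nb j} \<in> G2" "\<And>p. p \<in> D (Suc j) \<Longrightarrow> con {e \<in> G2. e \<subseteq> D (Suc j)} y p" "D (Suc j) \<inter> set ga = {}" "z' \<in> tri n"
    proof (cases "z' \<in> D j")
      case True
      then have "D (Suc j) = D j" using DS by auto
      then show thesis using that[of G1] G1 True Dtri by auto
    next
      case False
      \<comment> \<open>A neighbour not yet in \<open>D j\<close> is enclosed by the loop, and so is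
        its pocket. Hence \<open>z'\<close> can be attached to \<open>nb j\<close> before
        \<open>v\<close> is turned to it.\<close>
      define C where "C = insert v (D j) \<union> outer n d"
      have z'w: "z' \<notin> set ?w" using False nbv[of "Suc j"] by (auto simp: D_def L_def z'_def)
      have "z' \<noteq> y" using z'w by auto
      then have j4: "Suc j \<le> 4"
        using step nbs(6) y unfolding z'_def by (metis Suc_leI le_antisym not_less_eq_eq eval_nat_numeral(3))
      have ins: "inside ?w z'" unfolding z'_def by (rule sector) (use step j4 z'w z'_def in auto)
      have z't: "z' \<in> tri n" using notside[of z'] ins z'w by blast
      have z'o: "z' \<notin> outer n d"
      proof
        assume "z' \<in> outer n d"
        then obtain p where p: "p \<in> side n" "p \<in> outer n d" "con (target_beyond n d) z' p"
          using outer_anchor[OF _ d0(1)] by metis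
        have "inside ?w z' = inside ?w p"
        proof (rule inside_con[OF lat p(3)])
          fix p q assume pq: "{p, q} \<in> target_beyond n d"
          have "{p, q} \<subseteq> outer n d" by (rule target_beyond_outer[OF d0(1) pq])
          moreover have "{p, q} \<in> G" using pq TH HG by auto
          ultimately show "ladj p q \<and> p \<notin> set ?w \<and> q \<notin> set ?w \<and>
              (snd p < snd q \<longrightarrow> (hd ?w \<in> lrow p) = (last ?w \<in> lrow p))"
            using grove_edge(3)[OF g, of p q] wout by auto
        qed
        moreover have "p \<notin> set ?w" using p(2) wout by blast
        ultimately show False using notside[of p] p(1) ins by blast
      qed
      have z'C: "z' \<notin> C" using False z'o nbv[of "Suc j"] by (auto simp: C_def z'_def)
      have sol: "solid G1 C" unfolding C_def
      proof (rule solid_ext[OF G1(2) subset_trans[OF TH G1(3)] d0(1) a c1])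
        fix p assume p: "p \<in> insert v (D j)"
        have Dc: "con {e \<in> G1. e \<subseteq> insert v (D j)} y p" if "p \<in> D j" for p
          using G1(7)[OF that] by (rule con_mono) auto
        have "con {e \<in> G1. e \<subseteq> insert v (D j)} (nb j) v"
          using G1(6) jD by (intro con_edge) (auto simp: insert_commute)
        with Dc[OF jD] have "con {e \<in> G1. e \<subseteq> insert v (D j)} y v" by (rule con_trans)
        then show "con {e \<in> G1. e \<subseteq> insert v (D j)} y p"
          using p Dc[of p] by (elim insertE) simp_all
      qed
      have wC: "set ?w \<subseteq> C" by (auto simp: C_def D_def L_def)
      have fr: "pocket G1 C z' \<inter> side n = {}"
      proof (rule ccontr)
        assume "pocket G1 C z' \<inter> side n \<noteq> {}"
        then obtain p where p: "p \<in> pocket G1 C z'" "p \<in> side n" by blast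
        then have c: "con {e \<in> G1. e \<inter> C = {}} z' p" by (simp add: pocket_def)
        have "inside ?w z' = inside ?w p"
        proof (rule inside_con[OF lat c])
          fix p q assume "{p, q} \<in> {e \<in> G1. e \<inter> C = {}}"
          then show "ladj p q \<and> p \<notin> set ?w \<and> q \<notin> set ?w \<and>
              (snd p < snd q \<longrightarrow> (hd ?w \<in> lrow p) = (last ?w \<in> lrow p))"
            using grove_edge(3)[OF G1(2), of p q] wC by auto
        qed
        moreover have "p \<notin> set ?w" using p(1) pocket_disjoint[OF z'C] wC by blast
        ultimately show False using notside[of p] p(2) ins by blast
      qed
      have l: "ladj z' (nb j)" using nbl'[of j] ladj_sym z'_def by blast
      obtain G2 where G2: "reach n G1 G2" "grove n G2" "{z', nb j} \<in> G2"
        "\<And>e. e \<in> G1 \<Longrightarrow> e \<inter> pocket G1 C z' = {} \<Longrightarrow> e \<in> G2"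
        using attach[OF G1(2) z't z'C sol fr l] by blast
      have keep: "e \<in> G2" if "e \<in> G1" "e \<subseteq> C" for e
        using G2(4)[OF that(1)] that(2) pocket_disjoint[OF z'C] by blast
      have H2: "H \<subseteq> G2"
      proof
        fix e assume e: "e \<in> H"
        have "outer n d \<subseteq> C" by (auto simp: C_def)
        then show "e \<in> G2" using H_pocket[OF G1(2,3) e _ z'C sol fr] G2(4) e G1(3) by blast
      qed
      have w1: "walk G2 (al @ [x, y])"
      proof (rule walk_edges_pocket[OF G1(2) z'C sol fr G1(4)])
        show "distinct (al @ [x, y])" using dist by auto
        have "hd (al @ [x, y]) = a" using hd by (simp add: hd_append split: if_splits)
        then show "hd (al @ [x, y]) \<in> C \<union> side n" using a(1) by simp
        show "last (al @ [x, y]) \<in> C \<union> side n" by (simp add: C_def D_def L_def)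
      qed (use G2(4) in simp_all)
      have w2: "walk G2 (v # ga)"
      proof (rule walk_edges_pocket[OF G1(2) z'C sol fr G1(5)])
        show "distinct (v # ga)" using dist by auto
        have "last (v # ga) = b" using la by simp
        then show "last (v # ga) \<in> C \<union> side n" using b(1) by simp
        show "hd (v # ga) \<in> C \<union> side n" by (simp add: C_def)
      qed (use G2(4) in simp_all)
      have vj: "{v, nb j} \<in> G2" by (rule keep[OF G1(6)]) (use jD in \<open>auto simp: C_def\<close>)
      have Dc: "con {e \<in> G2. e \<subseteq> D (Suc j)} y p" if "p \<in> D j" for p
        using G1(7)[OF that] by (rule con_mono) (use keep DS in \<open>auto simp: C_def\<close>)
      have "con {e \<in> G2. e \<subseteq> D (Suc j)} (nb j) z'"
        using G2(3) jD DS by (intro con_edge) (auto simp: insert_commute)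
      with Dc[OF jD] have "con {e \<in> G2. e \<subseteq> D (Suc j)} y z'" by (rule con_trans)
      then have D2: "con {e \<in> G2. e \<subseteq> D (Suc j)} y p" if "p \<in> D (Suc j)" for p
        using that[unfolded DS] Dc[of p] by (elim insertE) simp_all
      \<comment> \<open>Otherwise the rest of the path would lead from \<open>z'\<close> to
        \<open>b\<close> and bring a boundary vertex into the pocket.\<close>
      have "z' \<notin> set ga"
      proof
        assume "z' \<in> set ga"
        then obtain g1 g2 where ga: "ga = g1 @ z' # g2" by (meson split_list)
        have wg: "walk G1 (z' # g2)" using G1(5) ga by (auto simp: successively_append_iff successively_Cons)
        have gC: "p \<notin> C" if "p \<in> set ga" for p
          using that G1(8) vn(2) good_in(2)[OF good, of p] by (auto simp: C_def)
        have "walk {e \<in> G1. e \<inter> C = {}} (z' # g2)"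
          by (rule walk_mono[OF wg]) (use gC ga in auto)
        then have "con {e \<in> G1. e \<inter> C = {}} (hd (z' # g2)) (last (z' # g2))" by (rule walk_con) simp
        moreover have "last (z' # g2) = b" using la ga by simp
        ultimately have "b \<in> pocket G1 C z'" by (simp add: pocket_def)
        then show False using fr b(1) by blast
      qed
      then have "D (Suc j) \<inter> set ga = {}" using G1(8) DS by auto
      then show thesis using that[OF G2(1,2) H2 w1 w2 vj D2 _ z't] by simp
    qed
    let ?G3 = "insert {v, z'} (G2 - {{v, nb j}})"
    have sub: "{e \<in> G2. e \<subseteq> D (Suc j)} \<subseteq> G2 - {{v, nb j}}" using vD by blast
    have yc: "con (G2 - {{v, nb j}}) y p" if "p \<in> D (Suc j)" for p
      using con_mono[OF G2(7)[OF that] sub] .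
    have jz: "con (G2 - {{v, nb j}}) (nb j) z'"
      using con_sym[OF yc[of "nb j"]] yc[of z'] jD DS con_trans by (metis insertI1 insertI2)
    have nc: "\<not> con (G2 - {{v, nb j}}) v z'"
    proof
      assume "con (G2 - {{v, nb j}}) v z'"
      then have "con (G2 - {{v, nb j}}) v (nb j)" using con_sym[OF jz] by (rule con_trans)
      then show False using acycD[OF grove_acyc[OF G2(2)] G2(6)] by simp
    qed
    have sp: "reach n G2 ?G3" "grove n ?G3"
      using spin_step[OF G2(2,6) _ G2(9) nc disjI1[OF jz]] nbS[of j] z'_def by simp_all
    have r3: "reach n G ?G3" using G1(1) G2(1) sp(1) by (meson rtranclp_trans)
    have H3: "H \<subseteq> ?G3" using G2(3) vH[of "nb j"] by blast
    have w3: "walk ?G3 (al @ [x, y])"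
      by (rule walk_mono[OF G2(4)]) (use vn(1) in \<open>auto simp: doubleton_eq_iff\<close>)
    have jga: "nb j \<notin> set ga" using G2(8) DS jD by blast
    have w4: "walk ?G3 (v # ga)"
      by (rule walk_mono[OF G2(5)]) (use jga nbv[of j] in \<open>auto simp: doubleton_eq_iff\<close>)
    have D3: "\<forall>p\<in>D (Suc j). con {e \<in> ?G3. e \<subseteq> D (Suc j)} y p"
    proof
      fix p assume "p \<in> D (Suc j)"
      from G2(7)[OF this] show "con {e \<in> ?G3. e \<subseteq> D (Suc j)} y p" by (rule con_mono) (use sub in blast)
    qed
    show ?case using r3 sp(2) H3 w3 w4 D3 G2(8) z'_def by (intro exI[of _ ?G3]) simp
  qed
  have "m \<le> 5" using m by simp
  from turned[OF this order_refl]
  obtain G' where G': "reach n G G'" "grove n G'" "H \<subseteq> G'" "walk G' (al @ [x, y])" "walk G' (v # ga)" "{v, nb 5} \<in> G'"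
    by (elim exE conjE)
  have "{y, v} \<in> G'" using G'(6) nbs(6) y by (simp add: insert_commute)
  then have "walk G' (al @ x # y # v # ga)" using G'(4,5)
    by (auto simp: successively_append_iff successively_Cons)
  moreover have "distinct (al @ x # y # v # ga)" using dist by auto
  moreover have "hd (al @ x # y # v # ga) = a" using hd by (simp add: hd_append split: if_splits)
  moreover have "last (al @ x # y # v # ga) = b" using la by simp
  ultimately have "good G' (al @ x # y # v # ga)" using G' unfolding good_def by simp
  then show ?thesis using G'(1) by (intro exI[of _ G'] conjI)
qed

section \<open>Moves that lower the weight of the path\<close>

definition improves :: "point set set \<Rightarrow> point list \<Rightarrow> bool" where
  "improves G ps \<longleftrightarrow> (\<exists>G' ps'. reach n G G' \<and> good G' ps' \<and> weight n ps' < weight n ps)"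

lemma improvesI: "reach n G G' \<Longrightarrow> good G' ps' \<Longrightarrow> weight n ps' < weight n ps \<Longrightarrow> improves G ps"
  unfolding improves_def by blast

text \<open>The bound on the level sum keeps the exponent of the first edge positive, so
  \<open>nat\<close> does not hide the drop; one step of the exponent gives a factor 3, which beats
  2.\<close>

lemma weight_edge_less:
  assumes "level p + level q < level p' + level q'" "level p + level q \<le> 2 * int n"
  shows "2 * weight n [p', q'] < weight n [p, q]"
proof -
  let ?m = "nat (2 * int n + 2 - level p - level q)" and ?m' = "nat (2 * int n + 2 - level p' - level q')"
  have "?m' < ?m" using assms by simp
  then obtain k where k: "?m = Suc k" "?m' \<le> k" by (metis less_imp_Suc_add le_add1 add_Suc_right)
  have "(3::nat) ^ ?m' \<le> 3 ^ k" using k(2) by (simp add: power_increasing)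
  moreover have "0 < (3::nat) ^ k" by simp
  ultimately have "2 * (3::nat) ^ ?m' < 3 ^ ?m" unfolding k(1) power_Suc by linarith
  then show ?thesis by simp
qed

text \<open>Here \<open>v\<close> lies on the path before \<open>x\<close>. Turning \<open>y\<close>
  from \<open>x\<close> to \<open>v\<close> cuts out the piece between \<open>v\<close> and
  \<open>x\<close> and lets the path continue from \<open>v\<close> directly to
  \<open>y\<close>.\<close>

lemma push_back:
  assumes good: "good G (al1 @ v # al2 @ x # y # be)"
    and x: "x = (c, t)" and y: "y = (c - 1, t + 1)" and v: "v = (c, t + 1)"
  shows "improves G (al1 @ v # al2 @ x # y # be)"
proof -
  let ?ps = "al1 @ v # al2 @ x # y # be"
  have g: "grove n G" and HG: "H \<subseteq> G" and wk: "walk G ?ps" and dist: "distinct ?ps"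
    and hd: "hd ?ps = a" and la: "last ?ps = b" using good by (auto simp: good_def)
  have tri: "x \<in> tri n" "v \<in> tri n" "shell y \<le> d" using good_in[OF good] by auto
  have yx: "{y, x} \<in> G" using wk by (auto simp: successively_append_iff successively_Cons insert_commute)
  have cw: "cw_next y x = v" by (simp add: x y v)
  have wv: "walk G (v # al2 @ [x])" using wk by (auto simp: successively_append_iff successively_Cons hd_append)
  have "walk (G - {{y, x}}) (v # al2 @ [x])"
    by (rule walk_mono[OF wv]) (use dist in \<open>auto simp: doubleton_eq_iff\<close>)
  then have "con (G - {{y, x}}) (hd (v # al2 @ [x])) x" by (rule walk_con) simp
  then have xv: "con (G - {{y, x}}) x v" by (simp add: con_sym)
  have nc: "\<not> con (G - {{y, x}}) y v"
  proof
    assume "con (G - {{y, x}}) y v"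
    then have "con (G - {{y, x}}) y x" using con_sym[OF xv] by (rule con_trans)
    then show False using acycD[OF grove_acyc[OF g] yx] by simp
  qed
  let ?G = "insert {y, v} (G - {{y, x}})"
  have sp: "reach n G ?G" "grove n ?G" using spin_step[OF g yx cw tri(2) nc disjI1[OF xv]] by simp_all
  have "{y, x} \<notin> H" using H_edge_shell[of y x] tri(3) x y by auto
  then have H': "H \<subseteq> ?G" using HG by blast
  have w1: "walk G (al1 @ [v])" "walk G (y # be)" using wk by (auto simp: successively_append_iff successively_Cons)
  have "walk ?G (al1 @ [v])" by (rule walk_mono[OF w1(1)]) (use dist in \<open>auto simp: doubleton_eq_iff\<close>)
  moreover have "walk ?G (y # be)" by (rule walk_mono[OF w1(2)]) (use dist in \<open>auto simp: doubleton_eq_iff\<close>)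
  ultimately have "walk ?G (al1 @ v # y # be)"
    by (auto simp: successively_append_iff successively_Cons insert_commute)
  moreover have "distinct (al1 @ v # y # be)" using dist by auto
  moreover have "hd (al1 @ v # y # be) = a" using hd by (simp add: hd_append split: if_splits)
  moreover have "last (al1 @ v # y # be) = b" using la by simp
  ultimately have good': "good ?G (al1 @ v # y # be)" unfolding good_def using sp(2) H' by simp
  have "2 * weight n [v, y] < weight n [x, y]"
    by (rule weight_edge_less) (use tri in \<open>auto simp: x y v level_def tri_def\<close>)
  moreover have "weight n ?ps = weight n (al1 @ [v]) + (weight n ((v # al2) @ [x]) + (weight n [x, y] + weight n (y # be)))"
    using weight_append[of n al1 v "al2 @ x # y # be"] weight_append[of n "v # al2" x "y # be"] by simp
  moreover have "weight n (al1 @ v # y # be) = weight n (al1 @ [v]) + (weight n [v, y] + weight n (y # be))"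
    using weight_append[of n al1 v "y # be"] by simp
  ultimately have "weight n (al1 @ v # y # be) < weight n ?ps" by linarith
  then show ?thesis using sp(1) good' by (intro improvesI)
qed

text \<open>Turning \<open>v\<close> from \<open>y\<close> to \<open>x\<close> lets the path skip
  \<open>y\<close>; the second spin moves the released vertex \<open>y\<close> from \<open>x\<close>
  to \<open>v\<close>.\<close>

lemma push_tri:
  assumes good: "good G (al @ x # y # v # ga)"
    and x: "x = (c, t)" and y: "y = (c - 1, t + 1)" and v: "v = (c, t + 1)"
  shows "improves G (al @ x # y # v # ga)"
proof -
  let ?ps = "al @ x # y # v # ga"
  have g: "grove n G" and HG: "H \<subseteq> G" and wk: "walk G ?ps" and dist: "distinct ?ps"
    and hd: "hd ?ps = a" and la: "last ?ps = b" using good by (auto simp: good_def)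
  have tri: "x \<in> tri n" "v \<in> tri n" "y \<in> tri n" "shell y \<le> d" using good_in[OF good] by auto
  have yx: "{y, x} \<in> G" and vy: "{v, y} \<in> G"
    using wk by (auto simp: successively_append_iff successively_Cons insert_commute)
  have cw: "cw_next v y = x" "cw_next y x = v" by (simp_all add: x y v)
  have ne: "x \<noteq> y" "x \<noteq> v" "y \<noteq> v" using dist by auto
  have "con (G - {{v, y}}) y x" using yx ne by (intro con_edge) (auto simp: doubleton_eq_iff)
  moreover have "\<not> con (G - {{v, y}}) v x"
  proof
    assume "con (G - {{v, y}}) v x"
    then have "con (G - {{v, y}}) v y" using con_sym[OF calculation] by (rule con_trans)
    then show False using acycD[OF grove_acyc[OF g] vy] by simp
  qed
  ultimately have sp1: "reach n G (insert {v, x} (G - {{v, y}}))" "grove n (insert {v, x} (G - {{v, y}}))"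
    using spin_step[OF g vy cw(1) tri(1) _ disjI1] by simp_all
  define G1 where "G1 = insert {v, x} (G - {{v, y}})"
  have yx1: "{y, x} \<in> G1" using yx ne by (auto simp: G1_def doubleton_eq_iff)
  have c1: "con (G1 - {{y, x}}) x v"
    using ne by (intro con_edge) (auto simp: G1_def doubleton_eq_iff)
  have g1: "grove n G1" using sp1(2) by (simp add: G1_def)
  have nc1: "\<not> con (G1 - {{y, x}}) y v"
  proof
    assume "con (G1 - {{y, x}}) y v"
    then have "con (G1 - {{y, x}}) y x" using con_sym[OF c1] by (rule con_trans)
    then show False using acycD[OF grove_acyc[OF g1] yx1] by simp
  qed
  define G2 where "G2 = insert {y, v} (G1 - {{y, x}})"
  have sp2: "reach n G1 G2" "grove n G2"
    unfolding G2_def using spin_step[OF g1 yx1 cw(2) tri(2) nc1 disjI1[OF c1]] by simp_all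
  have r: "reach n G G2" using sp1(1) sp2(1) unfolding G1_def by (rule rtranclp_trans)
  have nH: "{y, x} \<notin> H" "{v, y} \<notin> H"
    using H_edge_shell[of y x] H_edge_shell[of y v] tri(4) x y v by (auto simp: insert_commute)
  have keep: "e \<in> G2" if "e \<in> G" "e \<noteq> {y, x}" "e \<noteq> {v, y}" for e
    using that by (simp add: G1_def G2_def)
  have H': "H \<subseteq> G2" using HG nH keep by blast
  have w1: "walk G (al @ [x])" "walk G (v # ga)" using wk by (auto simp: successively_append_iff successively_Cons)
  have "walk G2 (al @ [x])"
    by (rule walk_mono[OF w1(1)], rule keep) (use dist in \<open>auto simp: doubleton_eq_iff\<close>)
  moreover have "walk G2 (v # ga)"
    by (rule walk_mono[OF w1(2)], rule keep) (use dist in \<open>auto simp: doubleton_eq_iff\<close>)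
  moreover have "{x, v} \<in> G2" using ne by (auto simp: G1_def G2_def doubleton_eq_iff)
  ultimately have "walk G2 (al @ x # v # ga)"
    by (auto simp: successively_append_iff successively_Cons)
  moreover have "distinct (al @ x # v # ga)" using dist by auto
  moreover have "hd (al @ x # v # ga) = a" using hd by (simp add: hd_append split: if_splits)
  moreover have "last (al @ x # v # ga) = b" using la by simp
  ultimately have good': "good G2 (al @ x # v # ga)" unfolding good_def using sp2(2) H' by simp
  have "weight n ?ps = weight n (al @ [x]) + (weight n [x, y] + (weight n [y, v] + weight n (v # ga)))"
    using weight_append[of n al x "y # v # ga"] by simp
  moreover have "weight n (al @ x # v # ga) = weight n (al @ [x]) + (weight n [x, v] + weight n (v # ga))"
    using weight_append[of n al x "v # ga"] by simp
  moreover have "weight n [x, v] = weight n [y, v]" by (simp add: x y v level_def algebra_simps)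
  moreover have "0 < weight n [x, y]" by simp
  ultimately have "weight n (al @ x # v # ga) < weight n ?ps" by linarith
  then show ?thesis using r good' by (intro improvesI)
qed

text \<open>After \<open>close_loop\<close> the piece from \<open>y\<close> to \<open>v\<close> is a
  single edge. It is not heavier than the first edge of that piece, because no neighbour of
  \<open>y\<close> has a larger level than \<open>v\<close>; the other edges of the piece are pure
  gain.\<close>

lemma push_loop:
  assumes good: "good G (al @ x # y # be @ v # ga)" and be: "be \<noteq> []"
    and x: "x = (c, t)" and y: "y = (c - 1, t + 1)" and v: "v = (c, t + 1)"
  shows "improves G (al @ x # y # be @ v # ga)"
proof -
  let ?ps = "al @ x # y # be @ v # ga"
  obtain G' where G': "reach n G G'" "good G' (al @ x # y # v # ga)"
    using close_loop[OF good be x y v] by (elim exE conjE)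
  obtain u be' where bu: "be = u # be'" using be by (cases be) auto
  have "ladj y u" using good_lat[OF good] bu by (auto simp: successively_append_iff successively_Cons)
  then have "level u \<le> level v" unfolding y v by (elim ladjE) (auto simp: level_def)
  then have 1: "weight n [y, v] \<le> weight n [y, u]" by (simp add: power_increasing)
  have "weight n ?ps = weight n (al @ [x]) + (weight n [x, y] + (weight n [y, u] + (weight n ((u # be') @ [v]) + weight n (v # ga))))"
    using weight_append[of n al x "y # be @ v # ga"] weight_append[of n "u # be'" v ga] bu by simp
  moreover have "weight n (al @ x # y # v # ga) = weight n (al @ [x]) + (weight n [x, y] + (weight n [y, v] + weight n (v # ga)))"
    using weight_append[of n al x "y # v # ga"] by simp
  moreover have "0 < weight n ((u # be') @ [v])" by (cases be') auto
  ultimately have "weight n (al @ x # y # v # ga) < weight n ?ps" using 1 by linarith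
  then show ?thesis using G' by (intro improvesI)
qed

text \<open>By \<open>uniq\<close> the leftward ray from the triangle \<open>x y v\<close> crosses
  the path only at the edge \<open>x y\<close>, so \<open>v\<close> is inside. Its pocket therefore
  has no boundary vertex; \<open>v\<close> can be attached to \<open>x\<close>, and then
  \<open>y\<close> is turned from \<open>x\<close> to \<open>v\<close>.\<close>

lemma push_free:
  assumes good: "good G (al @ x # y # be)"
    and x: "x = (c, t)" and y: "y = (c - 1, t + 1)" and v: "v = (c, t + 1)" "v \<in> tri n" "shell v \<le> d"
    and vps: "v \<notin> set (al @ x # y # be)"
    and uniq: "\<And>p q. p \<in> set (al @ x # y # be) \<Longrightarrow> q \<in> set (al @ x # y # be) \<Longrightarrow> ladj p q \<Longrightarrow>
      up_cross (c - 1) (t + 1) p q \<Longrightarrow> {p, q} = {x, y}"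
  shows "improves G (al @ x # y # be)"
proof -
  let ?ps = "al @ x # y # be"
  have g: "grove n G" and HG: "H \<subseteq> G" and wk: "walk G ?ps" and dist: "distinct ?ps"
    and hd: "hd ?ps = a" and la: "last ?ps = b" using good by (auto simp: good_def)
  have lat: "lat ?ps" using good_lat[OF good] .
  have lat1: "lat (al @ [x])" "lat (y # be)" using lat by (auto simp: successively_append_iff successively_Cons)
  have tri: "x \<in> tri n" "shell y \<le> d" using good_in[OF good] by auto
  have yx: "{y, x} \<in> G" using wk by (auto simp: successively_append_iff successively_Cons insert_commute)
  have ins: "inside ?ps v"
  proof -
    have "\<not> cross_parity (up_cross (c - 1) (t + 1)) (al @ [x])"
    proof (rule cross_parity_none[OF lat1(1)])
      fix p q assume pq: "p \<in> set (al @ [x])" "q \<in> set (al @ [x])" "ladj p q"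
      show "\<not> up_cross (c - 1) (t + 1) p q"
      proof
        assume "up_cross (c - 1) (t + 1) p q"
        then have "{p, q} = {x, y}" using uniq[of p q] pq by auto
        then show False using pq dist by (auto simp: doubleton_eq_iff)
      qed
    qed
    moreover have "\<not> cross_parity (up_cross (c - 1) (t + 1)) (y # be)"
    proof (rule cross_parity_none[OF lat1(2)])
      fix p q assume pq: "p \<in> set (y # be)" "q \<in> set (y # be)" "ladj p q"
      show "\<not> up_cross (c - 1) (t + 1) p q"
      proof
        assume "up_cross (c - 1) (t + 1) p q"
        then have "{p, q} = {x, y}" using uniq[of p q] pq by auto
        then show False using pq dist by (auto simp: doubleton_eq_iff)
      qed
    qed
    moreover have "up_cross (c - 1) (t + 1) x y" by (simp add: up_cross_def x y)
    ultimately have "inside ?ps (c - 1, t + 1)"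
      using cross_parity_append[of "up_cross (c - 1) (t + 1)" al x y be] by (simp add: inside_def)
    then show ?thesis using inside_right[OF lat, of "c - 1" "t + 1"] vps v(1) by simp
  qed
  define C where "C = set ?ps \<union> outer n d"
  have vC: "v \<notin> C" using vps v(3) by (auto simp: C_def outer_def)
  have sol: "solid G C" unfolding C_def
  proof (rule solid_ext[OF g subset_trans[OF TH HG] d0(1) a, of a])
    fix p assume p: "p \<in> set ?ps"
    have "walk {e \<in> G. e \<subseteq> set ?ps} ?ps" by (rule walk_mono[OF wk]) auto
    from walk_con[OF this p] show "con {e \<in> G. e \<subseteq> set ?ps} a p" using hd by simp
  qed simp
  have fr: "pocket G C v \<inter> side n = {}"
  proof (rule ccontr)
    assume "pocket G C v \<inter> side n \<noteq> {}"
    then obtain p where p: "p \<in> pocket G C v" "p \<in> side n" by blast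
    have pC: "p \<notin> C" using p(1) pocket_disjoint[OF vC] by blast
    from p(1) have c: "con {e \<in> G. e \<inter> C = {}} v p" by (simp add: pocket_def)
    \<comment> \<open>A vertex of shell \<open>d\<close> in a row \<open>t < d\<close> has first
      coordinate \<open>d\<close>, the largest possible for \<open>p'\<close>. So neither end of the
      path lies in the left part of the row of \<open>p'\<close>.\<close>
    have end': "r \<notin> lrow p'" if "r \<in> set ?ps" "shell r = d" "p' \<notin> C" "p' \<in> tri n" "snd p' < d" for r p'
    proof
      assume "r \<in> lrow p'"
      moreover have "shell p' \<le> d" using that by (auto simp: C_def outer_def)
      ultimately have "r = p'" using that(2,5) by (auto simp: lrow_def shell_def prod_eq_iff)
      then show False using that(1,3) by (auto simp: C_def)
    qed
    have aps: "a \<in> set ?ps" "b \<in> set ?ps" using hd la by (metis hd_in_set last_in_set Nil_is_append_conv list.distinct(1))+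
    have "inside ?ps v = inside ?ps p"
    proof (rule inside_con[OF lat c])
      fix p q assume pq: "{p, q} \<in> {e \<in> G. e \<inter> C = {}}"
      then have pq': "p \<notin> C" "q \<notin> C" "{p, q} \<in> G" by auto
      note ge = grove_edge[OF g pq'(3)]
      have "snd p < snd q \<longrightarrow> (hd ?ps \<in> lrow p) = (last ?ps \<in> lrow p)"
      proof
        assume "snd p < snd q"
        moreover have "shell q \<le> d" using ge(2) pq'(2) by (auto simp: C_def outer_def)
        ultimately have "snd p < d" by (auto simp: shell_def)
        then show "(hd ?ps \<in> lrow p) = (last ?ps \<in> lrow p)"
          unfolding hd la using end'[OF aps(1) a(2) pq'(1) ge(1)] end'[OF aps(2) b(2) pq'(1) ge(1)] by simp
      qed
      then show "ladj p q \<and> p \<notin> set ?ps \<and> q \<notin> set ?ps \<and>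
          (snd p < snd q \<longrightarrow> (hd ?ps \<in> lrow p) = (last ?ps \<in> lrow p))"
        using ge pq' by (auto simp: C_def)
    qed
    moreover have "\<not> inside ?ps p"
    proof (rule not_inside[OF lat _ _ disjI2[OF p(2)]])
      show "set ?ps \<subseteq> tri n" using good_in(1)[OF good] by blast
      show "p \<notin> set ?ps" using pC by (simp add: C_def)
      have pt: "p \<in> tri n" using p(2) side_tri by blast
      have m: "shell p \<le> d" using pC pt by (auto simp: C_def outer_def)
      assume "int n \<le> fst p + snd p"
      then have "fst p + snd p = int n" using pt by (auto simp: tri_def)
      moreover have "p \<noteq> a" "p \<noteq> b" using aps pC by (auto simp: C_def)
      ultimately show "(snd p \<le> snd (hd ?ps)) = (snd p \<le> snd (last ?ps))"
        unfolding hd la using hyp[OF p(2)] m by simp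
    qed simp
    ultimately show False using ins by simp
  qed
  have l: "ladj v x" by (simp add: v x ladj_iff)
  obtain G1 where G1: "reach n G G1" "grove n G1" "{v, x} \<in> G1"
    "\<And>e. e \<in> G \<Longrightarrow> e \<inter> pocket G C v = {} \<Longrightarrow> e \<in> G1"
    using attach[OF g v(2) vC sol fr l] by blast
  have keep: "e \<in> G1" if "e \<in> G" "e \<subseteq> C" for e
    using G1(4)[OF that(1)] that(2) pocket_disjoint[OF vC] by blast
  have H1: "H \<subseteq> G1"
  proof
    fix e assume e: "e \<in> H"
    have "outer n d \<subseteq> C" by (auto simp: C_def)
    then have "e \<inter> pocket G C v = {}" using H_pocket[OF g HG e _ vC sol fr] by simp
    then show "e \<in> G1" using G1(4) e HG by blast
  qed
  have wk1: "walk G1 ?ps" by (rule walk_mono[OF wk], rule keep) (auto simp: C_def)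
  have yx1: "{y, x} \<in> G1" using wk1 by (auto simp: successively_append_iff successively_Cons insert_commute)
  have ne: "v \<noteq> y" "v \<noteq> x" "x \<noteq> y" using vps dist by auto
  have c1: "con (G1 - {{y, x}}) x v"
    using G1(3) ne by (intro con_edge) (auto simp: doubleton_eq_iff insert_commute)
  have nc: "\<not> con (G1 - {{y, x}}) y v"
  proof
    assume "con (G1 - {{y, x}}) y v"
    then have "con (G1 - {{y, x}}) y x" using con_sym[OF c1] by (rule con_trans)
    then show False using acycD[OF grove_acyc[OF G1(2)] yx1] by simp
  qed
  have cw: "cw_next y x = v" by (simp add: x y v)
  let ?G = "insert {y, v} (G1 - {{y, x}})"
  have sp: "reach n G1 ?G" "grove n ?G" using spin_step[OF G1(2) yx1 cw v(2) nc disjI1[OF c1]] by simp_all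
  have r: "reach n G ?G" using G1(1) sp(1) by (rule rtranclp_trans)
  have "{y, x} \<notin> H" using H_edge_shell[of y x] tri(2) x y by auto
  then have H': "H \<subseteq> ?G" using H1 by blast
  have w1: "walk G1 (al @ [x])" "walk G1 (y # be)" using wk1 by (auto simp: successively_append_iff successively_Cons)
  have "walk ?G (al @ [x])" by (rule walk_mono[OF w1(1)]) (use dist in \<open>auto simp: doubleton_eq_iff\<close>)
  moreover have "walk ?G (y # be)" by (rule walk_mono[OF w1(2)]) (use dist in \<open>auto simp: doubleton_eq_iff\<close>)
  moreover have "{x, v} \<in> ?G" "{v, y} \<in> ?G" using G1(3) ne by (auto simp: doubleton_eq_iff insert_commute)
  ultimately have "walk ?G (al @ x # v # y # be)"
    by (auto simp: successively_append_iff successively_Cons)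
  moreover have "distinct (al @ x # v # y # be)" using dist vps by auto
  moreover have "hd (al @ x # v # y # be) = a" using hd by (simp add: hd_append split: if_splits)
  moreover have "last (al @ x # v # y # be) = b" using la by simp
  ultimately have good': "good ?G (al @ x # v # y # be)" unfolding good_def using sp(2) H' by simp
  have "2 * weight n [v, y] < weight n [x, y]"
    by (rule weight_edge_less) (use tri v in \<open>auto simp: x y v level_def tri_def\<close>)
  moreover have "weight n [x, v] = weight n [v, y]" by (simp add: x y v level_def algebra_simps)
  moreover have "weight n ?ps = weight n (al @ [x]) + (weight n [x, y] + weight n (y # be))"
    using weight_append[of n al x "y # be"] by simp
  moreover have "weight n (al @ x # v # y # be) = weight n (al @ [x]) + (weight n [x, v] + (weight n [v, y] + weight n (y # be)))"
    using weight_append[of n al x "v # y # be"] by simp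
  ultimately have "weight n (al @ x # v # y # be) < weight n ?ps" by linarith
  then show ?thesis using r good' by (intro improvesI)
qed

lemma push:
  assumes good: "good G (al @ x # y # be)"
    and x: "x = (c, t)" and y: "y = (c - 1, t + 1)" and v: "(c, t + 1) \<in> tri n" "shell (c, t + 1) \<le> d"
    and uniq: "\<And>p q. p \<in> set (al @ x # y # be) \<Longrightarrow> q \<in> set (al @ x # y # be) \<Longrightarrow> ladj p q \<Longrightarrow>
      up_cross (c - 1) (t + 1) p q \<Longrightarrow> {p, q} = {x, y}"
  shows "improves G (al @ x # y # be)"
proof -
  let ?v = "(c, t + 1)"
  have "?v \<noteq> x" "?v \<noteq> y" using x y by auto
  then consider "?v \<notin> set (al @ x # y # be)" | "?v \<in> set al" | "?v \<in> set be" by auto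
  then show ?thesis
  proof cases
    case 1
    then show ?thesis using push_free[OF good x y refl v _ uniq] by blast
  next
    case 2
    then obtain a1 a2 where "al = a1 @ ?v # a2" by (meson split_list)
    then show ?thesis using push_back[of G a1 ?v a2 x y be c t] good x y by simp
  next
    case 3
    then obtain b1 b2 where be: "be = b1 @ ?v # b2" by (meson split_list)
    show ?thesis
    proof (cases "b1 = []")
      case True
      then show ?thesis using push_tri[of G al x y ?v b2 c t] good x y be by simp
    next
      case False
      then show ?thesis using push_loop[of G al x y b1 ?v b2 c t] good x y be by simp
    qed
  qed
qed

text \<open>Both \<open>r\<close> and \<open>s\<close> have a larger level than \<open>x\<close>, so
  the edge \<open>s r\<close> is lighter than either of the two edges it replaces on the
  path.\<close>

lemma cut_corner:
  assumes good: "good G (al @ r # x # s # be)"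
    and x: "x = (c, t)" "shell x < d" and r: "r = (c + 1, t)" and s: "s = (c, t + 1)"
  shows "improves G (al @ r # x # s # be)"
proof -
  let ?ps = "al @ r # x # s # be"
  have g: "grove n G" and HG: "H \<subseteq> G" and wk: "walk G ?ps" and dist: "distinct ?ps"
    and hd: "hd ?ps = a" and la: "last ?ps = b" using good by (auto simp: good_def)
  have tri: "x \<in> tri n" "r \<in> tri n" "s \<in> tri n" using good_in[OF good] by auto
  have sx: "{s, x} \<in> G" and rx: "{x, r} \<in> G" using wk by (auto simp: successively_append_iff successively_Cons insert_commute)
  have cw: "cw_next s x = r" by (simp add: x r s)
  have ne: "r \<noteq> x" "s \<noteq> x" "r \<noteq> s" using dist by auto
  have c1: "con (G - {{s, x}}) x r" using rx ne by (intro con_edge) (auto simp: doubleton_eq_iff)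
  have nc: "\<not> con (G - {{s, x}}) s r"
  proof
    assume "con (G - {{s, x}}) s r"
    then have "con (G - {{s, x}}) s x" using con_sym[OF c1] by (rule con_trans)
    then show False using acycD[OF grove_acyc[OF g] sx] by simp
  qed
  let ?G = "insert {s, r} (G - {{s, x}})"
  have sp: "reach n G ?G" "grove n ?G" using spin_step[OF g sx cw tri(2) nc disjI1[OF c1]] by simp_all
  have "{x, s} \<notin> H" using H_edge_shell[of x s] x(2) by (auto simp: shell_def)
  then have H': "H \<subseteq> ?G" using HG by (auto simp: insert_commute)
  have w1: "walk G (al @ [r])" "walk G (s # be)" using wk by (auto simp: successively_append_iff successively_Cons)
  have "walk ?G (al @ [r])" by (rule walk_mono[OF w1(1)]) (use dist in \<open>auto simp: doubleton_eq_iff\<close>)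
  moreover have "walk ?G (s # be)" by (rule walk_mono[OF w1(2)]) (use dist in \<open>auto simp: doubleton_eq_iff\<close>)
  ultimately have "walk ?G (al @ r # s # be)"
    by (auto simp: successively_append_iff successively_Cons insert_commute)
  moreover have "distinct (al @ r # s # be)" using dist by auto
  moreover have "hd (al @ r # s # be) = a" using hd by (simp add: hd_append split: if_splits)
  moreover have "last (al @ r # s # be) = b" using la by simp
  ultimately have good': "good ?G (al @ r # s # be)" unfolding good_def using sp(2) H' by simp
  have "2 * weight n [r, s] < weight n [r, x]"
    by (rule weight_edge_less) (use tri in \<open>auto simp: x r s level_def tri_def\<close>)
  moreover have "weight n ?ps = weight n (al @ [r]) + (weight n [r, x] + (weight n [x, s] + weight n (s # be)))"
    using weight_append[of n al r "x # s # be"] by simp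
  moreover have "weight n (al @ r # s # be) = weight n (al @ [r]) + (weight n [r, s] + weight n (s # be))"
    using weight_append[of n al r "s # be"] by simp
  ultimately have "weight n (al @ r # s # be) < weight n ?ps" by linarith
  then show ?thesis using sp(1) good' by (intro improvesI)
qed

section \<open>Reversal of the path, and finding an edge that can be pushed\<close>

lemma stage_swap: "stage n d H b a"
  by unfold_locales (use d0 H a b lab hyp in auto)

lemma good_swap: "stage.good n H b a G (rev ps) = good G ps"
  unfolding good_def stage.good_def[OF stage_swap] walk_rev
  by (auto simp: hd_rev last_rev)

lemma improves_swap:
  assumes "stage.improves n H b a G (rev ps)"
  shows "improves G ps"
proof -
  obtain G' ps' where p: "reach n G G'" "stage.good n H b a G' ps'" "weight n ps' < weight n (rev ps)"
    using assms unfolding stage.improves_def[OF stage_swap] by blast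
  have "good G' (rev ps')" using good_swap[of G' "rev ps'"] p(2) by simp
  then show ?thesis using p(1,3) by (intro improvesI[of G G' "rev ps'"]) (simp_all add: weight_rev)
qed

text \<open>A step crossing the ray has an end \<open>(q1, t)\<close> with
  \<open>q1 \<le> c\<close>. If the path has no vertex left of \<open>(c, t)\<close> in this row,
  the step is the given edge itself, which is what \<open>push\<close> demands. An edge traversed
  the other way is handled on the reversed path.\<close>

lemma push_either:
  assumes good: "good G ps" and split: "ps = al @ (c, t) # (c - 1, t + 1) # be \<or> ps = al @ (c - 1, t + 1) # (c, t) # be"
    and v: "(c, t + 1) \<in> tri n"
    and uniq: "\<And>c'. c' < c \<Longrightarrow> (c', t) \<notin> set ps"
  shows "improves G ps"
proof -
  let ?x = "(c, t)" and ?y = "(c - 1, t + 1)"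
  have xy: "?x \<in> set ps" "?y \<in> set ps" using split by auto
  have m: "shell (c, t + 1) \<le> d" using good_in(3)[OF good xy(1)] good_in(3)[OF good xy(2)] by (auto simp: shell_def)
  have u: "{p, q} = {?x, ?y}" if pq: "p \<in> set ps" "q \<in> set ps" "ladj p q" "up_cross (c - 1) (t + 1) p q" for p q
  proof -
    have *: "{p, q} = {?x, ?y}" if q: "q \<in> set ps" and l: "ladj p q"
      and p: "snd p = t + 1" "fst p \<le> c - 1" "snd q = t" for p q
    proof -
      obtain p1 q1 where pq: "p = (p1, t + 1)" "q = (q1, t)" using p by (metis prod.collapse)
      have "q1 = p1 \<or> q1 = p1 + 1" using l unfolding pq by (elim ladjE) auto
      moreover have "\<not> q1 < c" using uniq[of q1] q pq by auto
      ultimately have "q1 = c" "p1 = c - 1" using p pq by auto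
      then show ?thesis using pq by auto
    qed
    from pq(4) consider "snd p = t + 1" "fst p \<le> c - 1" "snd q = t" | "snd q = t + 1" "fst q \<le> c - 1" "snd p = t"
      by (auto simp: up_cross_def)
    then show ?thesis
    proof cases
      case 1
      then show ?thesis using *[OF pq(2,3)] by simp
    next
      case 2
      have "ladj q p" using pq(3) ladj_sym by simp
      then show ?thesis using *[OF pq(1) _ 2] by (simp add: insert_commute)
    qed
  qed
  from split show ?thesis
  proof
    assume s: "ps = al @ ?x # ?y # be"
    show ?thesis unfolding s
      by (rule push[OF good[unfolded s] refl refl v m]) (use u s in simp)
  next
    assume s: "ps = al @ ?y # ?x # be"
    then have r: "rev ps = rev be @ ?x # ?y # rev al" by simp
    have "stage.improves n H b a G (rev ps)" unfolding r
    proof (rule stage.push[OF stage_swap _ refl refl v m])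
      show "stage.good n H b a G (rev be @ ?x # ?y # rev al)" using good_swap[of G ps] good r by simp
      fix p q
      assume "p \<in> set (rev be @ ?x # ?y # rev al)" "q \<in> set (rev be @ ?x # ?y # rev al)" "ladj p q"
        "up_cross (c - 1) (t + 1) p q"
      then show "{p, q} = {?x, ?y}" using u[of p q] unfolding r[symmetric] set_rev by simp
    qed
    then show ?thesis by (rule improves_swap)
  qed
qed

lemma side_in_stage:
  assumes good: "good G ps" and p: "p \<in> set ps" "p \<in> side n"
  shows "lab n p = lab n a"
  using grove_lab[OF _ a(1) p(2)] good_con[OF good p(1)] good by (simp add: good_def)

text \<open>Take a vertex \<open>x\<close> of least level among those of smaller shell. Its left and
  upper left neighbours would be lower still. So either one of its neighbours on the path forms a
  slash edge with it, which can be pushed because minimality leaves nothing to the left, or the two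
  are \<open>(c + 1, t)\<close> and \<open>(c, t + 1)\<close> and the corner at \<open>x\<close> is
  cut.\<close>

lemma inner_improves:
  assumes good: "good G ps" and ex: "p0 \<in> set ps" "shell p0 < d"
  shows "improves G ps"
proof -
  let ?S = "{p \<in> set ps. shell p < d}"
  have "p0 \<in> ?S" using ex by simp
  then have fin: "finite (level ` ?S)" "level ` ?S \<noteq> {}" by (simp, blast)
  obtain x where x: "x \<in> set ps" "shell x < d" "level x = Min (level ` ?S)" using Min_in[OF fin] by auto
  have mn: "level x \<le> level p" if "p \<in> set ps" "shell p < d" for p
    unfolding x(3) by (rule Min_le[OF fin(1)]) (use that in auto)
  obtain c t where ct: "x = (c, t)" by (cases x)
  have cd: "c < d" "t < d" using x(2) ct by (auto simp: shell_def)
  have xtri: "0 \<le> c" "0 \<le> t" "c + t \<le> int n" using good_in(1)[OF good x(1)] ct by (auto simp: tri_def)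
  \<comment> \<open>A boundary vertex on the path has the label of \<open>a\<close> and hence shell
    \<open>d\<close>, so \<open>x\<close> is off the right side and \<open>(c, t + 1)\<close> is
    still a vertex.\<close>
  have ln: "c + t < int n"
  proof (rule ccontr)
    assume "\<not> c + t < int n"
    then have "x \<in> side n" using xtri ct by (auto simp: side_def tri_def)
    then have "lab n x = lab n a" using side_in_stage[OF good x(1)] by simp
    then have "fst (lab n x) = fst (lab n a)" by simp
    then have "shell x = shell a" by (simp add: lab_def shell_def split_beta)
    then show False using x(2) a(2) by simp
  qed
  have xa: "x \<noteq> a" "x \<noteq> b" using x(2) a(2) b(2) by auto
  obtain as bs where ab: "ps = as @ x # bs" using split_list[OF x(1)] by auto
  have "as \<noteq> []" "bs \<noteq> []" using good ab xa by (auto simp: good_def)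
  then obtain as' p q bs' where pq: "as = as' @ [p]" "bs = q # bs'" by (metis append_butlast_last_id neq_Nil_conv)
  have ps: "ps = as' @ p # x # q # bs'" using ab pq by simp
  have pql: "ladj x p" "ladj x q" "p \<noteq> q" "p \<in> set ps" "q \<in> set ps"
    using good_lat[OF good] good ps ladj_sym[of x p] by (auto simp: successively_append_iff successively_Cons good_def)
  have nb: "u = (c + 1, t) \<or> u = (c, t + 1) \<or> u = (c + 1, t - 1) \<or> u = (c - 1, t + 1)"
    if u: "ladj x u" "u \<in> set ps" for u
  proof -
    have "u \<noteq> (c - 1, t)" "u \<noteq> (c, t - 1)" using mn[OF u(2)] cd ct by (auto simp: shell_def level_def)
    then show ?thesis using u(1) unfolding ct by (elim ladjE) auto
  qed
  have inn: "(c', t') \<notin> set ps" if "c' + t' < c + t" "c' < d" "t' < d" for c' t'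
    using mn[of "(c', t')"] that ct by (auto simp: shell_def level_def)
  have up: "improves G ps" if "ps = al @ (c, t) # (c - 1, t + 1) # be \<or> ps = al @ (c - 1, t + 1) # (c, t) # be" for al be
    by (rule push_either[OF good that]) (use ln xtri cd inn in \<open>auto simp: tri_def\<close>)
  have dn: "improves G ps" if s: "ps = al @ (c + 1, t - 1) # (c, t) # be \<or> ps = al @ (c, t) # (c + 1, t - 1) # be" for al be
  proof -
    have "(c + 1, t - 1) \<in> set ps" using s by auto
    then have "0 \<le> t - 1" using good_in(1)[OF good, of "(c + 1, t - 1)"] by (auto simp: tri_def)
    then show ?thesis using s ln xtri cd inn
      by (intro push_either[OF good, of al "c + 1" "t - 1" be]) (auto simp: tri_def)
  qed
  consider "p = (c - 1, t + 1)" | "q = (c - 1, t + 1)" | "p = (c + 1, t - 1)" | "q = (c + 1, t - 1)"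
    | "p = (c + 1, t)" "q = (c, t + 1)" | "p = (c, t + 1)" "q = (c + 1, t)"
    using nb[OF pql(1,4)] nb[OF pql(2,5)] pql(3) by auto
  then show ?thesis
  proof cases
    case 1
    then show ?thesis using up[of as' "q # bs'"] ps ct by simp
  next
    case 2
    then show ?thesis using up[of "as' @ [p]" bs'] ps ct by simp
  next
    case 3
    then show ?thesis using dn[of as' "q # bs'"] ps ct by simp
  next
    case 4
    then show ?thesis using dn[of "as' @ [p]" bs'] ps ct by simp
  next
    case 5
    then show ?thesis using cut_corner[of G as' p x q bs' c t] good ps ct x(2) by simp
  next
    case 6
    have r: "rev ps = rev bs' @ q # x # p # rev as'" using ps by simp
    have "stage.improves n H b a G (rev ps)" unfolding r
      by (rule stage.cut_corner[OF stage_swap _ ct x(2) 6(2,1)]) (use good_swap[of G ps] good r in simp)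
    then show ?thesis by (rule improves_swap)
  qed
qed

text \<open>Within shell \<open>d\<close> a slash edge can only join \<open>(d, d - 1)\<close> and
  \<open>(d - 1, d)\<close>. If \<open>(d, d)\<close> were no vertex, both would be boundary
  vertices with different labels on one path; so the edge can be pushed to
  \<open>(d, d)\<close>.\<close>

lemma slash_improves:
  assumes good: "good G ps" and fr: "\<And>p. p \<in> set ps \<Longrightarrow> shell p = d"
    and s: "ps = al @ (c, t) # (c - 1, t + 1) # be \<or> ps = al @ (c - 1, t + 1) # (c, t) # be"
  shows "improves G ps"
proof -
  have xy: "(c, t) \<in> set ps" "(c - 1, t + 1) \<in> set ps" using s by auto
  have ct: "c = d" "t + 1 = d" using fr[OF xy(1)] fr[OF xy(2)] by (auto simp: shell_def)
  have tri: "0 \<le> c - 1" "0 \<le> t" "c + t \<le> int n" using good_in(1)[OF good xy(1)] good_in(1)[OF good xy(2)] by (auto simp: tri_def)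
  have "c + t \<noteq> int n"
  proof
    assume n: "c + t = int n"
    then have "lab n (c, t) = lab n (c - 1, t + 1)"
      using side_in_stage[OF good xy(1)] side_in_stage[OF good xy(2)] tri by (auto simp: side_def tri_def)
    then show False using n ct by (auto simp: lab_def split: if_splits)
  qed
  then have v: "(c, t + 1) \<in> tri n" using tri by (auto simp: tri_def)
  show ?thesis
  proof (rule push_either[OF good s v])
    fix c' assume "c' < c"
    then show "(c', t) \<notin> set ps" using fr[of "(c', t)"] ct by (auto simp: shell_def)
  qed
qed

lemma straighten:
  assumes g: "grove n G" and HG: "H \<subseteq> G"
  obtains G' ps where "reach n G G'" "good G' ps" "\<And>p. p \<in> set ps \<Longrightarrow> shell p = d"
    "\<And>as h h' bs. ps = as @ h # h' # bs \<Longrightarrow> ladj h h' \<and> (fst h = fst h' \<or> snd h = snd h')"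
proof -
  have "con G a b" using grove_lab[OF g a(1) b(1)] lab by simp
  then obtain ps0 where "walk G ps0" "distinct ps0" "ps0 \<noteq> []" "hd ps0 = a" "last ps0 = b" by (rule con_imp_walk)
  then have "good G ps0" using g HG by (simp add: good_def)
  then have ex: "\<exists>G' ps. reach n G G' \<and> good G' ps \<and> weight n ps = weight n ps0" by blast
  define m where "m = (LEAST m. \<exists>G' ps. reach n G G' \<and> good G' ps \<and> weight n ps = m)"
  obtain G' ps where G': "reach n G G'" "good G' ps" "weight n ps = m"
    using LeastI[of "\<lambda>m. \<exists>G' ps. reach n G G' \<and> good G' ps \<and> weight n ps = m", OF ex] unfolding m_def by blast
  have ni: "\<not> improves G' ps"
  proof
    assume "improves G' ps"
    then obtain G'' ps' where i: "reach n G' G''" "good G'' ps'" "weight n ps' < weight n ps"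
      unfolding improves_def by blast
    have "reach n G G''" using G'(1) i(1) by (rule rtranclp_trans)
    then have "m \<le> weight n ps'" unfolding m_def using i(2) by (intro Least_le) blast
    then show False using i(3) G'(3) by simp
  qed
  have fr: "shell p = d" if "p \<in> set ps" for p
    using good_in(3)[OF G'(2) that] inner_improves[OF G'(2) that] ni by fastforce
  have "ladj h h' \<and> (fst h = fst h' \<or> snd h = snd h')" if s: "ps = as @ h # h' # bs" for as h h' bs
  proof -
    have l: "ladj h h'" using good_lat[OF G'(2)] s by (auto simp: successively_append_iff)
    obtain c t where h: "h = (c, t)" by (cases h)
    from l[unfolded h] have "fst h = fst h' \<or> snd h = snd h'"
    proof (cases rule: ladjE)
      case 5
      then show ?thesis using slash_improves[OF G'(2) fr, of as "c + 1" "t - 1" bs] s h ni by simp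
    next
      case 6
      then show ?thesis using slash_improves[OF G'(2) fr, of as c t bs] s h ni by simp
    qed (simp_all add: h)
    then show ?thesis using l by simp
  qed
  then show thesis using that[OF G'(1,2) fr] by blast
qed

text \<open>For each column edge, the path starts in the part of the column up to that edge and ends
  off it. A straight step within the shell can leave this part only along the edge.\<close>

lemma col_result:
  assumes good: "good G ps" and fr: "\<And>p. p \<in> set ps \<Longrightarrow> shell p = d"
    and st: "\<And>as h h' bs. ps = as @ h # h' # bs \<Longrightarrow> ladj h h' \<and> (fst h = fst h' \<or> snd h = snd h')"
    and ends: "a = (d, 0)" "b = (d, int n - d) \<or> b = (0, d)"
  shows "target_col n d \<subseteq> G"
proof
  have e: "ps \<noteq> []" "hd ps = a" "last ps = b" using good by (simp_all add: good_def)
  fix e assume "e \<in> target_col n d"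
  then obtain t where t: "e = {(d, t), (d, t + 1)}" "0 \<le> t" "t + 1 \<le> d" "d + t + 1 \<le> int n" by (auto simp: target_col_def)
  have "\<exists>as h h' bs. ps = as @ h # h' # bs \<and> h \<in> {(d, t') |t'. t' \<le> t} \<and> h' \<notin> {(d, t') |t'. t' \<le> t}"
    by (rule crossing_step) (use e ends t in auto)
  then obtain as h h' bs where s: "ps = as @ h # h' # bs" "h \<in> {(d, t') |t'. t' \<le> t}" "h' \<notin> {(d, t') |t'. t' \<le> t}"
    by (elim exE conjE)
  obtain t1 where t1: "h = (d, t1)" "t1 \<le> t" using s(2) by auto
  have m: "shell h' = d" using fr[of h'] s(1) by simp
  have "h' = (d, t + 1) \<and> t1 = t"
    using conjunct1[OF st[OF s(1)]] conjunct2[OF st[OF s(1)]] m s(3) t1(2) t(3) unfolding t1(1)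
    by (elim ladjE) (auto simp: shell_def)
  moreover have "{h, h'} \<in> G" using good s(1) by (auto simp: good_def successively_append_iff)
  ultimately show "e \<in> G" using t(1) t1(1) by simp
qed

lemma row_result:
  assumes good: "good G ps" and fr: "\<And>p. p \<in> set ps \<Longrightarrow> shell p = d"
    and st: "\<And>as h h' bs. ps = as @ h # h' # bs \<Longrightarrow> ladj h h' \<and> (fst h = fst h' \<or> snd h = snd h')"
    and ends: "b = (0, d)" "a = (int n - d, d) \<or> a = (d, 0)"
  shows "target_row n d \<subseteq> G"
proof
  have e: "ps \<noteq> []" "hd ps = a" "last ps = b" using good by (simp_all add: good_def)
  fix e assume "e \<in> target_row n d"
  then obtain c where c: "e = {(c, d), (c + 1, d)}" "0 \<le> c" "c + 1 \<le> d" "c + 1 + d \<le> int n" by (auto simp: target_row_def)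
  \<comment> \<open>The path runs along the row towards \<open>(0, d)\<close>, so the crossing step
    is one that enters the part up to \<open>c\<close>; hence the complement.\<close>
  have "\<exists>as h h' bs. ps = as @ h # h' # bs \<and> h \<in> - {(c', d) |c'. c' \<le> c} \<and> h' \<notin> - {(c', d) |c'. c' \<le> c}"
    by (rule crossing_step) (use e ends c in auto)
  then obtain as h h' bs where s: "ps = as @ h # h' # bs" "h \<notin> {(c', d) |c'. c' \<le> c}" "h' \<in> {(c', d) |c'. c' \<le> c}"
    by auto
  obtain c1 where c1: "h' = (c1, d)" "c1 \<le> c" using s(3) by auto
  have m: "shell h = d" using fr[of h] s(1) by simp
  have l: "ladj h' h" using conjunct1[OF st[OF s(1)]] ladj_sym by simp
  have "h = (c + 1, d) \<and> c1 = c"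
    using l conjunct2[OF st[OF s(1)]] m s(2) c1(2) c(3) unfolding c1(1)
    by (elim ladjE) (auto simp: shell_def)
  moreover have "{h, h'} \<in> G" using good s(1) by (auto simp: good_def successively_append_iff)
  ultimately show "e \<in> G" using c(1) c1(1) by (simp add: insert_commute)
qed

end

section \<open>Filling the shells one by one\<close>

lemma target_beyond_step: "target_beyond n (d - 1) = target_beyond n d \<union> target_col n d \<union> target_row n d"
proof -
  have "{d - 1<..} = insert d {d<..}" by auto
  then show ?thesis by (auto simp: target_beyond_def)
qed

text \<open>For \<open>int n \<le> 2 * d\<close> the column and the row each join two boundary
  vertices and are treated one after the other, the finished column being protected by
  \<open>H\<close>. For smaller \<open>d\<close> a single path runs from \<open>(d, 0)\<close> round
  the corner to \<open>(0, d)\<close>.\<close>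

lemma straighten_shell:
  assumes g: "grove n G" and H: "target_beyond n d \<subseteq> G" and d: "0 \<le> d" "d \<le> int n"
  shows "\<exists>G'. reach n G G' \<and> target_beyond n (d - 1) \<subseteq> G'"
proof (cases "int n \<le> 2 * d")
  case True
  interpret s1: stage n d "target_beyond n d" "(d, 0)" "(d, int n - d)"
  proof
    \<comment> \<open>On the right side, a vertex of shell at most \<open>d\<close> other than
      \<open>(d, int n - d)\<close> has a larger second coordinate than both ends.\<close>
    show "(snd p \<le> snd (d, 0)) = (snd p \<le> snd (d, int n - d))"
      if "p \<in> side n" "p \<noteq> (d, 0)" "p \<noteq> (d, int n - d)" "shell p \<le> d" "fst p + snd p = int n" for p
      using that d by (cases p) (auto simp: shell_def)
  qed (use d True in \<open>auto simp: side_def tri_def shell_def lab_def\<close>)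
  obtain G1 ps where 1: "reach n G G1" "s1.good G1 ps" "\<And>p. p \<in> set ps \<Longrightarrow> shell p = d"
    "\<And>as h h' bs. ps = as @ h # h' # bs \<Longrightarrow> ladj h h' \<and> (fst h = fst h' \<or> snd h = snd h')"
    using s1.straighten[OF g H] by blast
  have c1: "target_col n d \<subseteq> G1" using s1.col_result[OF 1(2-4)] by simp
  have g1: "grove n G1" "target_beyond n d \<subseteq> G1" using 1(2) by (simp_all add: s1.good_def)
  interpret s2: stage n d "target_beyond n d \<union> target_col n d" "(int n - d, d)" "(0, d)"
    by unfold_locales (use d True in \<open>auto simp: side_def tri_def shell_def lab_def\<close>)
  have "target_beyond n d \<union> target_col n d \<subseteq> G1" using c1 g1(2) by simp
  then obtain G2 ps2 where 2: "reach n G1 G2" "s2.good G2 ps2" "\<And>p. p \<in> set ps2 \<Longrightarrow> shell p = d"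
    "\<And>as h h' bs. ps2 = as @ h # h' # bs \<Longrightarrow> ladj h h' \<and> (fst h = fst h' \<or> snd h = snd h')"
    using s2.straighten[OF g1(1)] by blast
  have "target_row n d \<subseteq> G2" using s2.row_result[OF 2(2-4)] by simp
  moreover have "target_beyond n d \<union> target_col n d \<subseteq> G2" using 2(2) by (simp add: s2.good_def)
  moreover have "reach n G G2" using 1(1) 2(1) by (rule rtranclp_trans)
  ultimately show ?thesis unfolding target_beyond_step by (intro exI[of _ G2]) simp
next
  case False
  interpret s1: stage n d "target_beyond n d" "(d, 0)" "(0, d)"
  proof
    \<comment> \<open>Vacuous: \<open>2 * d < int n\<close> leaves no vertex of shell at most
      \<open>d\<close> on the right side.\<close>
    show "(snd p \<le> snd (d, 0)) = (snd p \<le> snd (0, d))"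
      if "p \<in> side n" "p \<noteq> (d, 0)" "p \<noteq> (0, d)" "shell p \<le> d" "fst p + snd p = int n" for p
      using that False by (cases p) (auto simp: shell_def)
  qed (use d False in \<open>auto simp: side_def tri_def shell_def lab_def\<close>)
  obtain G1 ps where 1: "reach n G G1" "s1.good G1 ps" "\<And>p. p \<in> set ps \<Longrightarrow> shell p = d"
    "\<And>as h h' bs. ps = as @ h # h' # bs \<Longrightarrow> ladj h h' \<and> (fst h = fst h' \<or> snd h = snd h')"
    using s1.straighten[OF g H] by blast
  have "target_col n d \<subseteq> G1" "target_row n d \<subseteq> G1" using s1.col_result[OF 1(2-4)] s1.row_result[OF 1(2-4)] by simp_all
  moreover have "target_beyond n d \<subseteq> G1" using 1(2) by (simp add: s1.good_def)
  ultimately show ?thesis unfolding target_beyond_step using 1(1) by (intro exI[of _ G1]) simp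
qed

text \<open>For \<open>d = - 1\<close> every vertex is outer, so the target edges already realise
  all connections of \<open>G\<close>, and a further edge would not be a bridge.\<close>

lemma grove_containing_target:
  assumes g: "grove n G" and T: "target_beyond n (- 1) \<subseteq> G"
  shows "G = target_beyond n (- 1)"
proof (rule ccontr)
  assume "G \<noteq> target_beyond n (- 1)"
  then obtain e where e: "e \<in> G" "e \<notin> target_beyond n (- 1)" using T by blast
  then obtain p q where pq: "e = {p, q}" "p \<in> tri n" "q \<in> tri n" using g unfolding grove_def by metis
  have "p \<in> outer n (- 1)" "q \<in> outer n (- 1)" using pq by (auto simp: outer_def tri_def shell_def)
  moreover have "con G p q" using e(1) pq(1) by (intro con_edge) simp
  ultimately have "con (target_beyond n (- 1)) p q" using outer_con[OF g T] by simp
  then have "con (G - {{p, q}}) p q" by (rule con_mono) (use e pq T in blast)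
  then show False using acycD[OF grove_acyc[OF g]] e(1) pq(1) by simp
qed

theorem reach_target:
  assumes g: "grove n G"
  shows "reach n G (target_beyond n (- 1))"
proof -
  \<comment> \<open>Here \<open>k\<close> counts the finished shells. There are \<open>n + 1\<close>
    of them, so the bound ends at \<open>- 1\<close>.\<close>
  have "\<exists>G'. reach n G G' \<and> target_beyond n (int n - int k) \<subseteq> G'" if "k \<le> n + 1" for k
    using that
  proof (induction k)
    case 0
    have "target_beyond n (int n) = {}" by (auto simp: target_beyond_def target_col_def target_row_def)
    then show ?case by auto
  next
    case (Suc k)
    then obtain G1 where G1: "reach n G G1" "target_beyond n (int n - int k) \<subseteq> G1" by auto
    obtain G2 where G2: "reach n G1 G2" "target_beyond n (int n - int k - 1) \<subseteq> G2"
      using straighten_shell[OF reach_grove[OF G1(1) g] G1(2)] Suc.prems by auto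
    have "reach n G G2" using G1(1) G2(1) by (rule rtranclp_trans)
    then show ?case using G2(2) by (auto simp: algebra_simps)
  qed
  from this[of "n + 1"] obtain G' where G': "reach n G G'" "target_beyond n (- 1) \<subseteq> G'" by auto
  then show ?thesis using grove_containing_target[OF reach_grove[OF G'(1) g] G'(2)] by simp
qed

section \<open>Back to the original coordinates\<close>

definition phi :: "nat \<Rightarrow> point \<Rightarrow> point" where
  "phi n p = (2 * fst p - int n + snd p, - snd p)"

abbreviation phi_edges :: "nat \<Rightarrow> point set set \<Rightarrow> point set set" where
  "phi_edges n G \<equiv> (`) (phi n) ` G"

lemma inj_phi: "inj (phi n)"
  by (rule injI) (auto simp: phi_def prod_eq_iff)

lemma phi_eq: "phi n p = phi n q \<longleftrightarrow> p = q"
  by (rule inj_eq[OF inj_phi])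

lemma phi_pair: "{phi n p, phi n q} \<in> phi_edges n G \<longleftrightarrow> {p, q} \<in> G"
proof -
  have "{phi n p, phi n q} = phi n ` {p, q}" by simp
  then show ?thesis using inj_image_mem_iff[OF inj_on_image[of "phi n" "UNIV :: point set set"], of "{p, q}" G] inj_phi by simp
qed

lemma phi_tri_eq: "phi n ` tri n = grove_vertices n"
proof
  show "phi n ` tri n \<subseteq> grove_vertices n"
    by (auto simp: phi_def tri_def grove_vertices_def) presburger+
  show "grove_vertices n \<subseteq> phi n ` tri n"
  proof
    fix z assume z: "z \<in> grove_vertices n"
    obtain i j where ij: "z = (i, j)" by (cases z)
    have r: "\<bar>i\<bar> + \<bar>j\<bar> \<le> int n" "j \<le> 0" "(i + j) mod 2 = int n mod 2"
      using z ij by (auto simp: grove_vertices_def)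
    define c where "c = (int n + i + j) div 2"
    have c: "2 * c = int n + i + j" unfolding c_def using r(3) by presburger
    have "z = phi n (c, - j)" using c ij by (simp add: phi_def)
    moreover have "(c, - j) \<in> tri n" using c r by (auto simp: tri_def)
    ultimately show "z \<in> phi n ` tri n" by blast
  qed
qed

lemma phi_tri: "phi n p \<in> grove_vertices n \<longleftrightarrow> p \<in> tri n"
  using inj_image_mem_iff[OF inj_phi] phi_tri_eq by metis

lemma phi_ladj: "lattice_adjacent (phi n p) (phi n q) \<longleftrightarrow> ladj p q"
proof -
  define a b where "a = fst q - fst p" and "b = snd q - snd p"
  have ab: "fst (phi n q) - fst (phi n p) = 2 * a + b" "snd (phi n q) - snd (phi n p) = - b"
    by (simp_all add: phi_def a_def b_def)
  show ?thesis
    unfolding lattice_adjacent_def ladj_def ab a_def[symmetric] b_def[symmetric] insert_iff prod.inject empty_iff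
    by presburger
qed

text \<open>Ensures that every edge of the image consists of two image points, which is what pulling
  connections back along \<open>phi\<close> takes.\<close>

definition pairs :: "'a set set \<Rightarrow> bool" where
  "pairs G \<longleftrightarrow> (\<forall>e\<in>G. \<exists>p q. e = {p, q})"

lemma con_phi:
  assumes "pairs G"
  shows "con (phi_edges n G) (phi n p) (phi n q) \<longleftrightarrow> con G p q"
proof
  assume "con G p q"
  then show "con (phi_edges n G) (phi n p) (phi n q)"
  proof (induction rule: rtrancl_induct)
    case (step y z)
    then have "con (phi_edges n G) (phi n y) (phi n z)" by (intro con_edge) (simp add: adjacency_def phi_pair)
    with step.IH show ?case by (rule con_trans)
  qed simp
next
  assume c: "con (phi_edges n G) (phi n p) (phi n q)"
  have "\<exists>r. w = phi n r \<and> con G p r" if "con (phi_edges n G) (phi n p) w" for w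
    using that
  proof (induction rule: rtrancl_induct)
    case base
    show ?case by (rule exI[of _ p]) simp
  next
    case (step y z)
    then obtain r where r: "y = phi n r" "con G p r" by blast
    have "{y, z} \<in> phi_edges n G" using step by (simp add: adjacency_def)
    then obtain e where e: "e \<in> G" "{y, z} = phi n ` e" by auto
    then obtain a b where ab: "e = {a, b}" using assms unfolding pairs_def by blast
    have "{phi n r, z} = {phi n a, phi n b}" using e(2) r(1) ab by simp
    then have "(r = a \<and> z = phi n b) \<or> (r = b \<and> z = phi n a)" unfolding doubleton_eq_iff phi_eq by blast
    then have "\<exists>s. z = phi n s \<and> e = {r, s}" unfolding ab by (metis insert_commute)
    then obtain s where s: "z = phi n s" "{r, s} \<in> G" using e(1) by blast
    have "con G p s" using r(2) con_edge[OF s(2)] by (rule con_trans)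
    then show ?case using s(1) by blast
  qed
  from this[OF c] obtain r where "phi n q = phi n r" "con G p r" by blast
  then show "con G p q" unfolding phi_eq by simp
qed

lemma phi_edges_remove: "phi_edges n (G - {e}) = phi_edges n G - {phi n ` e}"
  using image_set_diff[OF inj_on_image[of "phi n" "UNIV :: point set set"], of G "{e}"] inj_phi by simp

lemma acyc_phi:
  assumes G: "pairs G"
  shows "acyc (phi_edges n G) \<longleftrightarrow> acyc G"
proof -
  have G': "pairs (G - {e})" for e using G by (simp add: pairs_def)
  have key: "(phi n p \<noteq> phi n q \<and> \<not> con (phi_edges n G - {{phi n p, phi n q}}) (phi n p) (phi n q)) \<longleftrightarrow>
      (p \<noteq> q \<and> \<not> con (G - {{p, q}}) p q)" for p q
    using con_phi[OF G'[of "{p, q}"], of n p q] phi_edges_remove[of n G "{p, q}"] by (simp add: phi_eq)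
  show ?thesis
  proof
    assume "acyc (phi_edges n G)"
    then have "p \<noteq> q \<and> \<not> con (G - {{p, q}}) p q" if "{p, q} \<in> G" for p q
      using that key[of p q] phi_pair[of n p q G] unfolding acyc_def by blast
    then show "acyc G" unfolding acyc_def by blast
  next
    assume ac: "acyc G"
    show "acyc (phi_edges n G)" unfolding acyc_def
    proof (intro allI impI)
      fix x y assume "{x, y} \<in> phi_edges n G"
      then obtain e where e: "e \<in> G" "{x, y} = phi n ` e" by auto
      then obtain a b where ab: "e = {a, b}" using G unfolding pairs_def by blast
      have "{x, y} = {phi n a, phi n b}" using e(2) ab by simp
      then have "\<exists>p q. x = phi n p \<and> y = phi n q \<and> {p, q} = {a, b}"
        unfolding doubleton_eq_iff by blast
      then obtain p q where pq: "x = phi n p" "y = phi n q" "{p, q} \<in> G" using e(1) ab by auto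
      have "p \<noteq> q \<and> \<not> con (G - {{p, q}}) p q" using ac pq(3) unfolding acyc_def by blast
      then show "x \<noteq> y \<and> \<not> con (phi_edges n G - {{x, y}}) x y" unfolding pq(1,2) key .
    qed
  qed
qed

lemma set_eq_pairI: "(\<And>c t. (c, t) \<in> A \<longleftrightarrow> (c, t) \<in> B) \<Longrightarrow> A = B"
  by (rule set_eqI) (simp add: split_paired_all)

section \<open>Boundary sets as fibres of the label\<close>

definition side_class :: "nat \<Rightarrow> int \<times> nat \<Rightarrow> point set" where
  "side_class n l = {b \<in> side n. lab n b = l}"

lemma side_class_iff: "(c, t) \<in> side_class n (d, k) \<longleftrightarrow> 0 \<le> c \<and> 0 \<le> t \<and> c + t \<le> int n \<and> (c = 0 \<or> t = 0 \<or> c + t = int n) \<and>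
    (c \<le> t \<and> d = t \<or> t < c \<and> d = c) \<and> k = (if 2 * d \<le> int n then 0 else if t < c then 1 else 2)"
  unfolding side_class_def side_def tri_def lab_def by (cases "c \<le> t") auto

lemma side_class_low:
  assumes "0 \<le> d" "2 * d < int n"
  shows "side_class n (d, 0) = {(d, 0), (0, d)}"
proof -
  have "(c, t) \<in> side_class n (d, 0) \<longleftrightarrow> (c, t) \<in> {(d, 0), (0, d)}" for c t
    unfolding side_class_iff using assms by auto
  then show ?thesis by (rule set_eq_pairI)
qed

lemma side_class_mid:
  assumes "2 * d = int n"
  shows "side_class n (d, 0) = {(d, 0), (0, d), (d, d)}"
proof -
  have "(c, t) \<in> side_class n (d, 0) \<longleftrightarrow> (c, t) \<in> {(d, 0), (0, d), (d, d)}" for c t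
    unfolding side_class_iff using assms by auto
  then show ?thesis by (rule set_eq_pairI)
qed

lemma side_class_east:
  assumes "int n < 2 * d" "d \<le> int n"
  shows "side_class n (d, 1) = {(d, 0), (d, int n - d)}"
proof -
  have "(c, t) \<in> side_class n (d, 1) \<longleftrightarrow> (c, t) \<in> {(d, 0), (d, int n - d)}" for c t
    unfolding side_class_iff using assms by auto
  then show ?thesis by (rule set_eq_pairI)
qed

lemma side_class_south:
  assumes "int n < 2 * d" "d \<le> int n"
  shows "side_class n (d, 2) = {(0, d), (int n - d, d)}"
proof -
  have "(c, t) \<in> side_class n (d, 2) \<longleftrightarrow> (c, t) \<in> {(0, d), (int n - d, d)}" for c t
    unfolding side_class_iff using assms by auto
  then show ?thesis by (rule set_eq_pairI)
qed

lemma lab_sideI: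
  "0 \<le> d \<Longrightarrow> 2 * d \<le> int n \<Longrightarrow> (d, 0) \<in> lab n ` side n"
  "int n < 2 * d \<Longrightarrow> d \<le> int n \<Longrightarrow> (d, 1) \<in> lab n ` side n"
  "int n < 2 * d \<Longrightarrow> d \<le> int n \<Longrightarrow> (d, 2) \<in> lab n ` side n"
  by (rule image_eqI[of _ _ "(d, 0)"], (simp add: lab_def), (simp add: side_def tri_def),
      rule image_eqI[of _ _ "(d, 0)"], (simp add: lab_def), (simp add: side_def tri_def),
      rule image_eqI[of _ _ "(0, d)"], (simp add: lab_def), (simp add: side_def tri_def))

lemma lab_sideE:
  assumes "l \<in> lab n ` side n"
  obtains d where "l = (d, 0)" "0 \<le> d" "2 * d < int n" | d where "l = (d, 0)" "2 * d = int n"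
    | d where "l = (d, 1)" "int n < 2 * d" "d \<le> int n" | d where "l = (d, 2)" "int n < 2 * d" "d \<le> int n"
proof -
  obtain b where b: "b \<in> side n" "l = lab n b" using assms by blast
  obtain c t where ct: "b = (c, t)" by (cases b)
  have r: "0 \<le> c" "0 \<le> t" "c + t \<le> int n" using b(1) ct by (auto simp: side_def tri_def)
  define d where "d = max c t"
  have d: "0 \<le> d" "d \<le> int n" using r by (auto simp: d_def)
  have l: "l = (d, if 2 * d \<le> int n then 0 else if t < c then 1 else 2)" using b(2) ct by (simp add: lab_def d_def)
  consider "2 * d < int n" | "2 * d = int n" | "int n < 2 * d" "t < c" | "int n < 2 * d" "\<not> t < c" by linarith
  then show thesis using l d that by cases auto
qed

text \<open>The dictionary: \<open>2 * d < int n\<close> gives the west pair with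
  \<open>i = int n - 2 * d\<close>, \<open>2 * d = int n\<close> the middle triplet, and a larger
  \<open>d\<close> the east pair with \<open>i = 2 * d - int n\<close> (second label entry 1) and
  the south pair with \<open>i = d\<close> (entry 2). The corners are the degenerate cases
  \<open>d = 0\<close> and \<open>d = int n\<close>.\<close>

lemma boundary_sets_eq:
  assumes n: "n \<ge> 1"
  shows "boundary_sets n = (\<lambda>l. phi n ` side_class n l) ` lab n ` side n"
proof
  let ?R = "(\<lambda>l. phi n ` side_class n l) ` lab n ` side n"
  have in_low: "phi n ` {(d, 0), (0, d)} \<in> ?R" if "0 \<le> d" "2 * d < int n" for d
    using imageI[OF lab_sideI(1)[of d n], of "\<lambda>l. phi n ` side_class n l"] that side_class_low[OF that] by simp
  have in_mid: "phi n ` {(d, 0), (0, d), (d, d)} \<in> ?R" if "2 * d = int n" for d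
    using imageI[OF lab_sideI(1)[of d n], of "\<lambda>l. phi n ` side_class n l"] that side_class_mid[OF that] by simp
  have in_east: "phi n ` {(d, 0), (d, int n - d)} \<in> ?R" if "int n < 2 * d" "d \<le> int n" for d
    using imageI[OF lab_sideI(2)[OF that], of "\<lambda>l. phi n ` side_class n l"] side_class_east[OF that] by simp
  have in_south: "phi n ` {(0, d), (int n - d, d)} \<in> ?R" if "int n < 2 * d" "d \<le> int n" for d
    using imageI[OF lab_sideI(3)[OF that], of "\<lambda>l. phi n ` side_class n l"] side_class_south[OF that] by simp
  show "boundary_sets n \<subseteq> (\<lambda>l. phi n ` side_class n l) ` lab n ` side n"
  proof
    fix S assume "S \<in> boundary_sets n"
    then consider "S \<in> corner_singletons n" | "S \<in> west_pairs n" | "S \<in> east_pairs n"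
      | "S \<in> south_pairs n" | "S \<in> middle_triplets n" unfolding boundary_sets_def by blast
    then show "S \<in> ?R"
    proof cases
      case 1
      then consider "S = {(- int n, 0)}" | "S = {(int n, 0)}" | "S = {(0, - int n)}"
        unfolding corner_singletons_def by blast
      then show ?thesis
      proof cases
        case 1
        then show ?thesis using in_low[of 0] n by (simp add: phi_def)
      next
        case 2
        then show ?thesis using in_east[of "int n"] n by (simp add: phi_def)
      next
        case 3
        then show ?thesis using in_south[of "int n"] n by (simp add: phi_def)
      qed
    next
      case 2
      then obtain i where 4: "S = {(- i, 0), ((- int n - i) div 2, (- int n + i) div 2)}" "0 < i" "i < int n"
        "i mod 2 = int n mod 2" unfolding west_pairs_def by blast
      define d where "d = (int n - i) div 2"
      have d: "2 * d = int n - i" unfolding d_def using 4(4) by presburger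
      have "(- int n - i) div 2 = d - int n" "(- int n + i) div 2 = - d" using d by presburger+
      then have "S = phi n ` {(d, 0), (0, d)}" using 4 d by (simp add: phi_def)
      then show ?thesis using in_low[of d] d 4 by simp
    next
      case 3
      then obtain i where 5: "S = {(i, 0), ((int n + i) div 2, (- int n + i) div 2)}" "0 < i" "i < int n"
        "i mod 2 = int n mod 2" unfolding east_pairs_def by blast
      define d where "d = (int n + i) div 2"
      have d: "2 * d = int n + i" unfolding d_def using 5(4) by presburger
      have "(int n + i) div 2 = d" "(- int n + i) div 2 = d - int n" using d by presburger+
      moreover have "phi n (d, 0) = (i, 0)" "phi n (d, int n - d) = (d, d - int n)" using d by (simp_all add: phi_def)
      ultimately have "S = phi n ` {(d, 0), (d, int n - d)}" using 5(1) by simp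
      then show ?thesis using in_east[of d] d 5 by simp
    next
      case 4
      then obtain i where 6: "S = {(- int n + i, - i), (int n - i, - i)}" "int n < 2 * i" "i < int n"
        unfolding south_pairs_def by blast
      then have "S = phi n ` {(0, i), (int n - i, i)}" by (simp add: phi_def)
      then show ?thesis using in_south[of i] 6 by simp
    next
      case 5
      then have 7: "S = {(0, 0), (- (int n div 2), - (int n div 2)), (int n div 2, - (int n div 2))}" "even n"
        unfolding middle_triplets_def by (auto split: if_splits)
      define d where "d = int n div 2"
      have d: "2 * d = int n" unfolding d_def using 7(2) by presburger
      then have "S = phi n ` {(d, 0), (0, d), (d, d)}" using 7 d_def by (auto simp: phi_def)
      then show ?thesis using in_mid[OF d] by simp
    qed
  qed
  show "(\<lambda>l. phi n ` side_class n l) ` lab n ` side n \<subseteq> boundary_sets n"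
  proof
    fix S assume "S \<in> (\<lambda>l. phi n ` side_class n l) ` lab n ` side n"
    then obtain l where l: "l \<in> lab n ` side n" "S = phi n ` side_class n l" by blast
    from l(1) show "S \<in> boundary_sets n"
    proof (cases rule: lab_sideE)
      case (1 d)
      have S: "S = {(2 * d - int n, 0), (d - int n, - d)}" using l 1 by (simp add: side_class_low phi_def)
      show ?thesis
      proof (cases "d = 0")
        case True
        then show ?thesis using S by (simp add: boundary_sets_def corner_singletons_def)
      next
        case False
        have "(- int n - (int n - 2 * d)) div 2 = d - int n" "(- int n + (int n - 2 * d)) div 2 = - d" by presburger+
        then have "S \<in> west_pairs n" unfolding west_pairs_def mem_Collect_eq using S False 1
          by (intro exI[of _ "int n - 2 * d"]) (simp, presburger)
        then show ?thesis by (simp add: boundary_sets_def)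
      qed
    next
      case (2 d)
      have S: "S = {(0, 0), (- d, - d), (d, - d)}" using l 2 by (auto simp: side_class_mid phi_def)
      have "even n" "int n div 2 = d" using 2 by presburger+
      then show ?thesis using S by (simp add: boundary_sets_def middle_triplets_def)
    next
      case (3 d)
      have S: "S = {(2 * d - int n, 0), (d, d - int n)}" using l 3 by (simp add: side_class_east[simplified] phi_def)
      show ?thesis
      proof (cases "d = int n")
        case True
        then show ?thesis using S by (simp add: boundary_sets_def corner_singletons_def)
      next
        case False
        have "(int n + (2 * d - int n)) div 2 = d" "(- int n + (2 * d - int n)) div 2 = d - int n" by presburger+
        then have "S \<in> east_pairs n" unfolding east_pairs_def mem_Collect_eq using S False 3
          by (intro exI[of _ "2 * d - int n"]) (simp, presburger)
        then show ?thesis by (simp add: boundary_sets_def)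
      qed
    next
      case (4 d)
      have S: "S = {(- int n + d, - d), (int n - d, - d)}" using l 4 by (simp add: side_class_south phi_def)
      show ?thesis
      proof (cases "d = int n")
        case True
        then show ?thesis using S by (simp add: boundary_sets_def corner_singletons_def)
      next
        case False
        then have "S \<in> south_pairs n" unfolding south_pairs_def using S 4 by auto
        then show ?thesis by (simp add: boundary_sets_def)
      qed
    qed
  qed
qed

lemma ex1_unique:
  assumes "\<exists>!x. P x" "P a" "P b"
  shows "a = b"
proof -
  obtain x where "\<forall>y. P y \<longrightarrow> y = x" using assms(1) by (rule ex1E)
  then have "a = x" "b = x" using assms(2,3) by blast+
  then show ?thesis by simp
qed

lemma components_phi:
  assumes "pairs G"
  shows "components (grove_vertices n) (phi_edges n G) = (\<lambda>p. phi n ` {q \<in> tri n. con G p q}) ` tri n"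
proof -
  have "{w \<in> grove_vertices n. con (phi_edges n G) (phi n p) w} = phi n ` {q \<in> tri n. con G p q}" for p
  proof (rule set_eqI)
    fix w
    show "w \<in> {w \<in> grove_vertices n. con (phi_edges n G) (phi n p) w} \<longleftrightarrow> w \<in> phi n ` {q \<in> tri n. con G p q}"
    proof
      assume "w \<in> {w \<in> grove_vertices n. con (phi_edges n G) (phi n p) w}"
      then obtain q where "q \<in> tri n" "w = phi n q" "con (phi_edges n G) (phi n p) w" unfolding phi_tri_eq[symmetric] by blast
      then show "w \<in> phi n ` {q \<in> tri n. con G p q}" using con_phi[OF assms, of n p q] by simp
    next
      assume "w \<in> phi n ` {q \<in> tri n. con G p q}"
      then obtain q where "q \<in> tri n" "w = phi n q" "con G p q" by blast
      then show "w \<in> {w \<in> grove_vertices n. con (phi_edges n G) (phi n p) w}"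
        using con_phi[OF assms, of n p q] phi_tri[of n q] by simp
    qed
  qed
  then have "(\<exists>v\<in>phi n ` tri n. C = {w \<in> grove_vertices n. con (phi_edges n G) v w}) \<longleftrightarrow>
      (\<exists>p\<in>tri n. C = phi n ` {q \<in> tri n. con G p q})" for C by simp
  then show ?thesis unfolding components_def phi_tri_eq[symmetric] image_def[of _ "tri n"] by blast
qed

lemma simplified_grove_phi:
  assumes n: "n \<ge> 1" and G: "pairs G"
  shows "simplified_grove n (phi_edges n G) \<longleftrightarrow> grove n G"
proof -
  let ?P = "\<forall>e\<in>G. \<exists>p\<in>tri n. \<exists>q\<in>tri n. e = {p, q} \<and> ladj p q"
  have edges: "phi_edges n G \<subseteq> lattice_edges n \<longleftrightarrow> ?P"
  proof
    assume sub: "phi_edges n G \<subseteq> lattice_edges n"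
    show ?P
    proof
      fix e assume e: "e \<in> G"
      obtain p q where pq: "e = {p, q}" using G e unfolding pairs_def by blast
      have "{phi n p, phi n q} \<in> lattice_edges n" using sub e pq by auto
      then obtain x y where xy: "{phi n p, phi n q} = {x, y}" "x \<in> grove_vertices n" "y \<in> grove_vertices n" "lattice_adjacent x y"
        by (auto simp: lattice_edges_def)
      then have "p \<in> tri n \<and> q \<in> tri n \<and> ladj p q"
        using phi_tri[of n p] phi_tri[of n q] phi_ladj[of n p q] phi_ladj[of n q p] ladj_sym[of p q]
        by (auto simp: doubleton_eq_iff)
      then show "\<exists>p\<in>tri n. \<exists>q\<in>tri n. e = {p, q} \<and> ladj p q" using pq by blast
    qed
  next
    assume P: ?P
    show "phi_edges n G \<subseteq> lattice_edges n"
    proof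
      fix e' assume "e' \<in> phi_edges n G"
      then obtain e where e: "e \<in> G" "e' = phi n ` e" by blast
      then obtain p q where pq: "p \<in> tri n" "q \<in> tri n" "e = {p, q}" "ladj p q" using P by blast
      then have "e' = {phi n p, phi n q}" using e by simp
      then show "e' \<in> lattice_edges n" unfolding lattice_edges_def using pq phi_tri phi_ladj by blast
    qed
  qed
  have cyc: "(\<nexists>vs. is_cycle (phi_edges n G) vs) \<longleftrightarrow> acyc G" if P: ?P
  proof -
    have "x \<noteq> y" if "{x, y} \<in> phi_edges n G" for x y
    proof -
      have "{x, y} \<in> lattice_edges n" using edges P that by blast
      then show ?thesis by (auto simp: lattice_edges_def lattice_adjacent_def doubleton_eq_iff)
    qed
    then show ?thesis using no_cycle_iff_acyc[of "phi_edges n G"] acyc_phi[OF G] by simp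
  qed
  have clsD: "side_class n l = side_class n l' \<longleftrightarrow> l = l'" if "l \<in> lab n ` side n" for l l'
    using that by (auto simp: side_class_def)
  have sub: "phi n ` side_class n l \<subseteq> phi n ` {q \<in> tri n. con G p q} \<longleftrightarrow> (\<forall>b\<in>side n. lab n b = l \<longrightarrow> con G p b)" for l p
    unfolding inj_image_subset_iff[OF inj_phi] using side_tri by (auto simp: side_class_def)
  let ?Q = "\<lambda>p l. \<forall>b\<in>side n. lab n b = l \<longrightarrow> con G p b"
  have A: "(\<forall>C\<in>components (grove_vertices n) (phi_edges n G). \<exists>!S. S \<in> boundary_sets n \<and> S \<subseteq> C) \<longleftrightarrow>
      (\<forall>p\<in>tri n. \<exists>!l. l \<in> lab n ` side n \<and> ?Q p l)"
  proof -
    have "(\<exists>!S. S \<in> boundary_sets n \<and> S \<subseteq> phi n ` {q \<in> tri n. con G p q}) \<longleftrightarrow> (\<exists>!l. l \<in> lab n ` side n \<and> ?Q p l)" for p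
    proof
      assume "\<exists>!S. S \<in> boundary_sets n \<and> S \<subseteq> phi n ` {q \<in> tri n. con G p q}"
      then obtain S where S': "S \<in> boundary_sets n \<and> S \<subseteq> phi n ` {q \<in> tri n. con G p q}"
        "\<forall>S'. S' \<in> boundary_sets n \<and> S' \<subseteq> phi n ` {q \<in> tri n. con G p q} \<longrightarrow> S' = S" by (rule ex1E)
      note S = conjunct1[OF S'(1)] conjunct2[OF S'(1)] S'(2)[rule_format, OF conjI]
      obtain l where l: "l \<in> lab n ` side n" "S = phi n ` side_class n l" using S(1) unfolding boundary_sets_eq[OF n] by blast
      show "\<exists>!l. l \<in> lab n ` side n \<and> ?Q p l"
      proof (rule ex1I[of _ l])
        show "l \<in> lab n ` side n \<and> ?Q p l" using l S(2) sub[of l p] by simp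
        fix l' assume l': "l' \<in> lab n ` side n \<and> ?Q p l'"
        then have "phi n ` side_class n l' \<in> boundary_sets n" unfolding boundary_sets_eq[OF n] by blast
        moreover have "phi n ` side_class n l' \<subseteq> phi n ` {q \<in> tri n. con G p q}" using sub[of l' p] l' by blast
        ultimately have "phi n ` side_class n l' = phi n ` side_class n l" unfolding l(2)[symmetric] by (rule S(3))
        then have "side_class n l' = side_class n l" unfolding inj_image_eq_iff[OF inj_phi] .
        then show "l' = l" using clsD[of l' l] l' by blast
      qed
    next
      assume "\<exists>!l. l \<in> lab n ` side n \<and> ?Q p l"
      then obtain l where l': "l \<in> lab n ` side n \<and> ?Q p l"
        "\<forall>l'. l' \<in> lab n ` side n \<and> ?Q p l' \<longrightarrow> l' = l" by (rule ex1E)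
      note l = conjunct1[OF l'(1)] conjunct2[OF l'(1)] l'(2)[THEN spec, THEN mp, OF conjI]
      show "\<exists>!S. S \<in> boundary_sets n \<and> S \<subseteq> phi n ` {q \<in> tri n. con G p q}"
      proof (rule ex1I[of _ "phi n ` side_class n l"])
        show "phi n ` side_class n l \<in> boundary_sets n \<and> phi n ` side_class n l \<subseteq> phi n ` {q \<in> tri n. con G p q}"
          using l(1,2) sub[of l p] unfolding boundary_sets_eq[OF n] by blast
        fix S assume S: "S \<in> boundary_sets n \<and> S \<subseteq> phi n ` {q \<in> tri n. con G p q}"
        then obtain l' where l': "l' \<in> lab n ` side n" "S = phi n ` side_class n l'" unfolding boundary_sets_eq[OF n] by blast
        moreover have "?Q p l'" using sub[of l' p] S l'(2) by blast
        ultimately have "l' = l" using l(3) by blast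
        then show "S = phi n ` side_class n l" using l'(2) by simp
      qed
    qed
    then show ?thesis unfolding components_phi[OF G] by simp
  qed
  have B: "(\<forall>S\<in>boundary_sets n. \<exists>C\<in>components (grove_vertices n) (phi_edges n G). S \<subseteq> C) \<longleftrightarrow>
      (\<forall>l\<in>lab n ` side n. \<exists>p\<in>tri n. ?Q p l)"
    unfolding boundary_sets_eq[OF n] components_phi[OF G] by (simp add: sub)
  \<comment> \<open>With boundary sets replaced by labels, this is a fact about the equivalence
    relation \<open>con G\<close>: every class contains exactly one fibre of the label and every
    fibre lies in a class, iff every class meets the boundary and on the boundary the relation is
    equality of labels.\<close>
  have C: "(\<forall>p\<in>tri n. \<exists>!l. l \<in> lab n ` side n \<and> ?Q p l) \<and> (\<forall>l\<in>lab n ` side n. \<exists>p\<in>tri n. ?Q p l) \<longleftrightarrow>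
      (\<forall>p\<in>tri n. \<exists>b\<in>side n. con G p b) \<and>
      (\<forall>b\<in>side n. \<forall>b'\<in>side n. con G b b' \<longleftrightarrow> lab n b = lab n b')" (is "?L \<longleftrightarrow> ?R")
  proof
    assume L: ?L
    have same: "con G b b'" if bb: "b \<in> side n" "b' \<in> side n" "lab n b = lab n b'" for b b'
    proof -
      obtain p where p: "?Q p (lab n b)" using bspec[OF conjunct2[OF L] imageI[OF bb(1)]] by blast
      have c: "con G p b" "con G p b'" using p bb by simp_all
      show ?thesis using con_sym[OF c(1)] c(2) by (rule con_trans)
    qed
    have Q: "?Q p (lab n b)" if "b \<in> side n" "con G p b" for p b
    proof (intro ballI impI)
      fix b' assume "b' \<in> side n" "lab n b' = lab n b"
      then have "con G b b'" using same that(1) by simp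
      with that(2) show "con G p b'" by (rule con_trans)
    qed
    show ?R
    proof (intro conjI ballI)
      fix p assume "p \<in> tri n"
      from bspec[OF conjunct1[OF L] this] obtain l where l: "l \<in> lab n ` side n" "?Q p l"
        by (elim ex1E conjE)
      then obtain b where "b \<in> side n" "l = lab n b" by blast
      then show "\<exists>b\<in>side n. con G p b" using l(2) by blast
    next
      fix b b' assume b: "b \<in> side n" "b' \<in> side n"
      show "con G b b' \<longleftrightarrow> lab n b = lab n b'"
      proof
        assume c: "con G b b'"
        have "b \<in> tri n" using b(1) side_tri by blast
        then have ex: "\<exists>!l. l \<in> lab n ` side n \<and> ?Q b l" by (rule bspec[OF conjunct1[OF L]])
        have "lab n b \<in> lab n ` side n \<and> ?Q b (lab n b)" using Q[OF b(1), of b] b(1) by simp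
        moreover have "lab n b' \<in> lab n ` side n \<and> ?Q b (lab n b')" using Q[OF b(2) c] b(2) by simp
        ultimately show "lab n b = lab n b'" by (rule ex1_unique[OF ex])
      qed (rule same[OF b])
    qed
  next
    assume R: ?R
    have Q: "?Q p (lab n b)" if "b \<in> side n" "con G p b" for p b
    proof (intro ballI impI)
      fix b' assume "b' \<in> side n" "lab n b' = lab n b"
      then have "con G b b'" using R that(1) by simp
      with that(2) show "con G p b'" by (rule con_trans)
    qed
    show ?L
    proof (intro conjI ballI)
      fix p assume "p \<in> tri n"
      then obtain b where b: "b \<in> side n" "con G p b" using R by blast
      show "\<exists>!l. l \<in> lab n ` side n \<and> ?Q p l"
      proof (rule ex1I[of _ "lab n b"])
        show "lab n b \<in> lab n ` side n \<and> ?Q p (lab n b)" using Q[OF b] imageI[OF b(1)] by (rule conjI[rotated])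
        fix l assume l: "l \<in> lab n ` side n \<and> ?Q p l"
        then obtain b' where b': "b' \<in> side n" "l = lab n b'" by blast
        then have "con G p b'" using l by simp
        with con_sym[OF b(2)] have "con G b b'" by (rule con_trans)
        then show "l = lab n b" using R b(1) b' by simp
      qed
    next
      fix l assume "l \<in> lab n ` side n"
      then obtain b where b: "b \<in> side n" "l = lab n b" by blast
      then have "?Q b l" using Q[of b b] by simp
      then show "\<exists>p\<in>tri n. ?Q p l" using b(1) side_tri by blast
    qed
  qed
  show ?thesis
  proof (cases ?P)
    case True
    then show ?thesis unfolding simplified_grove_def grove_def A B C edges using cyc[OF True] by simp
  next
    case False
    then show ?thesis unfolding simplified_grove_def grove_def edges by argo
  qed
qed

section \<open>The target grove and the spins in the original picture\<close>

lemma grove_pairs: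
  assumes "grove n G"
  shows "pairs G"
  unfolding pairs_def
proof
  fix e assume "e \<in> G"
  then have "\<exists>p\<in>tri n. \<exists>q\<in>tri n. e = {p, q} \<and> ladj p q"
    by (rule bspec[OF conjunct1[OF assms[unfolded grove_def]]])
  then show "\<exists>p q. e = {p, q}" by blast
qed

lemma phi_col: "phi n ` {(d, t), (d, t + 1)} = {(2 * d - int n + t, - t), (2 * d - int n + t + 1, - t - 1)}"
proof -
  have "phi n (d, t) = (2 * d - int n + t, - t)" "phi n (d, t + 1) = (2 * d - int n + t + 1, - t - 1)"
    by (simp_all add: phi_def)
  then show ?thesis by simp
qed

lemma phi_row: "phi n ` {(c, d), (c + 1, d)} = {(2 * c - int n + d, - d), (2 * c - int n + d + 2, - d)}"
proof -
  have "phi n (c, d) = (2 * c - int n + d, - d)" "phi n (c + 1, d) = (2 * c - int n + d + 2, - d)"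
    by (simp_all add: phi_def)
  then show ?thesis by simp
qed

text \<open>Shell \<open>d\<close> has the parameter \<open>i = int n - 2 * d\<close> if
  \<open>2 * d \<le> int n\<close>; otherwise \<open>i = 2 * d - int n\<close> for its column and
  \<open>i = d\<close> for its row. In the first case the row is listed leftwards from its corner,
  so the edge starting at \<open>c\<close> has \<open>s = d - c - 1\<close>.\<close>

lemma target_phi: "phi_edges n (target_beyond n (- 1)) = target_grove n"
proof
  show "phi_edges n (target_beyond n (- 1)) \<subseteq> target_grove n"
  proof
    fix e assume "e \<in> phi_edges n (target_beyond n (- 1))"
    then consider d t where "e = phi n ` {(d, t), (d, t + 1)}" "0 \<le> t" "t + 1 \<le> d" "d + t + 1 \<le> int n"
      | d c where "e = phi n ` {(c, d), (c + 1, d)}" "0 \<le> c" "c + 1 \<le> d" "c + 1 + d \<le> int n"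
      by (auto simp: target_beyond_def target_col_def target_row_def)
    then show "e \<in> target_grove n"
    proof cases
      case (1 d t)
      then have e: "e = {(2 * d - int n + t, - t), (2 * d - int n + t + 1, - t - 1)}" 
        using phi_col[of n d t] by simp
      show ?thesis
      proof (cases "2 * d \<le> int n")
        case True
        have "(int n - (int n - 2 * d)) div 2 = d" by simp
        then have "\<exists>i t. e = {(- i + t, - t), (- i + t + 1, - t - 1)} \<and> 0 \<le> i \<and> i < int n \<and> i mod 2 = int n mod 2 \<and>
            0 \<le> t \<and> t < (int n - i) div 2"
          using 1 True e by (intro exI[of _ "int n - 2 * d"] exI[of _ t]) (simp, presburger)
        then show ?thesis unfolding target_grove_def by blast
      next
        case False
        have "(int n - (2 * d - int n)) div 2 = int n - d" by presburger
        then have "\<exists>i t. e = {(i + t, - t), (i + t + 1, - t - 1)} \<and> 0 < i \<and> i < int n \<and> i mod 2 = int n mod 2 \<and>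
            0 \<le> t \<and> t < (int n - i) div 2"
          using 1 False e by (intro exI[of _ "2 * d - int n"] exI[of _ t]) (simp, presburger)
        then show ?thesis unfolding target_grove_def by blast
      qed
    next
      case (2 d c)
      then have e: "e = {(2 * c - int n + d, - d), (2 * c - int n + d + 2, - d)}" 
        using phi_row[of n c d] by simp
      show ?thesis
      proof (cases "2 * d \<le> int n")
        case True
        have q: "- (int n - 2 * d) + d - 2 * (d - c - 1) = 2 * c - int n + d + 2" by simp
        have ee: "e = {(- (int n - 2 * d) + d - 2 * (d - c - 1), - d), (- (int n - 2 * d) + d - 2 * (d - c - 1) - 2, - d)}"
          unfolding e q by (simp add: insert_commute)
        have "(int n - 2 * d) mod 2 = int n mod 2" by presburger
        moreover have "0 \<le> int n - 2 * d" "int n - 2 * d < int n" "d = (int n - (int n - 2 * d)) div 2"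
          "0 \<le> d - c - 1" "d - c - 1 < d" using 2 True by simp_all
        ultimately have "\<exists>i d s. e = {(- i + d - 2 * s, - d), (- i + d - 2 * s - 2, - d)} \<and>
            0 \<le> i \<and> i < int n \<and> i mod 2 = int n mod 2 \<and> d = (int n - i) div 2 \<and> 0 \<le> s \<and> s < d"
          using ee by blast
        then show ?thesis unfolding target_grove_def by blast
      next
        case False
        then have "\<exists>i s. e = {(- int n + i + 2 * s, - i), (- int n + i + 2 * s + 2, - i)} \<and>
            int n < 2 * i \<and> i < int n \<and> 0 \<le> s \<and> s < int n - i"
          using 2 e by (intro exI[of _ d] exI[of _ c]) (simp add: algebra_simps)
        then show ?thesis unfolding target_grove_def by blast
      qed
    qed
  qed
  have col: "{(2 * d - int n + t, - t), (2 * d - int n + t + 1, - t - 1)} \<in> phi_edges n (target_beyond n (- 1))"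
    if "0 \<le> t" "t + 1 \<le> d" "d + t + 1 \<le> int n" for d t
  proof -
    have "{(d, t), (d, t + 1)} \<in> target_beyond n (- 1)" using that by (auto simp: target_beyond_def target_col_def)
    then have "phi n ` {(d, t), (d, t + 1)} \<in> phi_edges n (target_beyond n (- 1))" by (rule imageI)
    then show ?thesis unfolding phi_col .
  qed
  have row: "{(2 * c - int n + d, - d), (2 * c - int n + d + 2, - d)} \<in> phi_edges n (target_beyond n (- 1))"
    if "0 \<le> c" "c + 1 \<le> d" "c + 1 + d \<le> int n" for c d
  proof -
    have "{(c, d), (c + 1, d)} \<in> target_beyond n (- 1)" using that by (auto simp: target_beyond_def target_row_def)
    then have "phi n ` {(c, d), (c + 1, d)} \<in> phi_edges n (target_beyond n (- 1))" by (rule imageI)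
    then show ?thesis unfolding phi_row .
  qed
  show "target_grove n \<subseteq> phi_edges n (target_beyond n (- 1))"
  proof
    fix e assume "e \<in> target_grove n"
    then show "e \<in> phi_edges n (target_beyond n (- 1))"
      unfolding target_grove_def Un_iff mem_Collect_eq
    proof (elim disjE exE conjE)
      fix i t assume 1: "e = {(- i + t, - t), (- i + t + 1, - t - 1)}" "0 \<le> i" "i < int n"
        "i mod 2 = int n mod 2" "0 \<le> t" "t < (int n - i) div 2"
      define d where "d = (int n - i) div 2"
      have d: "2 * d = int n - i" unfolding d_def using 1(4) by presburger
      then have i: "- i = 2 * d - int n" by simp
      show ?thesis unfolding 1(1) i by (rule col) (use 1 d d_def in simp_all)
    next
      fix i d s assume 2: "e = {(- i + d - 2 * s, - d), (- i + d - 2 * s - 2, - d)}" "0 \<le> i" "i < int n"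
        "i mod 2 = int n mod 2" "d = (int n - i) div 2" "0 \<le> s" "s < d"
      have d: "2 * d = int n - i" using 2(4,5) by presburger
      then have "- i + d - 2 * s = 2 * (d - s - 1) - int n + d + 2" "- i + d - 2 * s - 2 = 2 * (d - s - 1) - int n + d"
        by simp_all
      then have e: "e = {(2 * (d - s - 1) - int n + d, - d), (2 * (d - s - 1) - int n + d + 2, - d)}"
        unfolding 2(1) by (simp only: insert_commute)
      show ?thesis unfolding e by (rule row) (use 2(2,3,6,7) d in linarith)+
    next
      fix i t assume 3: "e = {(i + t, - t), (i + t + 1, - t - 1)}" "0 < i" "i < int n"
        "i mod 2 = int n mod 2" "0 \<le> t" "t < (int n - i) div 2"
      define d where "d = (int n + i) div 2"
      have d: "2 * d = int n + i" unfolding d_def using 3(4) by presburger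
      then have i: "i = 2 * d - int n" by simp
      have "int n - i = 2 * (int n - d)" using d by simp
      then have nd: "(int n - i) div 2 = int n - d" by simp
      have e: "e = {(2 * d - int n + t, - t), (2 * d - int n + t + 1, - t - 1)}" 
        unfolding 3(1) i ..
      show ?thesis unfolding e by (rule col) (use 3(2,3,5) 3(6)[unfolded nd] d in linarith)+
    next
      fix i s assume 4: "e = {(- int n + i + 2 * s, - i), (- int n + i + 2 * s + 2, - i)}"
        "int n < 2 * i" "i < int n" "0 \<le> s" "s < int n - i"
      have i: "- int n + i + 2 * s = 2 * s - int n + i" by simp
      show ?thesis unfolding 4(1) i by (rule row) (use 4 in simp_all)
    qed
  qed
qed

lemma clockwise_next_phi:
  assumes "ladj p u"
  shows "clockwise_next (phi n p) (phi n u) (phi n (cw_next p u))"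
proof -
  obtain c t where p: "p = (c, t)" by (cases p)
  from assms[unfolded p] show ?thesis
  proof (cases rule: ladjE)
    case 1
    then show ?thesis unfolding clockwise_next_def
      by (intro exI[of _ 2]) (simp add: p clockwise_neighbours_def phi_def)
  next
    case 2
    then show ?thesis unfolding clockwise_next_def
      by (intro exI[of _ 5]) (simp add: p clockwise_neighbours_def phi_def)
  next
    case 3
    then show ?thesis unfolding clockwise_next_def
      by (intro exI[of _ 3]) (simp add: p clockwise_neighbours_def phi_def)
  next
    case 4
    then show ?thesis unfolding clockwise_next_def
      by (intro exI[of _ 0]) (simp add: p clockwise_neighbours_def phi_def)
  next
    case 5
    then show ?thesis unfolding clockwise_next_def
      by (intro exI[of _ 1]) (simp add: p clockwise_neighbours_def phi_def)
  next
    case 6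
    then show ?thesis unfolding clockwise_next_def
      by (intro exI[of _ 4]) (simp add: p clockwise_neighbours_def phi_def)
  qed
qed

lemma spin_phi:
  assumes n: "n \<ge> 1" and s: "spin n G G'"
  shows "clockwise_spin n (phi_edges n G) (phi_edges n G')"
proof -
  obtain p u where pu: "grove n G" "grove n G'" "{p, u} \<in> G" "cw_next p u \<in> tri n" "{p, cw_next p u} \<notin> G"
    "G' = insert {p, cw_next p u} (G - {{p, u}})"
    using s unfolding spin_def by blast
  note ge = grove_edge[OF pu(1,3)]
  have sg: "simplified_grove n (phi_edges n G)" "simplified_grove n (phi_edges n G')"
    using simplified_grove_phi[OF n grove_pairs[OF pu(1)]] simplified_grove_phi[OF n grove_pairs[OF pu(2)]] pu(1,2)
    by blast+
  have "phi_edges n G' = phi_edges n G - {{phi n p, phi n u}} \<union> {{phi n p, phi n (cw_next p u)}}"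
    unfolding pu(6) image_insert phi_edges_remove by simp
  then have "clockwise_spin_at n (phi n p) (phi_edges n G) (phi_edges n G')"
    unfolding clockwise_spin_at_def
    using sg clockwise_next_phi[OF ge(3), of n] pu(3-5) ge(1,2) phi_tri phi_pair by metis
  then show ?thesis unfolding clockwise_spin_def by blast
qed

theorem theorem4:
  fixes n :: nat and G :: "point set set"
  assumes "n \<ge> 1" and "simplified_grove n G"
  shows "\<exists>(k::nat) (Gs :: nat \<Rightarrow> point set set).
           Gs 0 = G \<and>
           (\<forall>t\<le>k. simplified_grove n (Gs t)) \<and>
           (\<forall>t<k. clockwise_spin n (Gs t) (Gs (Suc t))) \<and>
           Gs k = target_grove n"
proof -
  \<comment> \<open>The given grove is pulled back along \<open>phi\<close>: each lattice edge is
    the image of a pair.\<close>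
  have "G \<subseteq> phi_edges n {e. \<exists>p q. e = {p, q}}"
  proof
    fix e assume e: "e \<in> G"
    have "e \<in> lattice_edges n"
      using conjunct1[OF assms(2)[unfolded simplified_grove_def]] e by (rule subsetD)
    then obtain x y where xy: "e = {x, y}" "x \<in> phi n ` tri n" "y \<in> phi n ` tri n"
      unfolding phi_tri_eq lattice_edges_def by blast
    then obtain p q where "x = phi n p" "y = phi n q" by blast
    then have e: "e = phi n ` {p, q}" using xy(1) by simp
    show "e \<in> phi_edges n {e. \<exists>p q. e = {p, q}}" unfolding e by (rule imageI) blast
  qed
  then obtain F where F: "F \<subseteq> {e. \<exists>p q. e = {p, q}}" "G = phi_edges n F" by (rule subset_imageE)
  have pairs: "pairs F" using F(1) unfolding pairs_def by blast
  have gF: "grove n F" using simplified_grove_phi[OF assms(1) pairs] assms(2) F(2) by simp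
  obtain k where "(spin n ^^ k) F (target_beyond n (- 1))"
    using rtranclp_imp_relpowp[OF reach_target[OF gF]] by blast
  then obtain f where f: "f 0 = F" "f k = target_beyond n (- 1)" "\<forall>i<k. spin n (f i) (f (Suc i))"
    unfolding relpowp_fun_conv by blast
  have gf: "grove n (f t)" if "t \<le> k" for t
  proof (cases t)
    case 0
    then show ?thesis using f(1) gF by simp
  next
    case (Suc s)
    then have "spin n (f s) (f t)" using f(3) that by simp
    then show ?thesis by (simp add: spin_def)
  qed
  have sg: "simplified_grove n (phi_edges n (f t))" if "t \<le> k" for t
    using simplified_grove_phi[OF assms(1) grove_pairs[OF gf[OF that]]] gf[OF that] by simp
  show ?thesis
  proof (intro exI[of _ k] exI[of _ "\<lambda>t. phi_edges n (f t)"] conjI allI impI)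
    show "phi_edges n (f 0) = G" using f(1) F(2) by simp
    show "phi_edges n (f k) = target_grove n" using f(2) target_phi by simp
    show "simplified_grove n (phi_edges n (f t))" if "t \<le> k" for t by (rule sg[OF that])
    show "clockwise_spin n (phi_edges n (f t)) (phi_edges n (f (Suc t)))" if "t < k" for t
      using spin_phi[OF assms(1)] f(3) that by blast
  qed
qed

end
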